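(* Each of the groups $H(2^{\mathbb N})$, $H(2^{\mathbb N},\sigma)$, $\mathrm{Aut}(X,\mu)$, and $\mathrm{Aut}(\mathbb N^{<\mathbb N})$ has cyclically dense conjugacy classes and is topologically 2-generated.
   Context: A Polish group $G$ has cyclically dense conjugacy classes if there are $g,h\in G$ such that $\{g^nhg^{-n}\}_{n\in\mathbb Z}$ is dense in $G$. $G$ is topologically 2-generated if it has a dense subgroup generated by two elements. $H(2^{\mathbb N})$ is the homeomorphism group of the Cantor space and $H(2^{\mathbb N},\sigma)$ its subgroup of homeomorphisms preserving the usual product measure $\sigma$ (product of the uniform measure on $\{0,1\}$), both with the uniform convergence topology. $(X,\mu)$ is a standard Borel space with a non-atomic Borel probability measure, and $\mathrm{Aut}(X,\mu)$ is the group of measure preserving automorphisms, modulo equality almost everywhere, with its usual (weak) Polish topology, the weakest making $T\mapsto\mu(T(A)\,\triangle\,B)$ continuous for all Borel $A,B\subseteq X$. $\mathbb N^{<\mathbb N}$ is the rooted tree of finite sequences of natural numbers, and $\mathrm{Aut}(\mathbb N^{<\mathbb N})$ its automorphism group (fixing the root) with the pointwise convergence topology. *)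

theory Defs
  imports "HOL-Probability.Probability" "HOL-Algebra.Bij" "HOL-Algebra.Generated_Groups"
begin

section \<open>Dense conjugacy classes and topological generation\<close>

text \<open>A topological group is given by a group \<open>G\<close> together with a topology \<open>T\<close> whose
  underlying set is the carrier of \<open>G\<close>.\<close>

definition cyclically_dense_conjugacy_classes ::
    "('a, 'b) monoid_scheme \<Rightarrow> 'a topology \<Rightarrow> bool" where
  "cyclically_dense_conjugacy_classes G T \<longleftrightarrow>
    (\<exists>g\<in>carrier G. \<exists>h\<in>carrier G.
       T closure_of (range (\<lambda>n::int. (g [^]\<^bsub>G\<^esub> n) \<otimes>\<^bsub>G\<^esub> h \<otimes>\<^bsub>G\<^esub> (g [^]\<^bsub>G\<^esub> (- n)))) = topspace T)"

definition topologically_2_generated ::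
    "('a, 'b) monoid_scheme \<Rightarrow> 'a topology \<Rightarrow> bool" where
  "topologically_2_generated G T \<longleftrightarrow>
    (\<exists>a\<in>carrier G. \<exists>b\<in>carrier G. T closure_of (generate G {a, b}) = topspace T)"

text \<open>The groups below are (quotients of) subgroups of the group of all bijections of a set.\<close>

lemma subgroup_BijGroupI:
  assumes "H \<subseteq> Bij S" "(\<lambda>x\<in>S. x) \<in> H"
    and "\<And>f g. f \<in> H \<Longrightarrow> g \<in> H \<Longrightarrow> compose S f g \<in> H"
    and "\<And>f. f \<in> H \<Longrightarrow> (\<lambda>x\<in>S. inv_into S f x) \<in> H"
  shows "subgroup H (BijGroup S)"
proof
  show "H \<subseteq> carrier (BijGroup S)"
    using assms(1) by (simp add: BijGroup_def)
  fix x y assume "x \<in> H" "y \<in> H"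
  then have "x \<otimes>\<^bsub>BijGroup S\<^esub> y = compose S x y"
    using assms(1) by (auto simp: BijGroup_def)
  then show "x \<otimes>\<^bsub>BijGroup S\<^esub> y \<in> H"
    using assms(3) \<open>x \<in> H\<close> \<open>y \<in> H\<close> by simp
next
  show "\<one>\<^bsub>BijGroup S\<^esub> \<in> H"
    using assms(2) by (simp add: BijGroup_def)
next
  fix x assume "x \<in> H"
  then have "inv\<^bsub>BijGroup S\<^esub> x = (\<lambda>y\<in>S. inv_into S x y)"
    using assms(1) inv_BijGroup by blast
  then show "inv\<^bsub>BijGroup S\<^esub> x \<in> H"
    using assms(4) \<open>x \<in> H\<close> by simp
qed

lemma group_BijGroup_restrict:
  "subgroup H (BijGroup S) \<Longrightarrow> group (BijGroup S \<lparr>carrier := H\<rparr>)"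
  by (rule subgroup.subgroup_is_group[OF _ group_BijGroup])


section \<open>Measure preserving maps\<close>

definition measure_preserving_map :: "'a measure \<Rightarrow> ('a \<Rightarrow> 'a) \<Rightarrow> bool" where
  "measure_preserving_map M f \<longleftrightarrow>
     f \<in> M \<rightarrow>\<^sub>M M \<and> (\<forall>A\<in>sets M. emeasure M (f -` A \<inter> space M) = emeasure M A)"

lemma measure_preserving_map_distr:
  "measure_preserving_map M f \<longleftrightarrow> f \<in> M \<rightarrow>\<^sub>M M \<and> distr M M f = M"
proof
  assume "measure_preserving_map M f"
  then show "f \<in> M \<rightarrow>\<^sub>M M \<and> distr M M f = M"
    by (auto simp: measure_preserving_map_def emeasure_distr intro!: measure_eqI)
next
  assume "f \<in> M \<rightarrow>\<^sub>M M \<and> distr M M f = M"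
  then show "measure_preserving_map M f"
    by (metis emeasure_distr measure_preserving_map_def)
qed

lemma measure_preserving_map_id: "measure_preserving_map M (\<lambda>x\<in>space M. x)"
proof -
  have "(\<lambda>x\<in>space M. x) \<in> M \<rightarrow>\<^sub>M M"
    by (subst measurable_cong[where g = "\<lambda>x. x"]) auto
  moreover have "distr M M (\<lambda>x\<in>space M. x) = distr M M (\<lambda>x. x)"
    by (rule distr_cong) simp_all
  ultimately show ?thesis
    by (simp add: measure_preserving_map_distr)
qed

lemma measure_preserving_map_compose:
  assumes "measure_preserving_map M f" "measure_preserving_map M g"
  shows "measure_preserving_map M (compose (space M) f g)"
proof -
  have fg: "f \<in> M \<rightarrow>\<^sub>M M" "g \<in> M \<rightarrow>\<^sub>M M" "distr M M f = M" "distr M M g = M"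
    using assms by (auto simp: measure_preserving_map_distr)
  have "f \<circ> g \<in> M \<rightarrow>\<^sub>M M" "distr M M (f \<circ> g) = M"
    using fg by (auto simp flip: distr_distr)
  moreover have "compose (space M) f g \<in> M \<rightarrow>\<^sub>M M \<longleftrightarrow> f \<circ> g \<in> M \<rightarrow>\<^sub>M M"
    by (rule measurable_cong) (simp add: compose_def)
  moreover have "distr M M (compose (space M) f g) = distr M M (f \<circ> g)"
    by (rule distr_cong) (simp_all add: compose_def)
  ultimately show ?thesis
    by (simp add: measure_preserving_map_distr)
qed

lemma measure_preserving_map_inverse:
  assumes "measure_preserving_map M f" "bij_betw f (space M) (space M)"
    and "inv_into (space M) f \<in> M \<rightarrow>\<^sub>M M"
  shows "measure_preserving_map M (\<lambda>x\<in>space M. inv_into (space M) f x)"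
proof -
  let ?g = "inv_into (space M) f"
  have f: "f \<in> M \<rightarrow>\<^sub>M M" "distr M M f = M"
    using assms(1) by (auto simp: measure_preserving_map_distr)
  have "distr M M ?g = distr (distr M M f) M ?g"
    using f by simp
  also have "\<dots> = distr M M (?g \<circ> f)"
    using f(1) assms(3) by (rule distr_distr[rotated])
  also have "\<dots> = distr M M (\<lambda>x. x)"
    using assms(2) by (intro distr_cong) (auto simp: bij_betw_def)
  finally have "distr M M ?g = M"
    by simp
  moreover have "distr M M (\<lambda>x\<in>space M. ?g x) = distr M M ?g"
    by (rule distr_cong) simp_all
  moreover have "(\<lambda>x\<in>space M. ?g x) \<in> M \<rightarrow>\<^sub>M M"
    using assms(3) by (subst measurable_cong[where g = "?g"]) simp_all
  ultimately show ?thesis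
    by (simp add: measure_preserving_map_distr)
qed


section \<open>Homeomorphisms of the Cantor space\<close>

definition cantor_space :: "(nat \<Rightarrow> bool) topology" where
  "cantor_space = product_topology (\<lambda>_. discrete_topology UNIV) UNIV"

definition cantor_dist :: "(nat \<Rightarrow> bool) \<Rightarrow> (nat \<Rightarrow> bool) \<Rightarrow> real" where
  "cantor_dist x y = (if x = y then 0 else (1/2) ^ (LEAST n. x n \<noteq> y n))"

definition cantor_metric :: "(nat \<Rightarrow> bool) metric" where
  "cantor_metric = metric (UNIV, cantor_dist)"

definition cantor_measure :: "(nat \<Rightarrow> bool) measure" where
  "cantor_measure = PiM UNIV (\<lambda>_. uniform_count_measure (UNIV :: bool set))"

definition H_cantor :: "((nat \<Rightarrow> bool) \<Rightarrow> (nat \<Rightarrow> bool)) monoid" where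
  "H_cantor = BijGroup UNIV \<lparr>carrier := {f. homeomorphic_map cantor_space cantor_space f}\<rparr>"

definition H_cantor_measure :: "((nat \<Rightarrow> bool) \<Rightarrow> (nat \<Rightarrow> bool)) monoid" where
  "H_cantor_measure = BijGroup UNIV \<lparr>carrier :=
     {f. homeomorphic_map cantor_space cantor_space f \<and> measure_preserving_map cantor_measure f}\<rparr>"

text \<open>\<^term>\<open>funspace UNIV m\<close> carries the supremum metric. The Cantor space being compact, the
  topology of uniform convergence does not depend on the choice of the compatible metric
  \<^const>\<open>cantor_metric\<close>.\<close>

definition uniform_convergence_topology ::
    "((nat \<Rightarrow> bool) \<Rightarrow> (nat \<Rightarrow> bool)) set \<Rightarrow> ((nat \<Rightarrow> bool) \<Rightarrow> (nat \<Rightarrow> bool)) topology" where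
  "uniform_convergence_topology H = subtopology (mtopology_of (funspace UNIV cantor_metric)) H"

lemma topspace_cantor_space [simp]: "topspace cantor_space = UNIV"
  by (simp add: cantor_space_def)

lemma space_cantor_measure [simp]: "space cantor_measure = UNIV"
  by (auto simp: cantor_measure_def space_PiM space_uniform_count_measure PiE_UNIV_domain)

lemma cantor_dist_less_iff: "cantor_dist x y < (1/2) ^ n \<longleftrightarrow> (\<forall>i\<le>n. x i = y i)"
proof (cases "x = y")
  case False
  define k where "k = (LEAST n. x n \<noteq> y n)"
  have k: "x k \<noteq> y k"
    using False LeastI_ex[of "\<lambda>n. x n \<noteq> y n"] unfolding k_def by blast
  have less: "x i = y i" if "i < k" for i
    using that not_less_Least unfolding k_def by blast
  have "cantor_dist x y = (1/2) ^ k"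
    using False by (simp add: cantor_dist_def k_def)
  then have "cantor_dist x y < (1/2) ^ n \<longleftrightarrow> n < k"
    by simp
  also have "\<dots> \<longleftrightarrow> (\<forall>i\<le>n. x i = y i)"
    using k less by (metis le_less_trans not_less)
  finally show ?thesis .
qed (simp add: cantor_dist_def)

lemma cantor_dist_le_1: "cantor_dist x y \<le> 1"
  by (simp add: cantor_dist_def power_le_one)

lemma cantor_dist_ultra: "cantor_dist x z \<le> max (cantor_dist x y) (cantor_dist y z)"
proof (cases "x = z")
  case False
  define k where "k = (LEAST n. x n \<noteq> z n)"
  have "x k \<noteq> z k"
    using False LeastI_ex[of "\<lambda>n. x n \<noteq> z n"] unfolding k_def by blast
  then have "\<not> (cantor_dist x y < (1/2) ^ k \<and> cantor_dist y z < (1/2) ^ k)"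
    unfolding cantor_dist_less_iff by auto
  moreover have "cantor_dist x z = (1/2) ^ k"
    using False by (simp add: cantor_dist_def k_def)
  ultimately show ?thesis
    by auto
qed (auto simp: cantor_dist_def le_max_iff_disj)

lemma Metric_space_cantor: "Metric_space UNIV cantor_dist"
proof
  fix x y z
  show nonneg: "0 \<le> cantor_dist x y" for x y
    by (simp add: cantor_dist_def)
  show "cantor_dist x y = cantor_dist y x"
    by (auto simp: cantor_dist_def eq_commute)
  show "cantor_dist x y = 0 \<longleftrightarrow> x = y"
    by (simp add: cantor_dist_def)
  show "cantor_dist x z \<le> cantor_dist x y + cantor_dist y z"
    using cantor_dist_ultra[of x z y] nonneg[of x y] nonneg[of y z] by linarith
qed

lemma mspace_cantor_metric [simp]: "mspace cantor_metric = UNIV"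
  and mdist_cantor_metric [simp]: "mdist cantor_metric = cantor_dist"
  by (simp_all add: cantor_metric_def Metric_space.mspace_metric[OF Metric_space_cantor]
      Metric_space.mdist_metric[OF Metric_space_cantor])

lemma mtopology_of_cantor_metric: "mtopology_of cantor_metric = cantor_space"
proof -
  interpret Metric_space UNIV cantor_dist
    by (rule Metric_space_cantor)
  have ball: "mball x ((1/2) ^ n) = {y. \<forall>i\<le>n. x i = y i}" for x n
    by (auto simp: cantor_dist_less_iff)
  have "openin mtopology U \<longleftrightarrow> openin cantor_space U" for U
  proof
    assume U: "openin mtopology U"
    have "\<exists>V. finite {i. V i \<noteq> (UNIV :: bool set)} \<and> x \<in> PiE UNIV V \<and> PiE UNIV V \<subseteq> U"
      if x: "x \<in> U" for x
    proof -
      obtain r where r: "r > 0" "mball x r \<subseteq> U"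
        using U x unfolding openin_mtopology by meson
      obtain n where "(1/2 :: real) ^ n < r"
        using real_arch_pow_inv[OF r(1), of "1/2"] by auto
      then have n: "mball x ((1/2) ^ n) \<subseteq> U"
        using r(2) mball_subset_concentric[of "(1/2) ^ n" r x] by auto
      define V where "V i = (if i \<le> n then {x i} else UNIV)" for i
      have "{i. V i \<noteq> UNIV} \<subseteq> {..n}"
        by (auto simp: V_def)
      then have "finite {i. V i \<noteq> UNIV}"
        using finite_subset by blast
      moreover have "x \<in> PiE UNIV V"
        by (simp add: V_def PiE_UNIV_domain)
      moreover have "PiE UNIV V \<subseteq> U"
      proof
        fix y assume y: "y \<in> PiE UNIV V"
        have "x i = y i" if "i \<le> n" for i
          using PiE_mem[OF y, of i] that by (simp add: V_def)
        then have "y \<in> mball x ((1/2) ^ n)"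
          unfolding ball by blast
        then show "y \<in> U"
          using n by blast
      qed
      ultimately show ?thesis
        by blast
    qed
    then show "openin cantor_space U"
      unfolding cantor_space_def openin_product_topology_alt by auto
  next
    assume U: "openin cantor_space U"
    have "\<exists>r>0. mball x r \<subseteq> U" if x: "x \<in> U" for x
    proof -
      obtain V where V: "finite {i. V i \<noteq> (UNIV :: bool set)}" "x \<in> PiE UNIV V" "PiE UNIV V \<subseteq> U"
        using U x unfolding cantor_space_def openin_product_topology_alt by auto
      obtain n where n: "\<And>i. V i \<noteq> UNIV \<Longrightarrow> i \<le> n"
        using V(1) unfolding finite_nat_set_iff_bounded_le by auto
      have "mball x ((1/2) ^ n) \<subseteq> PiE UNIV V"
      proof
        fix y assume "y \<in> mball x ((1/2) ^ n)"
        then have y: "y i = x i" if "i \<le> n" for i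
          using that unfolding ball by auto
        have "y i \<in> V i" for i
        proof (cases "V i = UNIV")
          case False
          then show ?thesis
            using y[OF n] PiE_mem[OF V(2), of i] by simp
        qed simp
        then show "y \<in> PiE UNIV V"
          by (simp add: PiE_UNIV_domain)
      qed
      then show ?thesis
        using V(3) by (intro exI[of _ "(1/2) ^ n"]) auto
    qed
    then show "openin mtopology U"
      by (auto simp: openin_mtopology)
  qed
  then have "mtopology = cantor_space"
    by (simp add: topology_eq)
  then show ?thesis
    by (simp add: mtopology_of_def)
qed

lemma topspace_uniform_convergence_topology [simp]:
  "topspace (uniform_convergence_topology H) = H"
proof -
  have "Metric_space.mbounded UNIV cantor_dist A" for A
    unfolding Metric_space.mbounded_def[OF Metric_space_cantor]
    by (rule exI[of _ undefined], rule exI[of _ 1])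
      (auto simp: Metric_space.in_mcball[OF Metric_space_cantor] cantor_dist_le_1)
  then have "mspace (funspace (UNIV :: (nat \<Rightarrow> bool) set) cantor_metric) = UNIV"
    by (simp add: Metric_space.fspace_def[OF Metric_space_cantor] flip: Metric_space.fspace_def)
  then show ?thesis
    by (simp add: uniform_convergence_topology_def)
qed

lemma homeo_bij:
  "homeomorphic_map cantor_space cantor_space f \<Longrightarrow> bij_betw f UNIV UNIV"
  using homeomorphic_imp_injective_map homeomorphic_imp_surjective_map
  by (fastforce simp: bij_betw_def)

lemma homeo_inv:
  assumes "homeomorphic_map cantor_space cantor_space f"
  shows "homeomorphic_map cantor_space cantor_space (inv_into UNIV f)"
proof -
  obtain g where g: "homeomorphic_maps cantor_space cantor_space f g"
    using assms homeomorphic_map_maps by blast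
  then have "inv_into UNIV f = g"
    by (intro Hilbert_Choice.inv_equality) (auto simp: homeomorphic_maps_def)
  then show ?thesis
    using g by (auto simp: homeomorphic_maps_map)
qed

lemma subgroup_homeo: "subgroup {f. homeomorphic_map cantor_space cantor_space f} (BijGroup UNIV)"
proof (rule subgroup_BijGroupI)
  show "{f. homeomorphic_map cantor_space cantor_space f} \<subseteq> Bij UNIV"
    using homeo_bij by (auto simp: Bij_def)
next
  fix f g assume "f \<in> {f. homeomorphic_map cantor_space cantor_space f}"
    "g \<in> {f. homeomorphic_map cantor_space cantor_space f}"
  then have "homeomorphic_map cantor_space cantor_space (f \<circ> g)"
    using homeomorphic_map_compose by blast
  then show "compose UNIV f g \<in> {f. homeomorphic_map cantor_space cantor_space f}"
    by (simp add: compose_def o_def restrict_UNIV)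
qed (use homeo_inv in \<open>auto simp: homeomorphic_map_id[unfolded id_def] restrict_UNIV\<close>)

lemma group_H_cantor: "group H_cantor"
  unfolding H_cantor_def by (rule group_BijGroup_restrict[OF subgroup_homeo])


instance bool :: second_countable_topology
proof
  have "open = generate_topology (UNIV :: bool set set)"
    by (auto simp: fun_eq_iff discrete_topology_class.open_discrete intro: generate_topology.Basis)
  then show "\<exists>B::bool set set. countable B \<and> open = generate_topology B"
    using countable_finite[OF finite] by blast
qed

lemma homeo_measurable:
  assumes "homeomorphic_map cantor_space cantor_space f"
  shows "f \<in> cantor_measure \<rightarrow>\<^sub>M cantor_measure"
proof -
  have euclidean: "cantor_space = euclidean"
  proof -
    have "discrete_topology UNIV = (euclidean :: bool topology)"
      by (simp add: topology_eq discrete_topology_class.open_discrete)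
    then show ?thesis
      by (simp add: cantor_space_def euclidean_product_topology)
  qed
  have sets: "sets cantor_measure = sets (borel :: (nat \<Rightarrow> bool) measure)"
  proof -
    have "sets (uniform_count_measure (UNIV :: bool set)) = sets borel"
      by (simp add: sets_uniform_count_measure sets_borel_eq_count_space)
    then have "sets cantor_measure = sets (PiM UNIV (\<lambda>_::nat. borel :: bool measure))"
      unfolding cantor_measure_def by (intro sets_PiM_cong) auto
    then show ?thesis
      using sets_PiM_equal_borel by metis
  qed
  have "continuous_on UNIV f"
    using homeomorphic_imp_continuous_map[OF assms] by (simp add: euclidean)
  then have "f \<in> borel_measurable borel"
    by (rule borel_measurable_continuous_onI)
  then show ?thesis
    using measurable_cong_sets[OF sets sets] by auto
qed

lemma subgroup_homeo_measure:
  "subgroup {f. homeomorphic_map cantor_space cantor_space f \<and>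
                measure_preserving_map cantor_measure f} (BijGroup UNIV)"
proof (rule subgroup_BijGroupI)
  let ?H = "{f. homeomorphic_map cantor_space cantor_space f \<and>
                measure_preserving_map cantor_measure f}"
  show "?H \<subseteq> Bij UNIV"
    using homeo_bij by (auto simp: Bij_def)
  show "(\<lambda>x\<in>UNIV. x) \<in> ?H"
    using measure_preserving_map_id[of cantor_measure] subgroup.one_closed[OF subgroup_homeo]
    by (simp add: BijGroup_def)
next
  let ?H = "{f. homeomorphic_map cantor_space cantor_space f \<and>
                measure_preserving_map cantor_measure f}"
  fix f g assume fg: "f \<in> ?H" "g \<in> ?H"
  then have "homeomorphic_map cantor_space cantor_space (f \<circ> g)"
    using homeomorphic_map_compose by blast
  then have "homeomorphic_map cantor_space cantor_space (compose UNIV f g)"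
    by (simp add: compose_def o_def restrict_UNIV)
  then show "compose UNIV f g \<in> ?H"
    using fg measure_preserving_map_compose[of cantor_measure f g] by simp
next
  let ?H = "{f. homeomorphic_map cantor_space cantor_space f \<and>
                measure_preserving_map cantor_measure f}"
  fix f assume f: "f \<in> ?H"
  have "inv_into UNIV f \<in> cantor_measure \<rightarrow>\<^sub>M cantor_measure"
    using f homeo_inv homeo_measurable by blast
  then have "measure_preserving_map cantor_measure (\<lambda>x\<in>UNIV. inv_into UNIV f x)"
    using f homeo_bij measure_preserving_map_inverse[of cantor_measure f] by simp
  moreover have "homeomorphic_map cantor_space cantor_space (\<lambda>x\<in>UNIV. inv_into UNIV f x)"
    using f homeo_inv[of f] by (simp add: restrict_UNIV)
  ultimately show "(\<lambda>x\<in>UNIV. inv_into UNIV f x) \<in> ?H"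
    by simp
qed

lemma group_H_cantor_measure: "group H_cantor_measure"
  unfolding H_cantor_measure_def by (rule group_BijGroup_restrict[OF subgroup_homeo_measure])


section \<open>The automorphism group of a standard non-atomic probability space\<close>

definition Polish_topology :: "'a topology \<Rightarrow> bool" where
  "Polish_topology T \<longleftrightarrow> completely_metrizable_space T \<and> separable_space T"

definition standard_Borel :: "'a measure \<Rightarrow> bool" where
  "standard_Borel M \<longleftrightarrow>
     (\<exists>T. Polish_topology T \<and> topspace T = space M \<and> sets M = sigma_sets (space M) {U. openin T U})"

definition non_atomic :: "'a measure \<Rightarrow> bool" where
  "non_atomic M \<longleftrightarrow>
     \<not> (\<exists>A\<in>sets M. emeasure M A > 0 \<and>
          (\<forall>B\<in>sets M. B \<subseteq> A \<longrightarrow> emeasure M B = 0 \<or> emeasure M B = emeasure M A))"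

definition measure_automorphisms :: "'a measure \<Rightarrow> ('a \<Rightarrow> 'a) set" where
  "measure_automorphisms M =
     {f \<in> Bij (space M). measure_preserving_map M f \<and> inv_into (space M) f \<in> M \<rightarrow>\<^sub>M M}"

definition MPT :: "'a measure \<Rightarrow> ('a \<Rightarrow> 'a) monoid" where
  "MPT M = BijGroup (space M) \<lparr>carrier := measure_automorphisms M\<rparr>"

definition AE_trivial :: "'a measure \<Rightarrow> ('a \<Rightarrow> 'a) set" where
  "AE_trivial M = {f \<in> measure_automorphisms M. AE x in M. f x = x}"

text \<open>The elements of \<open>Aut M\<close> are the cosets of \<^term>\<open>AE_trivial M\<close>, i.e. the classes of
  automorphisms modulo equality almost everywhere, see \<open>MPT_coset_eq_iff\<close> below.\<close>

definition Aut :: "'a measure \<Rightarrow> ('a \<Rightarrow> 'a) set monoid" where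
  "Aut M = MPT M Mod AE_trivial M"

text \<open>\<open>\<mu>(T(A) \<triangle> B)\<close> for a class \<open>T\<close>; it does not depend on the representative, see
  \<open>Aut_diff_eq\<close> below.\<close>

definition Aut_diff :: "'a measure \<Rightarrow> 'a set \<Rightarrow> 'a set \<Rightarrow> ('a \<Rightarrow> 'a) set \<Rightarrow> real" where
  "Aut_diff M A B T = measure M (sym_diff ((SOME f. f \<in> T) ` A) B)"

definition Aut_topology :: "'a measure \<Rightarrow> ('a \<Rightarrow> 'a) set topology" where
  "Aut_topology M = topology_generated_by
     {{T \<in> carrier (Aut M). Aut_diff M A B T \<in> U} | A B U. A \<in> sets M \<and> B \<in> sets M \<and> open U}"

lemma measure_automorphismsD:
  assumes "f \<in> measure_automorphisms M"
  shows "f \<in> Bij (space M)" "bij_betw f (space M) (space M)" "measure_preserving_map M f"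
    "f \<in> M \<rightarrow>\<^sub>M M" "distr M M f = M" "inv_into (space M) f \<in> M \<rightarrow>\<^sub>M M"
  using assms by (auto simp: measure_automorphisms_def Bij_def measure_preserving_map_distr)

lemma inv_into_restrict_inv_into:
  assumes "f \<in> Bij S" "x \<in> S"
  shows "inv_into S (\<lambda>x\<in>S. inv_into S f x) x = f x"
proof (rule inv_into_f_eq)
  have b: "bij_betw f S S"
    using assms by (simp add: Bij_def)
  then have "bij_betw (inv_into S f) S S"
    by (rule bij_betw_inv_into)
  then show "inj_on (\<lambda>x\<in>S. inv_into S f x) S"
    by (simp add: bij_betw_def inj_on_def)
  show "f x \<in> S"
    using b assms(2) by (auto simp: bij_betw_def)
  then show "(\<lambda>x\<in>S. inv_into S f x) (f x) = x"
    using b assms(2) by (simp add: bij_betw_def)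
qed

lemma subgroup_measure_automorphisms:
  "subgroup (measure_automorphisms M) (BijGroup (space M))"
proof (rule subgroup_BijGroupI)
  let ?S = "space M"
  show "measure_automorphisms M \<subseteq> Bij ?S"
    by (auto simp: measure_automorphisms_def)
  have "inv_into ?S (\<lambda>x\<in>?S. x) x = x" if "x \<in> ?S" for x
    using that by (intro inv_into_f_eq) auto
  then have "inv_into ?S (\<lambda>x\<in>?S. x) \<in> M \<rightarrow>\<^sub>M M"
    by (subst measurable_cong[where g = "\<lambda>x. x"]) auto
  then show "(\<lambda>x\<in>?S. x) \<in> measure_automorphisms M"
    by (simp add: measure_automorphisms_def id_Bij measure_preserving_map_id)
next
  let ?S = "space M"
  fix f g assume fg: "f \<in> measure_automorphisms M" "g \<in> measure_automorphisms M"
  note f = measure_automorphismsD[OF fg(1)] and g = measure_automorphismsD[OF fg(2)]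
  have c: "compose ?S f g \<in> Bij ?S"
    using f(1) g(1) by (rule compose_Bij)
  have inv: "inv_into ?S (compose ?S f g) x = (inv_into ?S g \<circ> inv_into ?S f) x" if "x \<in> ?S" for x
  proof (rule inv_into_f_eq)
    show "inj_on (compose ?S f g) ?S"
      using c by (simp add: Bij_def bij_betw_def)
    have "inv_into ?S f x \<in> ?S" "f (inv_into ?S f x) = x"
      using that f(2) by (auto simp: bij_betw_def inv_into_into f_inv_into_f)
    moreover have "inv_into ?S g y \<in> ?S" "g (inv_into ?S g y) = y" if "y \<in> ?S" for y
      using that g(2) by (auto simp: bij_betw_def inv_into_into f_inv_into_f)
    ultimately show "(inv_into ?S g \<circ> inv_into ?S f) x \<in> ?S"
      "compose ?S f g ((inv_into ?S g \<circ> inv_into ?S f) x) = x"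
      by (auto simp: compose_def)
  qed
  have "inv_into ?S g \<circ> inv_into ?S f \<in> M \<rightarrow>\<^sub>M M"
    using f(6) g(6) by (rule measurable_comp)
  then have "inv_into ?S (compose ?S f g) \<in> M \<rightarrow>\<^sub>M M"
    using inv by (subst measurable_cong[where g = "inv_into ?S g \<circ> inv_into ?S f"]) auto
  then show "compose ?S f g \<in> measure_automorphisms M"
    using c measure_preserving_map_compose[OF f(3) g(3)] by (simp add: measure_automorphisms_def)
next
  let ?S = "space M"
  fix f assume f': "f \<in> measure_automorphisms M"
  note f = measure_automorphismsD[OF f']
  have "inv_into ?S (\<lambda>x\<in>?S. inv_into ?S f x) \<in> M \<rightarrow>\<^sub>M M"
    using f(4) inv_into_restrict_inv_into[OF f(1)] by (subst measurable_cong[where g = f]) auto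
  then show "(\<lambda>x\<in>?S. inv_into ?S f x) \<in> measure_automorphisms M"
    using restrict_inv_into_Bij[OF f(1)] measure_preserving_map_inverse[OF f(3,2,6)]
    by (simp add: measure_automorphisms_def)
qed

lemma group_MPT: "group (MPT M)"
  unfolding MPT_def by (rule group_BijGroup_restrict[OF subgroup_measure_automorphisms])

lemma carrier_MPT [simp]: "carrier (MPT M) = measure_automorphisms M"
  by (simp add: MPT_def)

lemma one_MPT [simp]: "\<one>\<^bsub>MPT M\<^esub> = (\<lambda>x\<in>space M. x)"
  by (simp add: MPT_def BijGroup_def)

lemma mult_MPT:
  "f \<in> measure_automorphisms M \<Longrightarrow> g \<in> measure_automorphisms M \<Longrightarrow>
    f \<otimes>\<^bsub>MPT M\<^esub> g = compose (space M) f g"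
  by (simp add: MPT_def BijGroup_def measure_automorphisms_def)

lemma inv_MPT:
  assumes "f \<in> measure_automorphisms M"
  shows "inv\<^bsub>MPT M\<^esub> f = (\<lambda>x\<in>space M. inv_into (space M) f x)"
  unfolding MPT_def
  using assms group.m_inv_consistent[OF group_BijGroup subgroup_measure_automorphisms]
    inv_BijGroup[OF measure_automorphismsD(1)] by metis

lemma AE_measure_preserving:
  assumes "measure_preserving_map M f" "AE x in M. P x"
  shows "AE x in M. P (f x)"
proof (rule AE_distrD[of f M M P])
  show "f \<in> M \<rightarrow>\<^sub>M M"
    using assms(1) by (simp add: measure_preserving_map_distr)
  have d: "distr M M f = M"
    using assms(1) by (simp add: measure_preserving_map_distr)
  show "AE x in distr M M f. P x"
    unfolding d by (rule assms(2))
qed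

lemma AE_trivialI:
  "f \<in> measure_automorphisms M \<Longrightarrow> AE x in M. f x = x \<Longrightarrow> f \<in> AE_trivial M"
  by (simp add: AE_trivial_def)

lemma normal_AE_trivial: "AE_trivial M \<lhd> MPT M"
proof -
  interpret group "MPT M" by (rule group_MPT)
  let ?S = "space M"
  have "subgroup (AE_trivial M) (MPT M)"
  proof
    show "AE_trivial M \<subseteq> carrier (MPT M)"
      by (auto simp: AE_trivial_def)
    show "\<one>\<^bsub>MPT M\<^esub> \<in> AE_trivial M"
      using one_closed by (intro AE_trivialI) auto
  next
    fix f g assume fg: "f \<in> AE_trivial M" "g \<in> AE_trivial M"
    then have m: "f \<in> measure_automorphisms M" "g \<in> measure_automorphisms M"
      and ae: "AE x in M. f x = x" "AE x in M. g x = x"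
      by (auto simp: AE_trivial_def)
    have "AE x in M. compose ?S f g x = x"
      using ae AE_space by eventually_elim (simp add: compose_def)
    then show "f \<otimes>\<^bsub>MPT M\<^esub> g \<in> AE_trivial M"
      using m_closed[of f g] m by (intro AE_trivialI) (simp_all add: mult_MPT)
  next
    fix f assume f: "f \<in> AE_trivial M"
    then have m: "f \<in> measure_automorphisms M" and ae: "AE x in M. f x = x"
      by (auto simp: AE_trivial_def)
    have inj: "inj_on f ?S"
      using measure_automorphismsD(2)[OF m] by (simp add: bij_betw_def)
    have "AE x in M. inv_into ?S f x = x"
      using ae AE_space by eventually_elim (simp add: inv_into_f_eq[OF inj])
    then have "AE x in M. (\<lambda>x\<in>?S. inv_into ?S f x) x = x"
      using AE_space by eventually_elim simp
    then show "inv\<^bsub>MPT M\<^esub> f \<in> AE_trivial M"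
      using inv_closed[of f] m by (intro AE_trivialI) (simp_all add: inv_MPT)
  qed
  moreover have "f \<otimes>\<^bsub>MPT M\<^esub> h \<otimes>\<^bsub>MPT M\<^esub> inv\<^bsub>MPT M\<^esub> f \<in> AE_trivial M"
    if f: "f \<in> carrier (MPT M)" and h: "h \<in> AE_trivial M" for f h
  proof -
    let ?g = "inv\<^bsub>MPT M\<^esub> f"
    have m: "f \<in> measure_automorphisms M" "h \<in> measure_automorphisms M"
      and ae: "AE x in M. h x = x"
      using f h by (auto simp: AE_trivial_def)
    have g: "?g \<in> measure_automorphisms M"
      using inv_closed[OF f] by simp
    have fh: "f \<otimes>\<^bsub>MPT M\<^esub> h \<in> measure_automorphisms M"
      using m_closed[of f h] m by simp
    have g_eq: "?g x \<in> ?S" "f (?g x) = x" if "x \<in> ?S" for x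
      using that measure_automorphismsD(2)[OF m(1)]
      by (auto simp: inv_MPT[OF m(1)] bij_betw_def inv_into_into f_inv_into_f)
    have "AE x in M. h (?g x) = ?g x"
      using measure_automorphismsD(3)[OF g] ae by (rule AE_measure_preserving)
    then have "AE x in M. (f \<otimes>\<^bsub>MPT M\<^esub> h \<otimes>\<^bsub>MPT M\<^esub> ?g) x = x"
      using AE_space
      by eventually_elim (simp add: mult_MPT[OF fh g] compose_def g_eq, simp add: mult_MPT[OF m] compose_def g_eq)
    moreover have "f \<otimes>\<^bsub>MPT M\<^esub> h \<otimes>\<^bsub>MPT M\<^esub> ?g \<in> measure_automorphisms M"
      using m_closed[of "f \<otimes>\<^bsub>MPT M\<^esub> h" ?g] fh g by simp
    ultimately show ?thesis
      by (rule AE_trivialI[rotated])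
  qed
  ultimately show ?thesis
    by (simp add: normal_inv_iff del: carrier_MPT)
qed

lemma group_Aut: "group (Aut M)"
  unfolding Aut_def by (rule normal.factorgroup_is_group[OF normal_AE_trivial])

lemma MPT_coset_eq_iff:
  assumes "f \<in> measure_automorphisms M" "g \<in> measure_automorphisms M"
  shows "AE_trivial M #>\<^bsub>MPT M\<^esub> f = AE_trivial M #>\<^bsub>MPT M\<^esub> g \<longleftrightarrow> (AE x in M. f x = g x)"
proof -
  interpret normal "AE_trivial M" "MPT M" by (rule normal_AE_trivial)
  let ?S = "space M" and ?g = "inv\<^bsub>MPT M\<^esub> g"
  have fg: "f \<in> carrier (MPT M)" "g \<in> carrier (MPT M)"
    using assms by simp_all
  have g': "?g \<in> measure_automorphisms M"
    using inv_closed[OF fg(2)] by simp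
  have eq1: "?g x \<in> ?S \<and> g (?g x) = x \<and> g x \<in> ?S \<and> ?g (g x) = x" if "x \<in> ?S" for x
    using that measure_automorphismsD(2)[OF assms(2)]
    by (auto simp: inv_MPT[OF assms(2)] bij_betw_def inv_into_into f_inv_into_f)
  have "AE_trivial M #>\<^bsub>MPT M\<^esub> f = AE_trivial M #>\<^bsub>MPT M\<^esub> g \<longleftrightarrow> f \<in> AE_trivial M #>\<^bsub>MPT M\<^esub> g"
    using fg rcos_self[OF fg(1) is_subgroup] repr_independence[OF _ fg(2) is_subgroup] by auto
  also have "\<dots> \<longleftrightarrow> f \<otimes>\<^bsub>MPT M\<^esub> ?g \<in> AE_trivial M"
    using rcos_module[OF is_group fg(2,1)] .
  also have "\<dots> \<longleftrightarrow> (AE x in M. compose ?S f ?g x = x)"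
    using m_closed[OF fg(1) inv_closed[OF fg(2)]]
    by (simp add: AE_trivial_def mult_MPT[OF assms(1) g'])
  also have "\<dots> \<longleftrightarrow> (AE x in M. f x = g x)"
  proof
    assume "AE x in M. compose ?S f ?g x = x"
    then have "AE x in M. compose ?S f ?g (g x) = g x"
      by (rule AE_measure_preserving[OF measure_automorphismsD(3)[OF assms(2)]])
    then show "AE x in M. f x = g x"
      using AE_space by eventually_elim (simp add: compose_def eq1)
  next
    assume "AE x in M. f x = g x"
    then have "AE x in M. f (?g x) = g (?g x)"
      by (rule AE_measure_preserving[OF measure_automorphismsD(3)[OF g']])
    then show "AE x in M. compose ?S f ?g x = x"
      using AE_space by eventually_elim (simp add: compose_def eq1)
  qed
  finally show ?thesis .
qed

lemma carrier_Aut: "carrier (Aut M) = (\<lambda>f. AE_trivial M #>\<^bsub>MPT M\<^esub> f) ` measure_automorphisms M"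
  by (simp add: Aut_def carrier_FactGroup)

lemma Aut_memD:
  assumes "T \<in> carrier (Aut M)" "f \<in> T"
  shows "f \<in> measure_automorphisms M" "T = AE_trivial M #>\<^bsub>MPT M\<^esub> f"
proof -
  interpret normal "AE_trivial M" "MPT M" by (rule normal_AE_trivial)
  obtain h where h: "h \<in> carrier (MPT M)" "T = AE_trivial M #>\<^bsub>MPT M\<^esub> h"
    using assms(1) by (auto simp: carrier_Aut)
  then have "f \<in> carrier (MPT M)"
    using assms(2) r_coset_subset_G[OF subset] by blast
  then show "f \<in> measure_automorphisms M"
    by simp
  show "T = AE_trivial M #>\<^bsub>MPT M\<^esub> f"
    using h assms(2) repr_independence[OF _ h(1) is_subgroup] by simp
qed

lemma image_measure_automorphism:
  assumes "f \<in> measure_automorphisms M" "A \<in> sets M"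
  shows "f ` A \<in> sets M"
proof -
  have b: "bij_betw f (space M) (space M)" and A: "A \<subseteq> space M"
    using measure_automorphismsD[OF assms(1)] sets.sets_into_space[OF assms(2)] by auto
  have inj: "inj_on f (space M)" and surj: "f ` space M = space M"
    using b by (auto simp: bij_betw_def)
  have "f ` A = inv_into (space M) f -` A \<inter> space M"
  proof (intro equalityI subsetI)
    fix y assume "y \<in> f ` A"
    then obtain a where a: "a \<in> A" "y = f a"
      by blast
    then have "a \<in> space M"
      using A by blast
    then show "y \<in> inv_into (space M) f -` A \<inter> space M"
      using a surj by (auto simp: inv_into_f_f[OF inj])
  next
    fix y assume y: "y \<in> inv_into (space M) f -` A \<inter> space M"
    then have "f (inv_into (space M) f y) = y"
      using surj by (intro f_inv_into_f) simp
    then show "y \<in> f ` A"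
      using y by (metis IntD1 imageI vimageD)
  qed
  then show ?thesis
    using measurable_sets[OF measure_automorphismsD(6)[OF assms(1)] assms(2)] by simp
qed

lemma AE_image_subset:
  fixes f g :: "'a \<Rightarrow> 'a"
  assumes f: "f \<in> measure_automorphisms M" and ae: "AE x in M. f x = g x" and A: "A \<in> sets M"
  shows "AE y in M. y \<in> f ` A \<longrightarrow> y \<in> g ` A"
proof -
  let ?g = "\<lambda>x\<in>space M. inv_into (space M) f x"
  have b: "inj_on f (space M)"
    using measure_automorphismsD(2)[OF f] by (simp add: bij_betw_def)
  have "measure_preserving_map M ?g"
    using measure_automorphismsD[OF f] by (intro measure_preserving_map_inverse)
  then have ae_g: "AE y in M. f (?g y) = g (?g y)"
    using ae by (rule AE_measure_preserving)
  have image: "y \<in> g ` A" if y: "y \<in> f ` A" "y \<in> space M" "f (?g y) = g (?g y)" for y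
  proof -
    obtain a where a: "a \<in> A" "y = f a"
      using y(1) by blast
    have "a \<in> space M"
      using a(1) sets.sets_into_space[OF A] by blast
    then have "?g y = a"
      using b y(2) a(2) by (simp add: inv_into_f_f)
    moreover have "f a = g a"
      using y(3) unfolding \<open>?g y = a\<close> .
    ultimately show ?thesis
      using a by auto
  qed
  show ?thesis
    using ae_g AE_space by eventually_elim (use image in blast)
qed

lemma Aut_diff_eq:
  assumes "T \<in> carrier (Aut M)" "f \<in> T" "A \<in> sets M" "B \<in> sets M"
  shows "Aut_diff M A B T = measure M (sym_diff (f ` A) B)"
proof -
  define g where "g = (SOME f. f \<in> T)"
  have gT: "g \<in> T"
    unfolding g_def by (rule someI[of "\<lambda>f. f \<in> T", OF assms(2)])
  note f = Aut_memD[OF assms(1,2)] and g = Aut_memD[OF assms(1) gT]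
  have ae: "AE x in M. f x = g x"
    using MPT_coset_eq_iff[OF f(1) g(1)] f(2) g(2) by simp
  then have ae': "AE x in M. g x = f x"
    by eventually_elim simp
  have "AE y in M. y \<in> sym_diff (g ` A) B \<longleftrightarrow> y \<in> sym_diff (f ` A) B"
    using AE_image_subset[OF f(1) ae assms(3)] AE_image_subset[OF g(1) ae' assms(3)]
    by eventually_elim auto
  moreover have "f ` A \<in> sets M" "g ` A \<in> sets M"
    using f(1) g(1) assms(3) by (auto intro: image_measure_automorphism)
  ultimately have "measure M (sym_diff (g ` A) B) = measure M (sym_diff (f ` A) B)"
    using assms(4) by (intro measure_eq_AE) auto
  then show ?thesis
    by (simp add: Aut_diff_def g_def)
qed

lemma topspace_Aut_topology [simp]: "topspace (Aut_topology M) = carrier (Aut M)"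
proof -
  have "carrier (Aut M) \<in>
      {{T \<in> carrier (Aut M). Aut_diff M A B T \<in> U} | A B U. A \<in> sets M \<and> B \<in> sets M \<and> open U}"
    by (rule CollectI, rule exI[of _ "{}"], rule exI[of _ "{}"], rule exI[of _ UNIV]) auto
  then show ?thesis
    unfolding Aut_topology_def topology_generated_by_topspace by blast
qed


section \<open>The automorphism group of the infinitely splitting rooted tree\<close>

definition tree_adjacent :: "nat list \<Rightarrow> nat list \<Rightarrow> bool" where
  "tree_adjacent s t \<longleftrightarrow> (\<exists>n. t = s @ [n] \<or> s = t @ [n])"

definition tree_automorphisms :: "(nat list \<Rightarrow> nat list) set" where
  "tree_automorphisms =
     {f. bij f \<and> f [] = [] \<and> (\<forall>s t. tree_adjacent (f s) (f t) \<longleftrightarrow> tree_adjacent s t)}"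

definition Aut_tree :: "(nat list \<Rightarrow> nat list) monoid" where
  "Aut_tree = BijGroup UNIV \<lparr>carrier := tree_automorphisms\<rparr>"

definition Aut_tree_topology :: "(nat list \<Rightarrow> nat list) topology" where
  "Aut_tree_topology =
     subtopology (product_topology (\<lambda>_. discrete_topology UNIV) UNIV) tree_automorphisms"

lemma topspace_Aut_tree_topology [simp]: "topspace Aut_tree_topology = carrier Aut_tree"
  by (simp add: Aut_tree_topology_def Aut_tree_def)

lemma group_Aut_tree: "group Aut_tree"
  unfolding Aut_tree_def
proof (rule group_BijGroup_restrict, rule subgroup_BijGroupI)
  fix f assume f: "f \<in> tree_automorphisms"
  then have "bij (inv_into UNIV f)" "\<And>s. f (inv_into UNIV f s) = s" "inv_into UNIV f [] = []"
    by (auto simp: tree_automorphisms_def bij_imp_bij_inv bij_is_surj surj_f_inv_f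
        intro: inv_f_eq bij_is_inj)
  then show "(\<lambda>x\<in>UNIV. inv_into UNIV f x) \<in> tree_automorphisms"
    using f unfolding tree_automorphisms_def restrict_UNIV by (auto, metis+)
qed (auto simp: tree_automorphisms_def Bij_def compose_def restrict_UNIV
      intro: bij_comp[unfolded o_def] bij_id[unfolded id_def])

end

theory Submission
  imports Defs
begin

text \<open>Density of the conjugates \<open>g\<^sup>n h g\<^sup>-\<^sup>n\<close> already gives topological generation by two elements, since
the subgroup generated by \<open>g\<close> and \<open>h\<close> contains all of them
(\<open>topologically_2_generated_if_cyclically_dense\<close>). So one pair \<open>g\<close>, \<open>h\<close> is needed in each group.

The idea is that of a universal element: \<open>g\<close> is a shift, and \<open>h\<close> performs, on infinitely many
pairwise disjoint regions, a copy of each member of a countable dense family. Shifting the \<open>j\<close>-th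
region back to the origin makes \<open>h\<close> look like the \<open>j\<close>-th member.

To make this precise, take a permutation \<open>\<tau>\<close> of the naturals all of whose orbits are infinite and
which has infinitely many orbits. Given finite sets \<open>F\<^sub>j\<close>, suitable powers of \<open>\<tau>\<close> move them to
pairwise disjoint places, and the images can be enlarged to infinite blocks that partition the
naturals; each block is identified with the naturals by a bijection \<open>\<eta>\<^sub>j\<close> that agrees with
\<open>\<tau>\<^bsup>c(j)\<^esup>\<close> on \<open>F\<^sub>j\<close> (\<open>obtain_scattering_permutation\<close>). Because the blocks are full copies of the
naturals, an arbitrary sequence of maps \<open>f\<^sub>j\<close> of \<open>2\<^sup>\<nat>\<close> can be glued, a copy of \<open>f\<^sub>j\<close> acting on the
coordinates in the \<open>j\<close>-th block.
Gluing preserves homeomorphisms, and it preserves measure preserving maps because the restrictions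
of a random point of \<open>2\<^sup>\<nat>\<close> to the blocks are independent. If \<open>g\<close> permutes the coordinates by \<open>\<tau>\<close> and
\<open>h\<close> is the glued map, then \<open>g\<^sup>c h g\<^sup>-\<^sup>c\<close> with \<open>c = c(j)\<close> agrees with \<open>f\<^sub>j\<close> as far as the
coordinates in \<open>F\<^sub>j\<close> can tell (\<open>conjugate_shift_glue\<close>).

It remains to choose countably many requirements. In all groups of maps of \<open>2\<^sup>\<nat>\<close> a basic
neighbourhood constrains the preimages of finitely many clopen sets: exactly for homeomorphisms,
where these preimages are again clopen, and up to a small measure for automorphisms of the measure,
where every measurable set is approximated by clopen ones. There are only countably many clopen
sets, so \<open>f\<^sub>j\<close> can be picked to satisfy the \<open>j\<close>-th constraint whenever some element of the group
does (\<open>obtain_dense_conjugates\<close>).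

For the tree the same partition is applied to the children of the root: \<open>h\<close> acts on the subtrees
above the \<open>j\<close>-th block as a copy of an automorphism \<open>f\<^sub>j\<close> that satisfies the \<open>j\<close>-th of the
countably many conditions prescribing the images of finitely many nodes.

Finally, a standard Borel space with a non-atomic probability measure is isomorphic modulo null sets
to \<open>2\<^sup>\<nat>\<close> with its product measure: it embeds into the real line, where the quantile function compares
a distribution without atoms with Lebesgue measure on the unit interval, and binary expansion leads
from there to \<open>2\<^sup>\<nat>\<close> (\<open>standard_Borel_iso_cantor\<close>). Automorphisms, and hence dense conjugates, are
transferred along such an isomorphism (\<open>transfer_dense_conjugates\<close>).\<close>

section \<open>Conjugates by powers of an element\<close>

abbreviation power_conjugate :: "('a, 'b) monoid_scheme \<Rightarrow> 'a \<Rightarrow> 'a \<Rightarrow> nat \<Rightarrow> 'a" where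
  "power_conjugate G g h c \<equiv> (g [^]\<^bsub>G\<^esub> c) \<otimes>\<^bsub>G\<^esub> h \<otimes>\<^bsub>G\<^esub> inv\<^bsub>G\<^esub> (g [^]\<^bsub>G\<^esub> c)"

lemma (in group) cyclically_dense_conjugacy_classesI:
  assumes T: "topspace T = carrier G" and gh: "g \<in> carrier G" "h \<in> carrier G"
    and dense: "\<And>f U. f \<in> U \<Longrightarrow> openin T U \<Longrightarrow>
      \<exists>c. power_conjugate G g h c \<in> U"
  shows "cyclically_dense_conjugacy_classes G T"
proof -
  let ?q = "\<lambda>n::int. (g [^] n) \<otimes> h \<otimes> (g [^] (- n))"
  have "T closure_of (range ?q) = topspace T"
    unfolding dense_intersects_open
  proof (intro allI impI, elim conjE)
    fix U assume U: "openin T U" "U \<noteq> {}"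
    then obtain f c where "f \<in> U" "power_conjugate G g h c \<in> U"
      using dense by blast
    then have "?q (int c) \<in> U"
      using gh by (simp add: int_pow_int int_pow_neg_int)
    then show "range ?q \<inter> U \<noteq> {}"
      by blast
  qed
  then show ?thesis
    unfolding cyclically_dense_conjugacy_classes_def using gh by blast
qed

lemma (in group) topologically_2_generated_if_cyclically_dense:
  assumes "topspace T = carrier G" "cyclically_dense_conjugacy_classes G T"
  shows "topologically_2_generated G T"
proof -
  obtain g h where gh: "g \<in> carrier G" "h \<in> carrier G"
    and dense: "T closure_of (range (\<lambda>n::int. (g [^] n) \<otimes> h \<otimes> (g [^] (- n)))) = topspace T"
    using assms(2) unfolding cyclically_dense_conjugacy_classes_def by blast
  interpret H: subgroup "generate G {g, h}" G
    by (rule generate_is_subgroup) (use gh in auto)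
  have "g \<in> generate G {g, h}" "h \<in> generate G {g, h}"
    by (auto intro: generate.incl)
  then have "range (\<lambda>n::int. (g [^] n) \<otimes> h \<otimes> (g [^] (- n))) \<subseteq> generate G {g, h}"
    using subgroup_int_pow_closed[OF H.subgroup_axioms] by auto
  then have "T closure_of generate G {g, h} = topspace T"
    using closure_of_mono[of _ _ T] closure_of_subset_topspace[of T] dense by blast
  then show ?thesis
    unfolding topologically_2_generated_def using gh by blast
qed

section \<open>Scattering finite sets of coordinates\<close>

text \<open>The window with centre \<open>c j\<close> and radius \<open>m j\<close> is placed to the right of all earlier ones, by leaving
room for twice their radii. The first conclusion keeps all windows in the nonnegative half line.\<close>

lemma disjoint_windows:
  fixes m :: "nat \<Rightarrow> int"
  assumes "\<And>j. 0 \<le> m j"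
  obtains c :: "nat \<Rightarrow> nat" where "\<And>j. m j \<le> int (c j)"
    "\<And>i j. i \<noteq> j \<Longrightarrow> m i + m j < \<bar>int (c j) - int (c i)\<bar>"
proof
  define s where "s j = (\<Sum>k<j. m k)" for j
  define c where "c j = nat (int j + m j + 2 * s j)" for j
  have s0: "0 \<le> s j" for j
    unfolding s_def using assms by (intro sum_nonneg) auto
  have c: "int (c j) = int j + m j + 2 * s j" for j
    using s0[of j] assms[of j] by (simp add: c_def)
  show "m j \<le> int (c j)" for j
    using s0[of j] by (simp add: c)
  have less: "m i + m j < int (c j) - int (c i)" if "i < j" for i j
  proof -
    have "s i + m i = s (Suc i)"
      by (simp add: s_def)
    also have "\<dots> \<le> s j"
      unfolding s_def using that assms by (intro sum_mono2) auto
    finally show ?thesis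
      using that by (simp add: c)
  qed
  show "m i + m j < \<bar>int (c j) - int (c i)\<bar>" if "i \<noteq> j" for i j
    using less[of i j] less[of j i] that by (cases "i < j") auto
qed

text \<open>The permutation is the translation by one in the first component of \<open>\<int> \<times> \<nat>\<close>, transported to the
naturals. A finite set occupies finitely many rows, so it can be translated into a window of rows
disjoint from the windows of the other sets. Every block contains a complete row, which is infinite;
this is what allows the translation on \<open>F j\<close> to be extended to a bijection of the naturals with the
block.\<close>

lemma obtain_scattering_permutation:
  obtains \<tau> :: "nat \<Rightarrow> nat" where "bij \<tau>"
    "\<And>F :: nat \<Rightarrow> nat set. (\<And>j. finite (F j)) \<Longrightarrow> \<exists>b \<eta> c. \<forall>j.
       bij_betw (\<eta> j) UNIV {i. b i = (j::nat)} \<and> (\<forall>i\<in>F j. \<eta> j i = (\<tau> ^^ c j) i)"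
proof -
  define e :: "nat \<Rightarrow> int \<times> nat" where "e = (\<lambda>n. from_nat_into UNIV n)"
  have e: "bij e"
    unfolding e_def by (intro bij_betw_from_nat_into) (auto simp: infinite_UNIV_nat finite_prod)
  define \<tau> where "\<tau> = inv_into UNIV e \<circ> (\<lambda>(r, k). (r + 1, k)) \<circ> e"
  have "bij (\<lambda>(r, k). (r + 1, k) :: int \<times> nat)"
    by (rule o_bij[where g = "\<lambda>(r, k). (r - 1, k)"]) auto
  then have "bij \<tau>"
    unfolding \<tau>_def using e by (intro bij_comp bij_imp_bij_inv)
  have e_inv: "e (inv_into UNIV e p) = p" "inv_into UNIV e (e i) = i" for p i
    using e by (simp_all add: bij_is_surj surj_f_inv_f bij_is_inj)
  have e_pow: "e ((\<tau> ^^ c) i) = (fst (e i) + int c, snd (e i))" for c i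
    by (induction c) (auto simp: \<tau>_def e_inv split: prod.splits)
  have "\<exists>b \<eta> c. \<forall>j. bij_betw (\<eta> j) UNIV {i. b i = (j::nat)} \<and> (\<forall>i\<in>F j. \<eta> j i = (\<tau> ^^ c j) i)"
    if fin: "\<And>j. finite (F j)" for F :: "nat \<Rightarrow> nat set"
  proof -
    define m where "m j = Max (insert 0 ((\<lambda>i. \<bar>fst (e i)\<bar>) ` F j))" for j
    have m0: "0 \<le> m j" for j
      using fin[of j] by (simp add: m_def)
    have mF: "\<bar>fst (e i)\<bar> \<le> m j" if "i \<in> F j" for i j
      unfolding m_def using fin[of j] that by (intro Max_ge) auto
    obtain c where c: "\<And>j. m j \<le> int (c j)"
      and sep: "\<And>i j. i \<noteq> j \<Longrightarrow> m i + m j < \<bar>int (c j) - int (c i)\<bar>"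
      using disjoint_windows[of m] m0 by blast
    define W where "W j = {r. \<bar>r - int (c j)\<bar> \<le> m j}" for j
    have disj: "i = j" if "r \<in> W i" "r \<in> W j" for r i j
    proof (rule ccontr)
      assume "i \<noteq> j"
      then show False
        using sep[of i j] that by (auto simp: W_def)
    qed
    \<comment> \<open>Rows outside all windows are assigned to the block number 0, so that the blocks form a
      partition.\<close>
    define b0 where "b0 r = (if \<exists>j. r \<in> W j then THE j. r \<in> W j else 0)" for r
    have b0: "b0 r = j" if "r \<in> W j" for r j
      unfolding b0_def using that disj by (auto intro!: the_equality)
    define b where "b i = b0 (fst (e i))" for i
    have inf: "infinite ({i. b i = j} - (\<tau> ^^ c j) ` F j)" for j
    proof -
      have "inj (\<lambda>k. inv_into UNIV e (int (c j), k))"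
        using e by (auto simp: inj_def bij_imp_bij_inv[THEN bij_is_inj, THEN injD] dest: injD[OF bij_is_inj[OF bij_imp_bij_inv[OF e]]])
      then have "infinite (range (\<lambda>k. inv_into UNIV e (int (c j), k)))"
        using finite_imageD infinite_UNIV_nat by blast
      moreover have "range (\<lambda>k. inv_into UNIV e (int (c j), k)) \<subseteq> {i. b i = j}"
        using m0 by (auto simp: b_def e_inv W_def intro!: b0)
      ultimately show ?thesis
        using fin[of j] by (meson Diff_infinite_finite finite_imageI finite_subset)
    qed
    have "\<exists>\<eta>. bij_betw \<eta> UNIV {i. b i = j} \<and> (\<forall>i\<in>F j. \<eta> i = (\<tau> ^^ c j) i)" for j
    proof -
      have "infinite (- F j)"
        using fin[of j] by (simp add: Compl_eq_Diff_UNIV)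
      then obtain \<theta> where \<theta>: "bij_betw \<theta> (- F j) ({i. b i = j} - (\<tau> ^^ c j) ` F j)"
        using inf[of j] bij_betw_trans[OF to_nat_on_infinite[OF countable_subset[OF subset_UNIV countableI_type]]
            bij_betw_from_nat_into[OF countable_subset[OF subset_UNIV countableI_type]]] by blast
      have "bij_betw (\<tau> ^^ c j) (F j) ((\<tau> ^^ c j) ` F j)"
        using \<open>bij \<tau>\<close> bij_fn[of \<tau> "c j"] by (auto intro!: inj_on_imp_bij_betw inj_on_subset[OF bij_is_inj])
      then have "bij_betw (\<lambda>i. if i \<in> F j then (\<tau> ^^ c j) i else \<theta> i) (F j \<union> - F j)
          ((\<tau> ^^ c j) ` F j \<union> ({i. b i = j} - (\<tau> ^^ c j) ` F j))"
        using \<theta> by (intro bij_betw_disjoint_Un) auto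
      moreover have "(\<tau> ^^ c j) i \<in> {i. b i = j}" if "i \<in> F j" for i
        using mF[OF that] by (auto simp: b_def e_pow W_def intro!: b0)
      then have "(\<tau> ^^ c j) ` F j \<union> ({i. b i = j} - (\<tau> ^^ c j) ` F j) = {i. b i = j}"
        by blast
      ultimately show ?thesis
        by (intro exI[of _ "\<lambda>i. if i \<in> F j then (\<tau> ^^ c j) i else \<theta> i"]) auto
    qed
    then have "\<exists>\<eta>. \<forall>j. bij_betw (\<eta> j) UNIV {i. b i = j} \<and> (\<forall>i\<in>F j. \<eta> j i = (\<tau> ^^ c j) i)"
      by (intro choice allI)
    then show ?thesis
      by blast
  qed
  then show ?thesis
    using that \<open>bij \<tau>\<close> by blast
qed

section \<open>Gluing maps of the Cantor space along blocks of coordinates\<close>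

lemma prob_space_fair_coin: "prob_space (uniform_count_measure (UNIV :: bool set))"
  by (rule prob_space_uniform_count_measure) auto

lemma prob_space_cantor_measure: "prob_space cantor_measure"
  unfolding cantor_measure_def by (intro prob_space_PiM prob_space_fair_coin)

interpretation cantor: prob_space cantor_measure
  by (rule prob_space_cantor_measure)

lemma measurable_cantor_coordinate [measurable]:
  "(\<lambda>x. x i) \<in> cantor_measure \<rightarrow>\<^sub>M count_space UNIV"
proof -
  have "(\<lambda>x. x i) \<in> cantor_measure \<rightarrow>\<^sub>M uniform_count_measure (UNIV :: bool set)"
    unfolding cantor_measure_def by simp
  then show ?thesis
    by (simp add: measurable_cong_sets[OF refl sets_uniform_count_measure_count_space])
qed

lemma measurable_into_cantorI:
  assumes "\<And>i. (\<lambda>x. f x i) \<in> N \<rightarrow>\<^sub>M count_space UNIV"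
  shows "f \<in> N \<rightarrow>\<^sub>M cantor_measure"
  unfolding cantor_measure_def
proof (rule measurable_PiM_single')
  show "(\<lambda>x. f x i) \<in> N \<rightarrow>\<^sub>M uniform_count_measure (UNIV :: bool set)" for i
    using assms[of i] by (simp add: measurable_cong_sets[OF refl sets_uniform_count_measure_count_space])
qed (auto simp: space_uniform_count_measure PiE_UNIV_domain)

lemma measurable_cantor_reindex [measurable]: "(\<lambda>x. x \<circ> \<rho>) \<in> cantor_measure \<rightarrow>\<^sub>M cantor_measure"
  by (rule measurable_into_cantorI) (simp add: measurable_cantor_coordinate)

lemma distr_cantor_reindex:
  assumes "inj \<rho>"
  shows "distr cantor_measure cantor_measure (\<lambda>x. x \<circ> \<rho>) = cantor_measure"
proof -
  have "distr cantor_measure cantor_measure (\<lambda>x. \<lambda>n\<in>UNIV. x (\<rho> n)) = cantor_measure"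
    unfolding cantor_measure_def
    by (rule distr_PiM_reindex) (use assms prob_space_fair_coin in auto)
  then show ?thesis
    by (simp add: restrict_UNIV o_def)
qed

lemma continuous_map_into_cantor:
  "continuous_map X cantor_space f \<longleftrightarrow> (\<forall>i. continuous_map X (discrete_topology UNIV) (\<lambda>x. f x i))"
  unfolding cantor_space_def by (simp add: continuous_map_componentwise_UNIV)

lemma continuous_map_cantor_coordinate:
  "continuous_map cantor_space (discrete_topology UNIV) (\<lambda>x. x i)"
  unfolding cantor_space_def by (rule continuous_map_product_projection) simp

lemma continuous_map_cantor_reindex: "continuous_map cantor_space cantor_space (\<lambda>x. x \<circ> \<rho>)"
  by (simp add: continuous_map_into_cantor continuous_map_cantor_coordinate)

text \<open>The number of the block of a coordinate \<open>i\<close> is \<open>b i\<close>, and \<open>\<eta> j\<close> enumerates the \<open>j\<close>-th block. For a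
point \<open>x\<close>, the composition \<open>x \<circ> \<eta> j\<close> is its restriction to that block, read as a point of the Cantor
space; so the blocks identify \<open>2\<^sup>\<nat>\<close> with \<open>(2\<^sup>\<nat>)\<^sup>\<nat>\<close>.\<close>

locale coordinate_blocks =
  fixes b :: "nat \<Rightarrow> nat" and \<eta> :: "nat \<Rightarrow> nat \<Rightarrow> nat"
  assumes bij_block: "\<And>j. bij_betw (\<eta> j) UNIV {i. b i = j}"
begin

lemma block_of [simp]: "b (\<eta> j k) = j"
  using bij_betwE[OF bij_block[of j]] by auto

lemma inj_block: "inj (\<eta> j)"
  using bij_block by (rule bij_betw_imp_inj_on)

lemma block_coordinate: "\<exists>k. i = \<eta> (b i) k"
  using bij_betw_imp_surj_on[OF bij_block[of "b i"]] by fastforce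

lemma eq_if_blocks_eq:
  assumes "\<And>j. x \<circ> \<eta> j = y \<circ> \<eta> j"
  shows "x = y"
proof
  fix i
  obtain k where "i = \<eta> (b i) k"
    using block_coordinate by blast
  then show "x i = y i"
    using fun_cong[OF assms[of "b i"], of k] by simp
qed

definition merge :: "(nat \<Rightarrow> nat \<Rightarrow> 'c) \<Rightarrow> nat \<Rightarrow> 'c" where
  "merge y i = y (b i) (inv_into UNIV (\<eta> (b i)) i)"

lemma merge_block: "merge y \<circ> \<eta> j = y j"
  by (simp add: merge_def fun_eq_iff inv_f_f[OF inj_block])

lemma merge_split: "merge (\<lambda>j. x \<circ> \<eta> j) = x"
  by (rule eq_if_blocks_eq) (rule merge_block)

definition glue :: "(nat \<Rightarrow> (nat \<Rightarrow> bool) \<Rightarrow> (nat \<Rightarrow> bool)) \<Rightarrow> (nat \<Rightarrow> bool) \<Rightarrow> (nat \<Rightarrow> bool)" where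
  "glue f x = merge (\<lambda>j. f j (x \<circ> \<eta> j))"

lemma glue_block: "glue f x \<circ> \<eta> j = f j (x \<circ> \<eta> j)"
  by (simp add: glue_def merge_block)

lemma glue_apply: "glue f x i = f (b i) (x \<circ> \<eta> (b i)) (inv_into UNIV (\<eta> (b i)) i)"
  by (simp add: glue_def merge_def)

lemma glue_inverse:
  assumes "\<And>j x. f j (f' j x) = x"
  shows "glue f (glue f' x) = x"
  by (rule eq_if_blocks_eq) (simp only: glue_block assms)

text \<open>Gluing corresponds to the product map on \<open>(2\<^sup>\<nat>)\<^sup>\<nat>\<close>, so it commutes with composition, and the glued
inverses invert the glued map.\<close>

lemma glue_bij:
  assumes "\<And>j. bij (f j)"
  shows "bij (glue f)" "inv_into UNIV (glue f) = glue (\<lambda>j. inv_into UNIV (f j))"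
proof -
  have 1: "glue f (glue (\<lambda>j. inv_into UNIV (f j)) x) = x" for x
    by (rule glue_inverse) (rule surj_f_inv_f[OF bij_is_surj[OF assms]])
  have 2: "glue (\<lambda>j. inv_into UNIV (f j)) (glue f x) = x" for x
    by (rule glue_inverse) (rule inv_f_f[OF bij_is_inj[OF assms]])
  show "bij (glue f)"
    by (rule o_bij[where g = "glue (\<lambda>j. inv_into UNIV (f j))"]) (auto simp: 1 2)
  show "inv_into UNIV (glue f) = glue (\<lambda>j. inv_into UNIV (f j))"
    by (rule Hilbert_Choice.inv_equality) (simp_all add: 1 2)
qed

lemma continuous_map_glue:
  assumes "\<And>j. continuous_map cantor_space cantor_space (f j)"
  shows "continuous_map cantor_space cantor_space (glue f)"
  unfolding continuous_map_into_cantor glue_apply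
proof
  fix i
  have "continuous_map cantor_space cantor_space (\<lambda>x. f (b i) (x \<circ> \<eta> (b i)))"
    using continuous_map_compose[OF continuous_map_cantor_reindex assms] by (simp add: o_def)
  then show "continuous_map cantor_space (discrete_topology UNIV)
      (\<lambda>x. f (b i) (x \<circ> \<eta> (b i)) (inv_into UNIV (\<eta> (b i)) i))"
    unfolding continuous_map_into_cantor by blast
qed

lemma homeomorphic_map_glue:
  assumes "\<And>j. homeomorphic_map cantor_space cantor_space (f j)"
  shows "homeomorphic_map cantor_space cantor_space (glue f)"
proof -
  have bij: "bij (f j)" for j
    by (rule homeo_bij[OF assms])
  have "continuous_map cantor_space cantor_space (glue f)"
    by (intro continuous_map_glue homeomorphic_imp_continuous_map assms)
  moreover have "continuous_map cantor_space cantor_space (inv_into UNIV (glue f))"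
    unfolding glue_bij(2)[OF bij] by (intro continuous_map_glue homeomorphic_imp_continuous_map homeo_inv assms)
  ultimately have "homeomorphic_maps cantor_space cantor_space (glue f) (inv_into UNIV (glue f))"
    using glue_bij(1)[OF bij]
    by (simp add: homeomorphic_maps_def bij_is_inj bij_is_surj surj_f_inv_f)
  then show ?thesis
    by (rule homeomorphic_maps_imp_map)
qed

lemma measurable_glue:
  assumes "\<And>j. f j \<in> cantor_measure \<rightarrow>\<^sub>M cantor_measure"
  shows "glue f \<in> cantor_measure \<rightarrow>\<^sub>M cantor_measure"
proof (rule measurable_into_cantorI, unfold glue_apply)
  fix i
  show "(\<lambda>x. f (b i) (x \<circ> \<eta> (b i)) (inv_into UNIV (\<eta> (b i)) i)) \<in> cantor_measure \<rightarrow>\<^sub>M count_space UNIV"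
    using measurable_compose[OF measurable_cantor_reindex assms, THEN measurable_compose[OF _ measurable_cantor_coordinate]] .
qed

text \<open>The coordinates are independent, and disjoint sets of coordinates give independent restrictions.\<close>

lemma indep_blocks: "cantor.indep_vars (\<lambda>_. cantor_measure) (\<lambda>j x. x \<circ> \<eta> j) UNIV"
proof -
  let ?B = "\<lambda>j. {i. b i = j}" and ?coin = "uniform_count_measure (UNIV :: bool set)"
  have coord: "(\<lambda>x. x i) \<in> cantor_measure \<rightarrow>\<^sub>M ?coin" for i
    unfolding cantor_measure_def by simp
  have "distr cantor_measure ?coin (\<lambda>x. x i) = ?coin" for i
    unfolding cantor_measure_def by (rule distr_PiM_component) (auto intro: prob_space_fair_coin)
  then have "cantor.indep_vars (\<lambda>_. ?coin) (\<lambda>i x. x i) UNIV"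
    using coord by (subst cantor.indep_vars_iff_distr_eq_PiM) (auto simp: cantor_measure_def restrict_UNIV)
  then have "cantor.indep_vars (\<lambda>j. PiM (?B j) (\<lambda>_. ?coin)) (\<lambda>j x. restrict (\<lambda>i. x i) (?B j)) UNIV"
    by (rule cantor.indep_vars_restrict) (auto simp: disjoint_family_on_def)
  then have "cantor.indep_vars (\<lambda>_. cantor_measure) (\<lambda>j x. restrict (\<lambda>i. x i) (?B j) \<circ> \<eta> j) UNIV"
  proof (rule cantor.indep_vars_compose2)
    fix j
    show "(\<lambda>y. y \<circ> \<eta> j) \<in> PiM (?B j) (\<lambda>_. ?coin) \<rightarrow>\<^sub>M cantor_measure"
    proof (rule measurable_into_cantorI)
      fix k
      have "(\<lambda>y. y (\<eta> j k)) \<in> PiM (?B j) (\<lambda>_. ?coin) \<rightarrow>\<^sub>M ?coin"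
        by (rule measurable_component_singleton) simp
      then show "(\<lambda>y. (y \<circ> \<eta> j) k) \<in> PiM (?B j) (\<lambda>_. ?coin) \<rightarrow>\<^sub>M count_space UNIV"
        by (simp add: measurable_cong_sets[OF refl sets_uniform_count_measure_count_space])
    qed
  qed
  moreover have "(\<lambda>j x. restrict (\<lambda>i. x i) (?B j) \<circ> \<eta> j) = (\<lambda>j (x :: nat \<Rightarrow> bool). x \<circ> \<eta> j)"
    by (simp add: fun_eq_iff)
  ultimately show ?thesis
    by simp
qed

text \<open>The restrictions to the blocks are independent with the law of the Cantor measure, and this remains
true after the measure preserving map \<open>f j\<close> is applied to the \<open>j\<close>-th one. Hence the joint law of the
restrictions is the same product measure before and after; merging the blocks again turns one into
the Cantor measure and the other into its image under the glued map.\<close>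

lemma distr_glue:
  assumes f: "\<And>j. f j \<in> cantor_measure \<rightarrow>\<^sub>M cantor_measure" "\<And>j. distr cantor_measure cantor_measure (f j) = cantor_measure"
  shows "distr cantor_measure cantor_measure (glue f) = cantor_measure"
proof -
  let ?P = "PiM UNIV (\<lambda>_::nat. cantor_measure)"
  have law: "distr cantor_measure ?P (\<lambda>x j. f j (x \<circ> \<eta> j)) = ?P"
    if f: "\<And>j. f j \<in> cantor_measure \<rightarrow>\<^sub>M cantor_measure" "\<And>j. distr cantor_measure cantor_measure (f j) = cantor_measure"
    for f
  proof -
    have m: "(\<lambda>x. f j (x \<circ> \<eta> j)) \<in> cantor_measure \<rightarrow>\<^sub>M cantor_measure" for j
      using f(1)[of j] by measurable
    have "distr cantor_measure cantor_measure (\<lambda>x. f j (x \<circ> \<eta> j)) =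
        distr (distr cantor_measure cantor_measure (\<lambda>x. x \<circ> \<eta> j)) cantor_measure (f j)" for j
      using distr_distr[OF f(1) measurable_cantor_reindex, of "\<eta> j" j]
      unfolding comp_def[of "f j" "\<lambda>x. x \<circ> \<eta> j"] by simp
    then have d: "distr cantor_measure cantor_measure (\<lambda>x. f j (x \<circ> \<eta> j)) = cantor_measure" for j
      using f(2) by (simp add: distr_cantor_reindex[OF inj_block])
    have "cantor.indep_vars (\<lambda>_. cantor_measure) (\<lambda>j x. f j (x \<circ> \<eta> j)) UNIV"
      by (rule cantor.indep_vars_compose2[OF indep_blocks]) (rule f)
    then show ?thesis
      using m by (subst (asm) cantor.indep_vars_iff_distr_eq_PiM) (auto simp: d restrict_UNIV)
  qed
  have merge: "merge \<in> ?P \<rightarrow>\<^sub>M cantor_measure"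
  proof (rule measurable_into_cantorI, unfold merge_def)
    fix i
    have "(\<lambda>y. y (b i)) \<in> ?P \<rightarrow>\<^sub>M cantor_measure"
      by simp
    from measurable_compose[OF this measurable_cantor_coordinate]
    show "(\<lambda>y. y (b i) (inv_into UNIV (\<eta> (b i)) i)) \<in> ?P \<rightarrow>\<^sub>M count_space UNIV" .
  qed
  have m: "(\<lambda>x j. f j (x \<circ> \<eta> j)) \<in> cantor_measure \<rightarrow>\<^sub>M ?P"
    if "\<And>j. f j \<in> cantor_measure \<rightarrow>\<^sub>M cantor_measure" for f
    using that by (intro measurable_PiM_single') (auto intro: measurable_compose[OF measurable_cantor_reindex])
  have "distr cantor_measure cantor_measure (glue f) = distr (distr cantor_measure ?P (\<lambda>x j. f j (x \<circ> \<eta> j))) cantor_measure merge"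
    using distr_distr[OF merge m[OF f(1)]] by (simp add: o_def glue_def[abs_def])
  also have "\<dots> = distr ?P cantor_measure merge"
    using law[OF f] by simp
  also have "\<dots> = distr (distr cantor_measure ?P (\<lambda>x j. x \<circ> \<eta> j)) cantor_measure merge"
    using law[of "\<lambda>_ x. x"] by simp
  also have "\<dots> = distr cantor_measure cantor_measure (\<lambda>x. x)"
    using distr_distr[OF merge m[of "\<lambda>_ x. x"]]
    unfolding comp_def[of merge "\<lambda>x j. x \<circ> \<eta> j"] merge_split by simp
  also have "\<dots> = cantor_measure"
    by simp
  finally show ?thesis .
qed

lemma measure_preserving_glue:
  assumes "\<And>j. measure_preserving_map cantor_measure (f j)"
  shows "measure_preserving_map cantor_measure (glue f)"
  using assms unfolding measure_preserving_map_distr by (auto intro: measurable_glue distr_glue)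

end

section \<open>Groups of maps of the Cantor space that are closed under gluing\<close>

lemma conjugate_power_BijGroup:
  assumes H: "subgroup H (BijGroup UNIV)" and gh: "g \<in> H" "h \<in> H"
  defines "G \<equiv> BijGroup UNIV \<lparr>carrier := H\<rparr>"
  shows "power_conjugate G g h c = (g ^^ c) \<circ> h \<circ> inv_into UNIV (g ^^ c)"
proof -
  interpret group G
    unfolding G_def by (rule group_BijGroup_restrict[OF H])
  have HB: "H \<subseteq> Bij UNIV"
    using subgroup.subset[OF H] by (simp add: BijGroup_def)
  have carrier: "carrier G = H"
    by (simp add: G_def)
  have mult: "x \<otimes>\<^bsub>G\<^esub> y = x \<circ> y" if "x \<in> H" "y \<in> H" for x y
  proof -
    have "x \<otimes>\<^bsub>G\<^esub> y = compose UNIV x y"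
      using that HB by (auto simp: G_def BijGroup_def)
    then show ?thesis
      by (simp add: compose_def fun_eq_iff)
  qed
  have inv: "inv\<^bsub>G\<^esub> x = inv_into UNIV x" if "x \<in> H" for x
    using group.m_inv_consistent[OF group_BijGroup H that] inv_BijGroup[of x UNIV] that HB
    by (auto simp: G_def restrict_UNIV)
  have pow: "g [^]\<^bsub>G\<^esub> c = g ^^ c"
  proof (induction c)
    case 0
    then show ?case
      by (auto simp: G_def BijGroup_def)
  next
    case (Suc c)
    have "g [^]\<^bsub>G\<^esub> c \<in> H"
      using nat_pow_closed[of g c] gh carrier by simp
    then show ?case
      using Suc gh by (simp add: mult funpow_Suc_right del: funpow.simps)
  qed
  have "g [^]\<^bsub>G\<^esub> c \<in> carrier G"
    using nat_pow_closed[of g c] gh carrier by simp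
  then have "inv\<^bsub>G\<^esub> (g [^]\<^bsub>G\<^esub> c) \<in> H" "g [^]\<^bsub>G\<^esub> c \<otimes>\<^bsub>G\<^esub> h \<in> H" "g [^]\<^bsub>G\<^esub> c \<in> H"
    using gh carrier inv_closed m_closed by auto
  then show ?thesis
    using gh by (simp add: mult inv pow)
qed

context coordinate_blocks begin

text \<open>Conjugation by the \<open>c\<close>-th power of the shift moves the block carrying \<open>f j\<close> back, so that the
coordinates in \<open>F\<close> of the image are those of \<open>f j\<close> applied to a rearrangement \<open>x \<circ> \<rho>\<close> of the argument.
The rearrangement does not touch the coordinates in \<open>F\<close>, and by injectivity of \<open>\<rho>\<close> it preserves the
Cantor measure.\<close>

lemma conjugate_shift_glue:
  assumes \<tau>: "bij \<tau>" and c: "\<forall>i\<in>F. \<eta> j i = (\<tau> ^^ c) i"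
  shows "\<exists>\<rho>. inj \<rho> \<and> (\<forall>i\<in>F. \<rho> i = i) \<and>
    (\<forall>x. \<forall>i\<in>F. (((\<lambda>x. x \<circ> \<tau>) ^^ c) \<circ> glue f \<circ> inv_into UNIV ((\<lambda>x. x \<circ> \<tau>) ^^ c)) x i = f j (x \<circ> \<rho>) i)"
proof -
  let ?t = "\<tau> ^^ c" and ?g = "\<lambda>x :: nat \<Rightarrow> bool. x \<circ> \<tau>"
  have t: "bij ?t"
    using \<tau> bij_fn by blast
  have tt: "inv_into UNIV ?t (?t i) = i" "?t (inv_into UNIV ?t i) = i" for i
    using t by (simp_all add: bij_is_inj bij_is_surj surj_f_inv_f)
  have pow: "(?g ^^ n) x = x \<circ> (\<tau> ^^ n)" for n x
    by (induction n) (auto simp: fun_eq_iff funpow_swap1)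
  have inv: "inv_into UNIV (?g ^^ c) x = x \<circ> inv_into UNIV ?t" for x
  proof -
    have "inv_into UNIV (?g ^^ c) = (\<lambda>x. x \<circ> inv_into UNIV ?t)"
      by (rule Hilbert_Choice.inv_equality) (auto simp: pow fun_eq_iff tt)
    then show ?thesis
      by simp
  qed
  define \<rho> where "\<rho> = inv_into UNIV ?t \<circ> \<eta> j"
  have "inj \<rho>"
    unfolding \<rho>_def by (rule inj_compose[OF bij_is_inj[OF bij_imp_bij_inv[OF t]] inj_block])
  moreover have "\<rho> i = i" if "i \<in> F" for i
    using c that by (simp add: \<rho>_def tt)
  moreover have "((?g ^^ c) \<circ> glue f \<circ> inv_into UNIV (?g ^^ c)) x i = f j (x \<circ> \<rho>) i" if "i \<in> F" for x i
  proof -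
    let ?y = "x \<circ> inv_into UNIV ?t"
    have "((?g ^^ c) \<circ> glue f \<circ> inv_into UNIV (?g ^^ c)) x i = glue f ?y (?t i)"
      by (simp add: pow inv)
    also have "\<dots> = (glue f ?y \<circ> \<eta> j) i"
      using c that by simp
    also have "\<dots> = f j (?y \<circ> \<eta> j) i"
      by (simp only: glue_block)
    finally show ?thesis
      by (simp only: \<rho>_def o_assoc)
  qed
  ultimately show ?thesis
    by blast
qed

end

text \<open>Clopen sets are coded by lists of finite words, because the codes then form a countable type and the
requirements on an element of the group can be enumerated.\<close>

definition cylinder_union :: "bool list list \<Rightarrow> (nat \<Rightarrow> bool) set" where
  "cylinder_union L = {x. \<exists>l\<in>set L. \<forall>i<length l. x i = l ! i}"

definition code_support :: "bool list list \<Rightarrow> nat set" where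
  "code_support L = (\<Union>l\<in>set L. {..<length l})"

lemma finite_code_support [simp]: "finite (code_support L)"
  by (simp add: code_support_def)

lemma cylinder_union_cong:
  assumes "\<And>i. i \<in> code_support L \<Longrightarrow> x i = y i"
  shows "x \<in> cylinder_union L \<longleftrightarrow> y \<in> cylinder_union L"
proof -
  have "x i = y i" if "l \<in> set L" "i < length l" for l i
    using assms that by (auto simp: code_support_def)
  then show ?thesis
    by (auto simp: cylinder_union_def)
qed

text \<open>A set that is determined by the first \<open>n\<close> coordinates is a union of cylinders given by words of
length \<open>n\<close>, of which there are finitely many.\<close>

lemma obtain_code:
  assumes "\<And>x y. (\<And>i. i < n \<Longrightarrow> x i = y i) \<Longrightarrow> x \<in> A \<longleftrightarrow> y \<in> A"
  obtains L where "A = cylinder_union L"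
proof -
  have "(\<lambda>x. map x [0..<n]) ` A \<subseteq> {l. set l \<subseteq> UNIV \<and> length l = n}"
    by auto
  then have "finite ((\<lambda>x. map x [0..<n]) ` A)"
    by (rule finite_subset) (rule finite_lists_length_eq, simp)
  then obtain L where L: "set L = (\<lambda>x. map x [0..<n]) ` A"
    using finite_list by blast
  have "x \<in> A \<longleftrightarrow> x \<in> cylinder_union L" for x
  proof
    assume "x \<in> cylinder_union L"
    then obtain y where "y \<in> A" "\<And>i. i < n \<Longrightarrow> x i = y i"
      by (auto simp: cylinder_union_def L)
    then show "x \<in> A"
      using assms[of x y] by blast
  qed (auto simp: cylinder_union_def L)
  then show ?thesis
    using that by blast
qed

text \<open>This isolates what the three groups of maps of the Cantor space have in common: the group of all
homeomorphisms, of the measure preserving ones, and of the Borel automorphisms of the measure.\<close>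

locale gluable_group =
  fixes H :: "((nat \<Rightarrow> bool) \<Rightarrow> (nat \<Rightarrow> bool)) set"
  assumes subgroup_H: "subgroup H (BijGroup UNIV)"
    and reindex_H: "\<And>\<tau>. bij \<tau> \<Longrightarrow> (\<lambda>x. x \<circ> \<tau>) \<in> H"
    and glue_H: "\<And>b \<eta> f. coordinate_blocks b \<eta> \<Longrightarrow> (\<And>j. f j \<in> H) \<Longrightarrow> coordinate_blocks.glue b \<eta> f \<in> H"
begin

abbreviation G where "G \<equiv> BijGroup UNIV \<lparr>carrier := H\<rparr>"

lemma obtain_universal_conjugate:
  fixes f :: "nat \<Rightarrow> (nat \<Rightarrow> bool) \<Rightarrow> (nat \<Rightarrow> bool)" and F :: "nat \<Rightarrow> nat set"
  assumes f: "\<And>j. f j \<in> H" and F: "\<And>j. finite (F j)"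
  obtains g h where "g \<in> H" "h \<in> H"
    "\<And>j. \<exists>c \<rho>. inj \<rho> \<and> (\<forall>i\<in>F j. \<rho> i = i) \<and> (\<forall>x. \<forall>i\<in>F j.
       power_conjugate G g h c x i = f j (x \<circ> \<rho>) i)"
proof -
  obtain \<tau> :: "nat \<Rightarrow> nat" where \<tau>: "bij \<tau>"
    and scatter: "\<And>F :: nat \<Rightarrow> nat set. (\<And>j. finite (F j)) \<Longrightarrow> \<exists>b \<eta> c. \<forall>j.
       bij_betw (\<eta> j) UNIV {i. b i = (j::nat)} \<and> (\<forall>i\<in>F j. \<eta> j i = (\<tau> ^^ c j) i)"
    using obtain_scattering_permutation by blast
  from scatter[of F, OF F] obtain b \<eta> c where \<eta>: "\<And>j. bij_betw (\<eta> j) UNIV {i. b i = (j::nat)}"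
    and c: "\<And>j. \<forall>i\<in>F j. \<eta> j i = (\<tau> ^^ c j) i"
    by blast
  interpret coordinate_blocks b \<eta>
    by standard (rule \<eta>)
  have gh: "(\<lambda>x. x \<circ> \<tau>) \<in> H" "glue f \<in> H"
    using reindex_H[OF \<tau>] glue_H[OF coordinate_blocks_axioms f] by auto
  show ?thesis
  proof (rule that[OF gh])
    fix j
    show "\<exists>c \<rho>. inj \<rho> \<and> (\<forall>i\<in>F j. \<rho> i = i) \<and> (\<forall>x. \<forall>i\<in>F j.
       (power_conjugate G (\<lambda>x. x \<circ> \<tau>) (glue f) c) x i =
       f j (x \<circ> \<rho>) i)"
      unfolding conjugate_power_BijGroup[OF subgroup_H gh]
      using conjugate_shift_glue[OF \<tau> c] by (rule exI)
  qed
qed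

text \<open>The relation \<open>R N A E\<close> expresses that \<open>E\<close> approximates \<open>A\<close> with a precision given by \<open>N\<close>. A
requirement consists of a precision and of finitely many pairs of clopen sets \<open>L\<close>, \<open>E\<close>, and asks that
\<open>E\<close> approximates the preimage of \<open>L\<close>. Each of the countably many requirements is met by some conjugate
of \<open>h\<close> as soon as it is met by some element of the group: with \<open>F j\<close> large enough to determine
the clopen sets of the \<open>j\<close>-th requirement, the conjugate meets it up to the rearrangement \<open>\<rho>\<close> from
\<open>conjugate_shift_glue\<close>, and \<open>R\<close> is assumed to be stable under these.\<close>

lemma obtain_dense_conjugates:
  fixes R :: "nat \<Rightarrow> (nat \<Rightarrow> bool) set \<Rightarrow> (nat \<Rightarrow> bool) set \<Rightarrow> bool"
  assumes R: "\<And>N f L E \<rho>. f \<in> H \<Longrightarrow> inj \<rho> \<Longrightarrow> R N (f -` cylinder_union L) (cylinder_union E) \<Longrightarrow>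
      R N ((\<lambda>x. x \<circ> \<rho>) -` (f -` cylinder_union L)) ((\<lambda>x. x \<circ> \<rho>) -` cylinder_union E)"
  obtains g h where "g \<in> H" "h \<in> H"
    "\<And>f N P. f \<in> H \<Longrightarrow> (\<And>L E. (L, E) \<in> set P \<Longrightarrow> R N (f -` cylinder_union L) (cylinder_union E)) \<Longrightarrow>
      \<exists>c. \<forall>(L, E)\<in>set P. R N (power_conjugate G g h c -` cylinder_union L)
        (cylinder_union E)"
proof -
  define realises where "realises f p \<longleftrightarrow> f \<in> H \<and>
      (\<forall>(L, E)\<in>set (snd p). R (fst p) (f -` cylinder_union L) (cylinder_union E))"
    for f and p :: "nat \<times> (bool list list \<times> bool list list) list"
  define p where "p j = (from_nat j :: nat \<times> (bool list list \<times> bool list list) list)" for j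
  \<comment> \<open>The identity, written as a rearrangement of coordinates, serves the unsatisfiable requirements.\<close>
  define f where "f j = (if \<exists>f. realises f (p j) then SOME f. realises f (p j) else (\<lambda>x. x \<circ> id))" for j
  define F where "F j = (\<Union>(L, E)\<in>set (snd (p j)). code_support L \<union> code_support E)" for j
  have f: "realises (f j) (p j)" if "realises f' (p j)" for f' j
    unfolding f_def using someI[of "\<lambda>f. realises f (p j)", OF that] that by auto
  have fH: "f j \<in> H" for j
  proof (cases "\<exists>f. realises f (p j)")
    case True
    then show ?thesis
      using f[of _ j] by (auto simp: realises_def)
  next
    case False
    then show ?thesis
      using reindex_H[of id] by (simp add: f_def)
  qed
  have "finite (F j)" for j
    by (auto simp: F_def)
  from obtain_universal_conjugate[of f F, OF fH this]
  obtain g h where gh: "g \<in> H" "h \<in> H" and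
    q: "\<And>j. \<exists>c \<rho>. inj \<rho> \<and> (\<forall>i\<in>F j. \<rho> i = i) \<and> (\<forall>x. \<forall>i\<in>F j.
       power_conjugate G g h c x i = f j (x \<circ> \<rho>) i)"
    by blast
  show ?thesis
  proof (rule that[OF gh])
    fix f' N P
    assume "f' \<in> H" and *: "\<And>L E. (L, E) \<in> set P \<Longrightarrow> R N (f' -` cylinder_union L) (cylinder_union E)"
    define j where "j = to_nat (N, P)"
    have j: "p j = (N, P)"
      by (simp add: p_def j_def)
    then have "realises f' (p j)"
      using \<open>f' \<in> H\<close> * by (auto simp: realises_def)
    then have fj: "realises (f j) (p j)"
      by (rule f)
    obtain c \<rho> where \<rho>: "inj \<rho>" "\<And>i. i \<in> F j \<Longrightarrow> \<rho> i = i" and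
      qj: "\<And>x i. i \<in> F j \<Longrightarrow> power_conjugate G g h c x i = f j (x \<circ> \<rho>) i"
      using q[of j] by blast
    let ?q = "power_conjugate G g h c"
    have "R N (?q -` cylinder_union L) (cylinder_union E)" if LE: "(L, E) \<in> set P" for L E
    proof -
      have supp: "code_support L \<subseteq> F j" "code_support E \<subseteq> F j"
        using LE by (force simp: F_def j)+
      have "?q x \<in> cylinder_union L \<longleftrightarrow> f j (x \<circ> \<rho>) \<in> cylinder_union L" for x
        by (rule cylinder_union_cong) (use qj supp in auto)
      then have 1: "?q -` cylinder_union L = (\<lambda>x. x \<circ> \<rho>) -` (f j -` cylinder_union L)"
        by blast
      have "x \<circ> \<rho> \<in> cylinder_union E \<longleftrightarrow> x \<in> cylinder_union E" for x
        by (rule cylinder_union_cong) (use \<rho> supp in auto)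
      then have 2: "(\<lambda>x. x \<circ> \<rho>) -` cylinder_union E = cylinder_union E"
        by blast
      have "R N (f j -` cylinder_union L) (cylinder_union E)"
        using fj LE by (auto simp: realises_def j)
      from R[OF fH \<rho>(1) this] show ?thesis
        unfolding 1 2 .
    qed
    then show "\<exists>c. \<forall>(L, E)\<in>set P. R N (power_conjugate G g h c -` cylinder_union L)
        (cylinder_union E)"
      by blast
  qed
qed

end

section \<open>Homeomorphisms of the Cantor space\<close>

lemma compact_space_cantor: "compact_space cantor_space"
  unfolding cantor_space_def compact_space_product_topology
  by (simp add: compact_space_discrete_topology)

lemma openin_cantor_initial:
  assumes "openin cantor_space U" "x \<in> U"
  obtains n where "\<And>y. (\<And>i. i < n \<Longrightarrow> y i = x i) \<Longrightarrow> y \<in> U"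
proof -
  obtain V where V: "finite {i. V i \<noteq> (UNIV :: bool set)}" "x \<in> PiE UNIV V" "PiE UNIV V \<subseteq> U"
    using assms unfolding cantor_space_def openin_product_topology_alt by auto
  obtain n where n: "\<And>i. V i \<noteq> UNIV \<Longrightarrow> i < n"
    using V(1) unfolding finite_nat_set_iff_bounded by auto
  have "y \<in> U" if "\<And>i. i < n \<Longrightarrow> y i = x i" for y
  proof -
    have "y i \<in> V i" for i
      using that[of i] n[of i] PiE_mem[OF V(2), of i] by (cases "V i = UNIV") auto
    then show ?thesis
      using V(3) by (auto simp: PiE_UNIV_domain)
  qed
  then show ?thesis
    using that by blast
qed

lemma openin_cantor_cylinder: "openin cantor_space {y. \<forall>i<n. y i = x i}"
proof -
  have "openin cantor_space {y. y i = x i}" for i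
    using openin_continuous_map_preimage[OF continuous_map_cantor_coordinate, of "{x i}" i] by simp
  then have "openin cantor_space (\<Inter>i\<in>{..<n}. {y. y i = x i} \<inter> topspace cantor_space)" if "n > 0"
    using that by (intro openin_Inter) auto
  moreover have "{y. \<forall>i<n. y i = x i} = (\<Inter>i\<in>{..<n}. {y. y i = x i} \<inter> topspace cantor_space)"
    by auto
  ultimately show ?thesis
    using openin_topspace[of cantor_space] by (cases "n = 0") auto
qed

text \<open>By compactness: finitely many cylinders on which \<open>\<phi>\<close> is constant cover the space, and \<open>n\<close> is the
largest of their lengths.\<close>

lemma continuous_map_cantor_finite_support:
  assumes "continuous_map cantor_space (discrete_topology UNIV) \<phi>"
  obtains n where "\<And>x y. (\<And>i. i < n \<Longrightarrow> x i = y i) \<Longrightarrow> \<phi> x = \<phi> y"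
proof -
  have "\<exists>n. \<forall>y. (\<forall>i<n. y i = x i) \<longrightarrow> \<phi> y = \<phi> x" for x
  proof -
    have "openin cantor_space {y. \<phi> y = \<phi> x}"
      using openin_continuous_map_preimage[OF assms, of "{\<phi> x}"] by simp
    from openin_cantor_initial[OF this, of x] show ?thesis
      by (metis (mono_tags, lifting) mem_Collect_eq)
  qed
  then obtain N where N: "\<And>x y. (\<forall>i<N x. y i = x i) \<Longrightarrow> \<phi> y = \<phi> x"
    by metis
  let ?C = "\<lambda>x. {y. \<forall>i<N x. y i = x i}"
  have "\<forall>U\<in>range ?C. openin cantor_space U" "topspace cantor_space \<subseteq> \<Union>(range ?C)"
    by (auto intro: openin_cantor_cylinder)
  then obtain \<F> where \<F>: "finite \<F>" "\<F> \<subseteq> range ?C" "topspace cantor_space \<subseteq> \<Union>\<F>"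
    using compact_space_cantor unfolding compact_space_alt by meson
  obtain X where X: "finite X" "\<F> = ?C ` X"
    using finite_subset_image[OF \<F>(1,2)] by auto
  define n where "n = Max (insert 0 (N ` X))"
  have "\<phi> y = \<phi> z" if "\<And>i. i < n \<Longrightarrow> y i = z i" for y z
  proof -
    obtain x where x: "x \<in> X" "\<forall>i<N x. y i = x i"
      using \<F>(3) unfolding X(2) by (auto simp: subset_iff)
    have "N x \<le> n"
      unfolding n_def using X(1) x(1) by (intro Max_ge) auto
    then have "\<forall>i<N x. z i = x i"
      using that x(2) by (metis less_le_trans)
    then show ?thesis
      using N x(2) by metis
  qed
  then show ?thesis
    using that by blast
qed

lemma uniform_convergence_neighbourhood:
  assumes "openin (uniform_convergence_topology H) U" "f \<in> U"
  obtains n where "\<And>q. q \<in> H \<Longrightarrow> (\<And>x i. i \<le> n \<Longrightarrow> q x i = f x i) \<Longrightarrow> q \<in> U"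
proof -
  interpret C: Metric_space UNIV cantor_dist
    by (rule Metric_space_cantor)
  interpret F: Metric_space "C.fspace UNIV" "C.fdist UNIV"
    by (rule C.Metric_space_funspace)
  have fspace: "C.fspace UNIV = (UNIV :: ((nat \<Rightarrow> bool) \<Rightarrow> (nat \<Rightarrow> bool)) set)"
    using topspace_uniform_convergence_topology[of UNIV]
    by (simp add: uniform_convergence_topology_def)
  obtain V where V: "openin F.mtopology V" "U = V \<inter> H"
    using assms(1) by (auto simp: uniform_convergence_topology_def openin_subtopology mtopology_of_def)
  then obtain r where r: "r > 0" "F.mball f r \<subseteq> V"
    using assms(2) unfolding F.openin_mtopology by blast
  obtain n where n: "(1/2 :: real) ^ n < r"
    using real_arch_pow_inv[OF r(1), of "1/2"] by auto
  have "q \<in> U" if "q \<in> H" and q: "\<And>x i. i \<le> n \<Longrightarrow> q x i = f x i" for q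
  proof -
    have "cantor_dist (f x) (q x) \<le> (1/2) ^ n" for x
      using q by (intro less_imp_le) (simp add: cantor_dist_less_iff)
    then have "C.fdist UNIV f q \<le> (1/2) ^ n"
      unfolding C.fdist_def fspace by (auto intro!: cSUP_least)
    then have "q \<in> F.mball f r"
      unfolding F.in_mball using n by (simp add: fspace)
    then show ?thesis
      using r(2) V(2) \<open>q \<in> H\<close> by blast
  qed
  then show ?thesis
    using that by blast
qed

text \<open>For a homeomorphism the preimage of a clopen set is clopen, so equality can be used as the
approximation relation. Agreement of two maps in the coordinate \<open>i\<close> of their values means that they
have the same preimage of the clopen set of all points with value true at \<open>i\<close>.\<close>

lemma (in gluable_group) cyclically_dense_if_homeomorphisms:
  assumes homeo: "\<And>f. f \<in> H \<Longrightarrow> homeomorphic_map cantor_space cantor_space f"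
  shows "cyclically_dense_conjugacy_classes G (uniform_convergence_topology H)"
proof -
  interpret group G
    by (rule group_BijGroup_restrict[OF subgroup_H])
  obtain g h where gh: "g \<in> H" "h \<in> H"
    and dense: "\<And>f P. f \<in> H \<Longrightarrow> (\<And>L E. (L, E) \<in> set P \<Longrightarrow> f -` cylinder_union L = cylinder_union E) \<Longrightarrow>
      \<exists>c. \<forall>(L, E)\<in>set P. power_conjugate G g h c -` cylinder_union L =
        cylinder_union E"
    by (rule obtain_dense_conjugates[of "\<lambda>_. (=)"]) (simp, blast)
  show ?thesis
  proof (rule cyclically_dense_conjugacy_classesI)
    show "topspace (uniform_convergence_topology H) = carrier G" "g \<in> carrier G" "h \<in> carrier G"
      using gh by simp_all
    fix f U
    assume f: "f \<in> U" and U: "openin (uniform_convergence_topology H) U"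
    have fH: "f \<in> H"
      using f openin_subset[OF U] by auto
    obtain n where n: "\<And>q. q \<in> H \<Longrightarrow> (\<And>x i. i \<le> n \<Longrightarrow> q x i = f x i) \<Longrightarrow> q \<in> U"
      using uniform_convergence_neighbourhood[OF U f] by blast
    have "\<exists>L E. {x. x i} = cylinder_union L \<and> {x. f x i} = cylinder_union E" for i
    proof -
      have "continuous_map cantor_space (discrete_topology UNIV) (\<lambda>x. f x i)"
        using homeomorphic_imp_continuous_map[OF homeo[OF fH]] continuous_map_into_cantor by blast
      then obtain m where "\<And>x y. (\<And>i. i < m \<Longrightarrow> x i = y i) \<Longrightarrow> f x i = f y i"
        using continuous_map_cantor_finite_support by blast
      then obtain E where "{x. f x i} = cylinder_union E"
        using obtain_code[of m "{x. f x i}"] by blast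
      moreover obtain L where "{x. x i} = cylinder_union L"
        using obtain_code[of "Suc i" "{x. x i}"] by blast
      ultimately show ?thesis
        by blast
    qed
    then obtain L E where L: "\<And>i. {x. x i} = cylinder_union (L i)" and E: "\<And>i. {x. f x i} = cylinder_union (E i)"
      by metis
    have fL: "f -` cylinder_union (L i) = cylinder_union (E i)" for i
      unfolding L[symmetric] E[symmetric] by auto
    let ?P = "map (\<lambda>i. (L i, E i)) [0..<Suc n]"
    have "\<And>L' E'. (L', E') \<in> set ?P \<Longrightarrow> f -` cylinder_union L' = cylinder_union E'"
      using fL by auto
    from dense[OF fH this] obtain c where
      c: "\<forall>(L, E)\<in>set ?P. power_conjugate G g h c -` cylinder_union L = cylinder_union E"
      by blast
    let ?q = "power_conjugate G g h c"
    have "?q \<in> carrier G"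
      using gh by (intro m_closed inv_closed nat_pow_closed) auto
    moreover have "?q x i = f x i" if "i \<le> n" for x i
    proof -
      have "?q -` cylinder_union (L i) = f -` cylinder_union (L i)"
        unfolding fL using c that by (auto simp: less_Suc_eq_le simp del: upt_Suc)
      then show ?thesis
        unfolding L[symmetric] by (auto simp: set_eq_iff)
    qed
    ultimately have "?q \<in> U"
      by (intro n) auto
    then show "\<exists>c. power_conjugate G g h c \<in> U"
      by blast
  qed
qed

lemma reindex_homeomorphic_map:
  assumes "bij \<tau>"
  shows "homeomorphic_map cantor_space cantor_space (\<lambda>x. x \<circ> \<tau>)"
proof -
  have "homeomorphic_maps cantor_space cantor_space (\<lambda>x. x \<circ> \<tau>) (\<lambda>x. x \<circ> inv_into UNIV \<tau>)"
    using assms by (auto simp: homeomorphic_maps_def continuous_map_cantor_reindex fun_eq_iff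
        bij_is_inj bij_is_surj surj_f_inv_f)
  then show ?thesis
    by (rule homeomorphic_maps_imp_map)
qed

lemma reindex_measure_preserving:
  assumes "inj \<rho>"
  shows "measure_preserving_map cantor_measure (\<lambda>x. x \<circ> \<rho>)"
  by (simp add: measure_preserving_map_distr measurable_cantor_reindex distr_cantor_reindex[OF assms])

lemma gluable_group_homeo: "gluable_group {f. homeomorphic_map cantor_space cantor_space f}"
  by (rule gluable_group.intro) (auto simp: subgroup_homeo intro: reindex_homeomorphic_map coordinate_blocks.homeomorphic_map_glue)

lemma gluable_group_homeo_measure:
  "gluable_group {f. homeomorphic_map cantor_space cantor_space f \<and> measure_preserving_map cantor_measure f}"
  by (rule gluable_group.intro) (auto simp: subgroup_homeo_measure bij_is_inj
      intro: reindex_homeomorphic_map coordinate_blocks.homeomorphic_map_glue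
        reindex_measure_preserving coordinate_blocks.measure_preserving_glue)

lemma cyclically_dense_H_cantor:
  "cyclically_dense_conjugacy_classes H_cantor (uniform_convergence_topology (carrier H_cantor))"
  using gluable_group.cyclically_dense_if_homeomorphisms[OF gluable_group_homeo]
  by (simp add: H_cantor_def)

lemma cyclically_dense_H_cantor_measure:
  "cyclically_dense_conjugacy_classes H_cantor_measure
    (uniform_convergence_topology (carrier H_cantor_measure))"
  using gluable_group.cyclically_dense_if_homeomorphisms[OF gluable_group_homeo_measure]
  by (simp add: H_cantor_measure_def)

section \<open>Automorphisms of the infinitely splitting tree\<close>

lemma tree_automorphismsI:
  assumes inv: "\<And>s. f (f' s) = s" "\<And>s. f' (f s) = s" and "f [] = []"
    and adj: "\<And>s t. tree_adjacent s t \<Longrightarrow> tree_adjacent (f s) (f t)"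
      "\<And>s t. tree_adjacent s t \<Longrightarrow> tree_adjacent (f' s) (f' t)"
  shows "f \<in> tree_automorphisms"
proof -
  have "bij f"
    by (rule o_bij[of f']) (auto simp: inv)
  moreover have "tree_adjacent (f s) (f t) \<longleftrightarrow> tree_adjacent s t" for s t
    using adj(1)[of s t] adj(2)[of "f s" "f t"] by (auto simp: inv)
  ultimately show ?thesis
    using \<open>f [] = []\<close> by (simp add: tree_automorphisms_def)
qed

lemma tree_automorphisms_inv:
  assumes "f \<in> tree_automorphisms"
  shows "f (inv_into UNIV f s) = s" "inv_into UNIV f (f s) = s" "inv_into UNIV f \<in> tree_automorphisms"
proof -
  have f: "bij f" "f [] = []" "\<And>s t. tree_adjacent (f s) (f t) \<longleftrightarrow> tree_adjacent s t"
    using assms by (auto simp: tree_automorphisms_def)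
  show inv: "f (inv_into UNIV f s) = s" "inv_into UNIV f (f s) = s" for s
    using f(1) by (simp_all add: bij_is_inj bij_is_surj surj_f_inv_f)
  have "inv_into UNIV f [] = []"
    using inv(2)[of "[]"] f(2) by simp
  moreover have "tree_adjacent (inv_into UNIV f s) (inv_into UNIV f t)" if "tree_adjacent s t" for s t
    using f(3)[of "inv_into UNIV f s" "inv_into UNIV f t"] that by (simp add: inv)
  ultimately show "inv_into UNIV f \<in> tree_automorphisms"
    by (intro tree_automorphismsI[of _ f]) (auto simp: inv f)
qed

lemma subgroup_tree_automorphisms: "subgroup tree_automorphisms (BijGroup UNIV)"
proof (rule subgroup_BijGroupI)
  show "(\<lambda>x\<in>UNIV. inv_into UNIV f x) \<in> tree_automorphisms" if "f \<in> tree_automorphisms" for f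
    using tree_automorphisms_inv(3)[OF that] by (simp add: restrict_UNIV)
qed (auto simp: tree_automorphisms_def Bij_def compose_def restrict_UNIV
      intro: bij_comp[unfolded o_def] bij_id[unfolded id_def])

text \<open>A permutation \<open>e\<close> of the naturals moves the subtrees above the children of the root as a whole. This
is how \<open>\<tau>\<close> and the bijections \<open>\<eta> j\<close> act on the tree.\<close>

fun map_head :: "(nat \<Rightarrow> nat) \<Rightarrow> nat list \<Rightarrow> nat list" where
  "map_head e [] = []"
| "map_head e (a # s) = e a # s"

lemma map_head_map_head [simp]: "map_head e (map_head e' s) = map_head (e \<circ> e') s"
  by (cases s) auto

lemma map_head_id [simp]: "map_head id s = s"
  by (cases s) auto

lemma map_head_cong: "(\<And>a. a \<in> set (take 1 s) \<Longrightarrow> e a = e' a) \<Longrightarrow> map_head e s = map_head e' s"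
  by (cases s) auto

lemma map_head_append: "map_head e (s @ [n]) = (if s = [] then [e n] else map_head e s @ [n])"
  by (cases s) auto

lemma tree_adjacent_map_head: "tree_adjacent s t \<Longrightarrow> tree_adjacent (map_head e s) (map_head e t)"
  by (auto simp: tree_adjacent_def map_head_append)

lemma map_head_pow: "(map_head e ^^ c) s = map_head (e ^^ c) s"
proof (cases s)
  case Nil
  then show ?thesis by (induction c) auto
next
  case (Cons a u)
  have "(map_head e ^^ c) (a # u) = (e ^^ c) a # u"
    by (induction c) auto
  then show ?thesis
    using Cons by simp
qed

lemma map_head_inverse:
  assumes "bij e"
  shows "map_head e (map_head (inv_into UNIV e) s) = s" "map_head (inv_into UNIV e) (map_head e s) = s"
  using assms by (simp_all add: bij_is_inj surj_iff[THEN iffD1, OF bij_is_surj])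

lemma map_head_automorphism:
  assumes "bij e"
  shows "map_head e \<in> tree_automorphisms"
  by (rule tree_automorphismsI[of _ "map_head (inv_into UNIV e)"])
    (use assms in \<open>auto simp: map_head_inverse tree_adjacent_map_head simp del: map_head_map_head\<close>)

context coordinate_blocks begin

text \<open>The union of the root and of the subtrees above the children in the \<open>j\<close>-th block is a copy of the
whole tree, embedded by \<open>map_head (\<eta> j)\<close>; the glued map acts on it as \<open>f j\<close>.\<close>

definition glue_tree :: "(nat \<Rightarrow> nat list \<Rightarrow> nat list) \<Rightarrow> nat list \<Rightarrow> nat list" where
  "glue_tree f s = (case s of [] \<Rightarrow> [] | a # s' \<Rightarrow>
     map_head (\<eta> (b a)) (f (b a) (map_head (inv_into UNIV (\<eta> (b a))) s)))"

lemma glue_tree_block: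
  assumes "f j [] = []"
  shows "glue_tree f (map_head (\<eta> j) s) = map_head (\<eta> j) (f j s)"
  using assms by (cases s) (auto simp: glue_tree_def inv_f_f[OF inj_block])

lemma tree_block: "\<exists>j s'. s = map_head (\<eta> j) s'"
proof (cases s)
  case (Cons a u)
  then show ?thesis
    using block_coordinate[of a] by (metis map_head.simps(2))
qed (metis map_head.simps(1))

lemma tree_block_append: "\<exists>j s' m. s = map_head (\<eta> j) s' \<and> s @ [n] = map_head (\<eta> j) (s' @ [m])"
proof (cases s)
  case Nil
  obtain k where "n = \<eta> (b n) k"
    using block_coordinate by blast
  then show ?thesis
    using Nil by (intro exI[of _ "b n"] exI[of _ "[]"] exI[of _ k]) simp
next
  case (Cons a u)
  obtain k where "a = \<eta> (b a) k"
    using block_coordinate by blast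
  then show ?thesis
    using Cons by (intro exI[of _ "b a"] exI[of _ "k # u"] exI[of _ n]) simp
qed

text \<open>Adjacent nodes lie in a common copy of the tree: if one of them is the root, the other one is a child
of the root and determines the block.\<close>

lemma tree_adjacent_block:
  assumes "tree_adjacent s t"
  shows "\<exists>j s' t'. s = map_head (\<eta> j) s' \<and> t = map_head (\<eta> j) t' \<and> tree_adjacent s' t'"
  using assms tree_block_append unfolding tree_adjacent_def by metis

lemma glue_tree_inverse:
  assumes "\<And>j. f j [] = []" "\<And>j. f' j [] = []" "\<And>j s. f j (f' j s) = s"
  shows "glue_tree f (glue_tree f' s) = s"
  using tree_block[of s] by (auto simp: glue_tree_block assms)

lemma glue_tree_automorphism:
  assumes f: "\<And>j. f j \<in> tree_automorphisms"
  shows "glue_tree f \<in> tree_automorphisms"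
proof (rule tree_automorphismsI[of _ "glue_tree (\<lambda>j. inv_into UNIV (f j))"])
  note inv = tree_automorphisms_inv[OF f]
  have adj: "tree_adjacent (glue_tree f s) (glue_tree f t)"
    if st: "tree_adjacent s t" and f: "\<And>j. f j \<in> tree_automorphisms" for f s t
  proof -
    obtain j s' t' where "s = map_head (\<eta> j) s'" "t = map_head (\<eta> j) t'" "tree_adjacent s' t'"
      using tree_adjacent_block[OF st] by blast
    then show ?thesis
      using f[of j] by (auto simp: glue_tree_block tree_automorphisms_def intro: tree_adjacent_map_head)
  qed
  have nil: "f j [] = []" "inv_into UNIV (f j) [] = []" for j
    using f[of j] inv(3)[of j] by (auto simp: tree_automorphisms_def)
  show "glue_tree f (glue_tree (\<lambda>j. inv_into UNIV (f j)) s) = s"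
    "glue_tree (\<lambda>j. inv_into UNIV (f j)) (glue_tree f s) = s" for s
    by (rule glue_tree_inverse; simp add: nil inv)+
  show "glue_tree f [] = []"
    by (simp add: glue_tree_def)
  show "tree_adjacent (glue_tree f s) (glue_tree f t)"
    "tree_adjacent (glue_tree (\<lambda>j. inv_into UNIV (f j)) s) (glue_tree (\<lambda>j. inv_into UNIV (f j)) t)"
    if "tree_adjacent s t" for s t
    using adj[OF that f] adj[OF that inv(3)] by auto
qed

end

text \<open>A basic neighbourhood prescribes the images of finitely many nodes. Take for \<open>F j\<close> the first entries of
the nodes and of the prescribed images in the \<open>j\<close>-th prescription. On these \<open>map_head (\<eta> j)\<close> agrees
with a power of \<open>map_head \<tau>\<close>, so conjugating the glued automorphism by that power yields \<open>f j\<close> on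
the nodes in question. The conjugating element is the inverse of \<open>map_head \<tau>\<close>, because nodes are
points that are moved, whereas for the Cantor space the shift acts on functions of the coordinates.\<close>

lemma cyclically_dense_Aut_tree: "cyclically_dense_conjugacy_classes Aut_tree Aut_tree_topology"
proof -
  interpret group Aut_tree
    by (rule group_Aut_tree)
  have carrier: "carrier Aut_tree = tree_automorphisms"
    by (simp add: Aut_tree_def)
  define p where "p j = (from_nat j :: (nat list \<times> nat list) list)" for j
  define realises where "realises f p \<longleftrightarrow> f \<in> tree_automorphisms \<and> (\<forall>(v, w)\<in>set p. f v = w)"
    for f and p :: "(nat list \<times> nat list) list"
  define f where "f j = (if \<exists>f. realises f (p j) then SOME f. realises f (p j) else id)" for j
  define F where "F j = (\<Union>(v, w)\<in>set (p j). set (take 1 v) \<union> set (take 1 w))" for j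
  have f: "realises (f j) (p j)" if "realises f' (p j)" for f' j
    unfolding f_def using someI[of "\<lambda>f. realises f (p j)", OF that] that by auto
  have fH: "f j \<in> tree_automorphisms" for j
  proof (cases "\<exists>f. realises f (p j)")
    case True
    then show ?thesis
      using f[of _ j] by (auto simp: realises_def)
  next
    case False
    then show ?thesis
      by (simp add: f_def tree_automorphisms_def)
  qed
  have "finite (F j)" for j
    by (auto simp: F_def)
  moreover obtain \<tau> :: "nat \<Rightarrow> nat" where \<tau>: "bij \<tau>"
    and scatter: "\<And>F :: nat \<Rightarrow> nat set. (\<And>j. finite (F j)) \<Longrightarrow> \<exists>b \<eta> c. \<forall>j.
       bij_betw (\<eta> j) UNIV {i. b i = (j::nat)} \<and> (\<forall>i\<in>F j. \<eta> j i = (\<tau> ^^ c j) i)"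
    using obtain_scattering_permutation by blast
  ultimately obtain b \<eta> c where \<eta>: "\<And>j. bij_betw (\<eta> j) UNIV {i. b i = (j::nat)}"
    and c: "\<And>j i. i \<in> F j \<Longrightarrow> \<eta> j i = (\<tau> ^^ c j) i"
    using scatter[of F] by blast
  interpret coordinate_blocks b \<eta>
    by standard (rule \<eta>)
  define g where "g = map_head (inv_into UNIV \<tau>)"
  define h where "h = glue_tree f"
  have gh: "g \<in> tree_automorphisms" "h \<in> tree_automorphisms"
    using \<tau> fH by (auto simp: g_def h_def intro: map_head_automorphism glue_tree_automorphism bij_imp_bij_inv)
  have g_pow: "(g ^^ n) (map_head (\<tau> ^^ n) s) = s" "inv_into UNIV (g ^^ n) s = map_head (\<tau> ^^ n) s" for n s
  proof -
    have inv: "(inv_into UNIV \<tau> ^^ n) \<circ> (\<tau> ^^ n) = id" for n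
      unfolding inv_fn[OF \<tau>, symmetric] by (intro inv_o_cancel bij_is_inj bij_fn \<tau>)
    show 1: "(g ^^ n) (map_head (\<tau> ^^ n) s) = s" for s
      by (simp add: g_def map_head_pow inv)
    have "inj (g ^^ n)"
      using gh(1) by (auto simp: tree_automorphisms_def intro: bij_is_inj bij_fn)
    then show "inv_into UNIV (g ^^ n) s = map_head (\<tau> ^^ n) s"
      using 1[of s] by (metis inv_f_f)
  qed
  show ?thesis
  proof (rule cyclically_dense_conjugacy_classesI)
    show "topspace Aut_tree_topology = carrier Aut_tree" "g \<in> carrier Aut_tree" "h \<in> carrier Aut_tree"
      using gh by (simp_all add: carrier)
    fix f' U
    assume f': "f' \<in> U" and U: "openin Aut_tree_topology U"
    have f'H: "f' \<in> tree_automorphisms"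
      using f' openin_subset[OF U] by (auto simp: carrier)
    obtain V where V: "openin (product_topology (\<lambda>_. discrete_topology UNIV) UNIV) V"
        "U = V \<inter> tree_automorphisms"
      using U by (auto simp: Aut_tree_topology_def openin_subtopology)
    then obtain W where W: "finite {v. W v \<noteq> (UNIV :: nat list set)}" "f' \<in> PiE UNIV W" "PiE UNIV W \<subseteq> V"
      using f' unfolding openin_product_topology_alt by auto
    obtain vs where vs: "set vs = {v. W v \<noteq> (UNIV :: nat list set)}"
      using W(1) finite_list by blast
    define j where "j = to_nat (map (\<lambda>v. (v, f' v)) vs)"
    have j: "p j = map (\<lambda>v. (v, f' v)) vs"
      by (simp add: p_def j_def)
    then have "realises (f j) (p j)"
      by (intro f[of f']) (auto simp: realises_def f'H)
    then have fj: "f j v = f' v" if "v \<in> set vs" for v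
      using that by (auto simp: realises_def j)
    let ?q = "power_conjugate Aut_tree g h (c j)"
    have q: "?q v = f' v" if v: "v \<in> set vs" for v
    proof -
      have "?q v = (g ^^ c j) (h (map_head (\<tau> ^^ c j) v))"
        using conjugate_power_BijGroup[OF subgroup_tree_automorphisms gh, of "c j"] g_pow
        by (simp add: Aut_tree_def)
      also have "map_head (\<tau> ^^ c j) v = map_head (\<eta> j) v"
        by (rule map_head_cong) (use v c[of _ j] in \<open>force simp: F_def j\<close>)
      also have "h \<dots> = map_head (\<eta> j) (f' v)"
        unfolding h_def using fj[OF v] fH[of j] by (subst glue_tree_block) (auto simp: tree_automorphisms_def)
      also have "\<dots> = map_head (\<tau> ^^ c j) (f' v)"
        by (rule map_head_cong) (use v c[of _ j] in \<open>force simp: F_def j\<close>)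
      finally show ?thesis
        by (simp only: g_pow)
    qed
    have "?q v \<in> W v" for v
      using q[of v] PiE_mem[OF W(2), of v] by (cases "v \<in> set vs") (auto simp: vs)
    then have "?q \<in> V"
      using W(3) by (auto simp: PiE_UNIV_domain)
    moreover have "?q \<in> carrier Aut_tree"
      using gh by (intro m_closed inv_closed nat_pow_closed) (auto simp: carrier)
    ultimately have "?q \<in> U"
      by (simp add: V(2) carrier)
    then show "\<exists>c. power_conjugate Aut_tree g h c \<in> U"
      by blast
  qed
qed

section \<open>The weak topology on the automorphisms of a probability space\<close>

lemma (in finite_measure) measure_sym_diff_triangle:
  assumes "A \<in> sets M" "B \<in> sets M" "C \<in> sets M"
  shows "measure M (sym_diff A C) \<le> measure M (sym_diff A B) + measure M (sym_diff B C)"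
proof -
  have "measure M (sym_diff A C) \<le> measure M (sym_diff A B \<union> sym_diff B C)"
    using assms by (intro finite_measure_mono) auto
  also have "\<dots> \<le> measure M (sym_diff A B) + measure M (sym_diff B C)"
    using assms by (intro measure_Un_le) auto
  finally show ?thesis .
qed

text \<open>The number \<open>\<mu>(T(A) \<triangle> B)\<close> changes by at most \<open>\<mu>(T(A) \<triangle> S(A))\<close> when \<open>T\<close> is replaced by \<open>S\<close>, so a
neighbourhood of \<open>T\<close> is obtained by controlling the images of finitely many sets. The statement
follows by induction over the construction of open sets from the generating ones.\<close>

lemma Aut_neighbourhood:
  assumes M: "prob_space M" and U: "openin (Aut_topology M) U" and T: "T \<in> U"
  obtains \<A> \<epsilon> where "finite \<A>" "\<A> \<subseteq> sets M" "\<epsilon> > 0"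
    "\<And>S f g. S \<in> carrier (Aut M) \<Longrightarrow> f \<in> T \<Longrightarrow> g \<in> S \<Longrightarrow>
      (\<And>A. A \<in> \<A> \<Longrightarrow> measure M (sym_diff (g ` A) (f ` A)) < \<epsilon>) \<Longrightarrow> S \<in> U"
proof -
  interpret prob_space M by fact
  define near where "near U \<A> \<epsilon> \<longleftrightarrow> finite \<A> \<and> \<A> \<subseteq> sets M \<and> \<epsilon> > 0 \<and>
      (\<forall>S f g. S \<in> carrier (Aut M) \<longrightarrow> f \<in> T \<longrightarrow> g \<in> S \<longrightarrow>
        (\<forall>A\<in>\<A>. measure M (sym_diff (g ` A) (f ` A)) < \<epsilon>) \<longrightarrow> S \<in> U)"
    for U \<A> and \<epsilon> :: real
  have TC: "T \<in> carrier (Aut M)"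
    using T openin_subset[OF U] by auto
  have "generate_topology_on
     {{T \<in> carrier (Aut M). Aut_diff M A B T \<in> U} | A B U. A \<in> sets M \<and> B \<in> sets M \<and> open U} U"
    using U unfolding Aut_topology_def openin_topology_generated_by_iff .
  then have "T \<in> U \<longrightarrow> (\<exists>\<A> \<epsilon>. near U \<A> \<epsilon>)"
  proof (induction rule: generate_topology_on.induct)
    case (Int U V)
    show ?case
    proof
      assume "T \<in> U \<inter> V"
      then obtain \<A> \<epsilon> \<B> \<delta> where *: "near U \<A> \<epsilon>" "near V \<B> \<delta>"
        using Int.IH by blast
      have "near (U \<inter> V) (\<A> \<union> \<B>) (min \<epsilon> \<delta>)"
        using * unfolding near_def by (simp add: ball_Un)
      then show "\<exists>\<A> \<epsilon>. near (U \<inter> V) \<A> \<epsilon>"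
        by blast
    qed
  next
    case (UN K)
    show ?case
    proof
      assume "T \<in> \<Union>K"
      then obtain k \<A> \<epsilon> where "k \<in> K" "near k \<A> \<epsilon>"
        using UN.IH by blast
      then have "near (\<Union>K) \<A> \<epsilon>"
        unfolding near_def by blast
      then show "\<exists>\<A> \<epsilon>. near (\<Union>K) \<A> \<epsilon>"
        by blast
    qed
  next
    case (Basis s)
    show ?case
    proof
      assume Ts: "T \<in> s"
      obtain A B V where s: "s = {T \<in> carrier (Aut M). Aut_diff M A B T \<in> V}"
        and AB: "A \<in> sets M" "B \<in> sets M" and V: "open V"
        using Basis by blast
      obtain \<epsilon> where \<epsilon>: "\<epsilon> > 0" "\<And>r. dist r (Aut_diff M A B T) < \<epsilon> \<Longrightarrow> r \<in> V"
        using V Ts unfolding s open_dist by blast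
      have "S \<in> s" if S: "S \<in> carrier (Aut M)" and f: "f \<in> T" and g: "g \<in> S"
        and less: "measure M (sym_diff (g ` A) (f ` A)) < \<epsilon>" for S f g
      proof -
        have sets: "f ` A \<in> sets M" "g ` A \<in> sets M"
          using Aut_memD(1)[OF TC f] Aut_memD(1)[OF S g] AB by (auto intro: image_measure_automorphism)
        have comm: "sym_diff (f ` A) (g ` A) = sym_diff (g ` A) (f ` A)"
          by auto
        have "measure M (sym_diff (g ` A) B) \<le> measure M (sym_diff (g ` A) (f ` A)) + measure M (sym_diff (f ` A) B)"
          "measure M (sym_diff (f ` A) B) \<le> measure M (sym_diff (f ` A) (g ` A)) + measure M (sym_diff (g ` A) B)"
          using sets AB by (intro measure_sym_diff_triangle; simp)+
        then have "dist (Aut_diff M A B S) (Aut_diff M A B T) < \<epsilon>"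
          using less unfolding Aut_diff_eq[OF S g AB] Aut_diff_eq[OF TC f AB] comm dist_real_def by linarith
        then show ?thesis
          using \<epsilon>(2) S by (simp add: s)
      qed
      then have "near s {A} \<epsilon>"
        using AB \<epsilon>(1) by (simp add: near_def)
      then show "\<exists>\<A> \<epsilon>. near s \<A> \<epsilon>"
        by blast
    qed
  qed simp
  then obtain \<A> \<epsilon> where "near U \<A> \<epsilon>"
    using T by blast
  then show ?thesis
    unfolding near_def by (intro that[of \<A> \<epsilon>]) blast+
qed

text \<open>This is stated for maps rather than for classes, and with preimages rather than images, since
preimages are what the gluing construction controls. Passing to inverse maps turns preimages into
images.\<close>

definition dense_conjugates :: "'a measure \<Rightarrow> ('a \<Rightarrow> 'a) \<Rightarrow> ('a \<Rightarrow> 'a) \<Rightarrow> bool" where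
  "dense_conjugates M g h \<longleftrightarrow> g \<in> measure_automorphisms M \<and> h \<in> measure_automorphisms M \<and>
    (\<forall>f \<A> \<epsilon>. f \<in> measure_automorphisms M \<longrightarrow> finite \<A> \<longrightarrow> \<A> \<subseteq> sets M \<longrightarrow> \<epsilon> > 0 \<longrightarrow>
      (\<exists>c. \<forall>A\<in>\<A>. measure M (sym_diff
        (power_conjugate (MPT M) g h c -` A \<inter> space M)
        (f -` A \<inter> space M)) < \<epsilon>))"

lemma image_inv_MPT:
  assumes f: "f \<in> measure_automorphisms M" and A: "A \<in> sets M"
  shows "(inv\<^bsub>MPT M\<^esub> f) ` A = f -` A \<inter> space M"
proof -
  have AS: "A \<subseteq> space M"
    using A by (rule sets.sets_into_space)
  have b: "inj_on f (space M)" "f ` space M = space M"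
    using measure_automorphismsD(2)[OF f] by (auto simp: bij_betw_def)
  have "(inv\<^bsub>MPT M\<^esub> f) ` A = inv_into (space M) f ` A"
    using AS by (auto simp: inv_MPT[OF f])
  also have "\<dots> = f -` A \<inter> space M"
  proof (intro equalityI subsetI)
    fix x assume "x \<in> inv_into (space M) f ` A"
    then show "x \<in> f -` A \<inter> space M"
      using AS b(2) by (auto simp: f_inv_into_f inv_into_into subset_iff)
  next
    fix x assume "x \<in> f -` A \<inter> space M"
    then show "x \<in> inv_into (space M) f ` A"
      using inv_into_f_f[OF b(1), of x] by force
  qed
  finally show ?thesis .
qed

text \<open>The conjugates of the class of the inverse of \<open>h\<close> are the classes of the inverses of the conjugates of
\<open>h\<close>. A conjugate whose preimages are close to those of the inverse of \<open>f\<close> has an inverse whose images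
are close to those of \<open>f\<close>.\<close>

lemma cyclically_dense_AutI:
  assumes M: "prob_space M" and dense: "dense_conjugates M g h"
  shows "cyclically_dense_conjugacy_classes (Aut M) (Aut_topology M)"
proof -
  interpret P: group "MPT M" by (rule group_MPT)
  interpret A: group "Aut M" by (rule group_Aut)
  interpret N: normal "AE_trivial M" "MPT M" by (rule normal_AE_trivial)
  let ?\<pi> = "\<lambda>f. AE_trivial M #>\<^bsub>MPT M\<^esub> f"
  interpret \<pi>: group_hom "MPT M" "Aut M" ?\<pi>
    unfolding Aut_def
    by (intro group_hom.intro group_hom_axioms.intro group_MPT N.r_coset_hom_Mod N.factorgroup_is_group)
  have gh: "g \<in> carrier (MPT M)" "h \<in> carrier (MPT M)"
    using dense by (simp_all add: dense_conjugates_def)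
  show ?thesis
  proof (rule A.cyclically_dense_conjugacy_classesI[where g = "?\<pi> g" and h = "?\<pi> (inv\<^bsub>MPT M\<^esub> h)"])
    show "topspace (Aut_topology M) = carrier (Aut M)" "?\<pi> g \<in> carrier (Aut M)"
      "?\<pi> (inv\<^bsub>MPT M\<^esub> h) \<in> carrier (Aut M)"
      using gh by (simp_all add: \<pi>.hom_closed del: \<pi>.hom_inv carrier_MPT)
    fix T U assume T: "T \<in> U" and U: "openin (Aut_topology M) U"
    have TC: "T \<in> carrier (Aut M)"
      using T openin_subset[OF U] by auto
    then obtain f where f: "f \<in> carrier (MPT M)" "T = ?\<pi> f"
      by (auto simp: carrier_Aut)
    have fT: "f \<in> T"
      unfolding f(2) by (rule P.rcos_self[OF f(1) N.is_subgroup])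
    obtain \<A> \<epsilon> where \<A>: "finite \<A>" "\<A> \<subseteq> sets M" "\<epsilon> > 0"
      and near: "\<And>S f g. S \<in> carrier (Aut M) \<Longrightarrow> f \<in> T \<Longrightarrow> g \<in> S \<Longrightarrow>
        (\<And>A. A \<in> \<A> \<Longrightarrow> measure M (sym_diff (g ` A) (f ` A)) < \<epsilon>) \<Longrightarrow> S \<in> U"
      using Aut_neighbourhood[OF M U T] by metis
    have f': "inv\<^bsub>MPT M\<^esub> f \<in> measure_automorphisms M"
      using P.inv_closed[OF f(1)] by simp
    obtain c where c: "\<And>A. A \<in> \<A> \<Longrightarrow> measure M (sym_diff
        (power_conjugate (MPT M) g h c -` A \<inter> space M)
        ((inv\<^bsub>MPT M\<^esub> f) -` A \<inter> space M)) < \<epsilon>"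
      using dense f' \<A> unfolding dense_conjugates_def by meson
    let ?gc = "g [^]\<^bsub>MPT M\<^esub> c"
    let ?q = "?gc \<otimes>\<^bsub>MPT M\<^esub> h \<otimes>\<^bsub>MPT M\<^esub> inv\<^bsub>MPT M\<^esub> ?gc"
    have gc: "?gc \<in> carrier (MPT M)"
      using gh by (intro P.nat_pow_closed)
    have q: "?q \<in> carrier (MPT M)"
      using gh gc by (intro P.m_closed P.inv_closed)
    have "inv\<^bsub>MPT M\<^esub> ?q = ?gc \<otimes>\<^bsub>MPT M\<^esub> inv\<^bsub>MPT M\<^esub> h \<otimes>\<^bsub>MPT M\<^esub> inv\<^bsub>MPT M\<^esub> ?gc"
      using gh gc by (simp add: P.inv_mult_group P.m_assoc del: carrier_MPT)
    then have "?\<pi> (inv\<^bsub>MPT M\<^esub> ?q) = power_conjugate (Aut M) (?\<pi> g) (?\<pi> (inv\<^bsub>MPT M\<^esub> h)) c"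
      using gh gc by (simp add: \<pi>.hom_mult \<pi>.hom_inv \<pi>.hom_nat_pow del: carrier_MPT)
    moreover have "?\<pi> (inv\<^bsub>MPT M\<^esub> ?q) \<in> U"
    proof (rule near[OF _ fT])
      show "?\<pi> (inv\<^bsub>MPT M\<^esub> ?q) \<in> carrier (Aut M)"
        using P.inv_closed[OF q] by (rule \<pi>.hom_closed)
      show "inv\<^bsub>MPT M\<^esub> ?q \<in> ?\<pi> (inv\<^bsub>MPT M\<^esub> ?q)"
        by (rule P.rcos_self[OF P.inv_closed[OF q] N.is_subgroup])
      fix A assume A: "A \<in> \<A>"
      then have "A \<in> sets M"
        using \<A> by blast
      moreover have "f ` A = (inv\<^bsub>MPT M\<^esub> f) -` A \<inter> space M"
        using image_inv_MPT[OF f' \<open>A \<in> sets M\<close>] f(1) by (simp add: P.inv_inv del: carrier_MPT)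
      ultimately show "measure M (sym_diff ((inv\<^bsub>MPT M\<^esub> ?q) ` A) (f ` A)) < \<epsilon>"
        using c[OF A] image_inv_MPT[of ?q M A] q by simp
    qed
    ultimately show "\<exists>c. power_conjugate (Aut M) (?\<pi> g) (?\<pi> (inv\<^bsub>MPT M\<^esub> h)) c \<in> U"
      by metis
  qed
qed

section \<open>Automorphisms of the Cantor measure\<close>

lemma cylinder_union_measurable [measurable]: "cylinder_union L \<in> sets cantor_measure"
proof -
  have "{x \<in> space cantor_measure. \<exists>l\<in>set L. \<forall>i\<in>{..<length l}. x i = l ! i} \<in> sets cantor_measure"
    by measurable
  then show ?thesis
    by (simp add: cylinder_union_def Ball_def)
qed

lemma cylinder_union_Compl: "\<exists>L'. - cylinder_union L = cylinder_union L'"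
proof -
  obtain n where n: "code_support L \<subseteq> {..<n}"
    using finite_code_support[of L] finite_nat_iff_bounded by metis
  show ?thesis
  proof (rule obtain_code[of n "- cylinder_union L"])
    show "x \<in> - cylinder_union L \<longleftrightarrow> y \<in> - cylinder_union L" if "\<And>i. i < n \<Longrightarrow> x i = y i" for x y
      using cylinder_union_cong[of L x y] n that by auto
  qed blast
qed

lemma cylinder_union_concat: "cylinder_union (concat Ls) = (\<Union>L\<in>set Ls. cylinder_union L)"
  by (auto simp: cylinder_union_def)

lemma sets_cantor_measure_subset: "sets cantor_measure \<subseteq> sigma_sets UNIV (range cylinder_union)"
proof
  let ?S = "sigma UNIV (range cylinder_union)"
  have "(\<lambda>x. x) \<in> ?S \<rightarrow>\<^sub>M cantor_measure"
  proof (rule measurable_into_cantorI)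
    fix i
    obtain L where "{x. x i} = cylinder_union L"
      using obtain_code[of "Suc i" "{x. x i}"] by blast
    then have "{x. x i} \<in> sets ?S"
      by (auto intro: sigma_sets.Basic)
    then have "Measurable.pred ?S (\<lambda>x. x i)"
      by (simp add: pred_def)
    then show "(\<lambda>x. x i) \<in> ?S \<rightarrow>\<^sub>M count_space UNIV" .
  qed
  from measurable_sets[OF this] show "A \<in> sigma_sets UNIV (range cylinder_union)"
    if "A \<in> sets cantor_measure" for A
    using that by (simp add: space_measure_of_conv)
qed

text \<open>The sets that can be approximated by clopen sets form a sigma-algebra. For a countable union, first
cut it off after finitely many members by continuity of the measure, then approximate each of these.\<close>

lemma approximate_by_cylinders:
  assumes A: "A \<in> sets cantor_measure" and "\<epsilon> > 0"
  shows "\<exists>L. measure cantor_measure (sym_diff A (cylinder_union L)) < \<epsilon>"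
proof -
  have "A \<in> sigma_sets UNIV (range cylinder_union)"
    using A sets_cantor_measure_subset by blast
  then have "A \<in> sets cantor_measure \<and> (\<forall>\<epsilon>>0. \<exists>L. measure cantor_measure (sym_diff A (cylinder_union L)) < \<epsilon>)"
  proof (induction rule: sigma_sets.induct)
    case (Basic a)
    then obtain L where "a = cylinder_union L"
      by blast
    then show ?case
      by (auto intro: exI[of _ L] cylinder_union_measurable)
  next
    case Empty
    have "cylinder_union [] = {}"
      by (simp add: cylinder_union_def)
    then show ?case
      by (metis (no_types, lifting) Diff_cancel Un_absorb measure_empty sets.empty_sets)
  next
    case (Compl a)
    show ?case
    proof (intro conjI allI impI)
      show "UNIV - a \<in> sets cantor_measure"
        using Compl sets.compl_sets[of a cantor_measure] by simp
      fix \<epsilon> :: real assume "\<epsilon> > 0"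
      then obtain L where L: "measure cantor_measure (sym_diff a (cylinder_union L)) < \<epsilon>"
        using Compl by blast
      obtain L' where L': "- cylinder_union L = cylinder_union L'"
        using cylinder_union_Compl by blast
      have "sym_diff (UNIV - a) (cylinder_union L') = sym_diff a (cylinder_union L)"
        unfolding L'[symmetric] by auto
      then show "\<exists>L. measure cantor_measure (sym_diff (UNIV - a) (cylinder_union L)) < \<epsilon>"
        using L by metis
    qed
  next
    case (Union a)
    have a: "a i \<in> sets cantor_measure" for i
      using Union by blast
    let ?A = "\<Union>i. a i"
    show ?case
    proof (intro conjI allI impI)
      show A: "?A \<in> sets cantor_measure"
        using a by blast
      fix \<epsilon> :: real assume \<epsilon>: "\<epsilon> > 0"
      have "(\<lambda>n. measure cantor_measure (\<Union>i<n. a i)) \<longlonglongrightarrow> measure cantor_measure (\<Union>n. \<Union>i<n. a i)"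
        using a by (intro cantor.finite_Lim_measure_incseq incseq_SucI) (auto simp: lessThan_Suc)
      moreover have "(\<Union>n. \<Union>i<n. a i) = ?A"
        by auto
      ultimately have "\<forall>\<^sub>F n in sequentially. measure cantor_measure ?A - \<epsilon> / 2 < measure cantor_measure (\<Union>i<n. a i)"
        using \<epsilon> by (intro order_tendstoD) auto
      then obtain n where n: "measure cantor_measure ?A - \<epsilon> / 2 < measure cantor_measure (\<Union>i<n. a i)"
        using eventually_happens'[OF sequentially_bot] by blast
      have "\<exists>L. measure cantor_measure (sym_diff (a i) (cylinder_union L)) < \<epsilon> / (2 * Suc n)" for i
        using Union \<epsilon> by simp
      then obtain L where L: "\<And>i. measure cantor_measure (sym_diff (a i) (cylinder_union (L i))) < \<epsilon> / (2 * Suc n)"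
        by metis
      let ?L = "concat (map L [0..<n])"
      have c: "cylinder_union ?L = (\<Union>i<n. cylinder_union (L i))"
        unfolding cylinder_union_concat by auto
      have "measure cantor_measure (sym_diff ?A (cylinder_union ?L))
        \<le> measure cantor_measure ((?A - (\<Union>i<n. a i)) \<union> (\<Union>i<n. sym_diff (a i) (cylinder_union (L i))))"
        unfolding c using a by (intro cantor.finite_measure_mono sets.Un sets.Diff A sets.finite_UN) (auto simp: cylinder_union_measurable)
      also have "\<dots> \<le> measure cantor_measure (?A - (\<Union>i<n. a i)) + measure cantor_measure (\<Union>i<n. sym_diff (a i) (cylinder_union (L i)))"
        using a by (intro measure_Un_le sets.Diff A sets.finite_UN sets.Un) (auto simp: cylinder_union_measurable)
      also have "measure cantor_measure (?A - (\<Union>i<n. a i)) < \<epsilon> / 2"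
        using n a A by (subst cantor.finite_measure_Diff) auto
      also have "measure cantor_measure (\<Union>i<n. sym_diff (a i) (cylinder_union (L i))) \<le> (\<Sum>i<n. measure cantor_measure (sym_diff (a i) (cylinder_union (L i))))"
        using a by (intro measure_UNION_le) (auto simp: cylinder_union_measurable)
      also have "\<dots> \<le> (\<Sum>i<n. \<epsilon> / (2 * Suc n))"
        using L by (intro sum_mono less_imp_le)
      also have "\<dots> \<le> \<epsilon> / 2"
        using \<epsilon> by (simp add: field_simps)
      finally show "\<exists>L. measure cantor_measure (sym_diff ?A (cylinder_union L)) < \<epsilon>"
        by (intro exI[of _ ?L]) simp
    qed
  qed
  then show ?thesis
    using \<open>\<epsilon> > 0\<close> by blast
qed

lemma measure_preserving_map_measure:
  "measure_preserving_map M f \<Longrightarrow> A \<in> sets M \<Longrightarrow> measure M (f -` A \<inter> space M) = measure M A"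
  by (simp add: measure_preserving_map_def measure_def)

lemma gluable_group_measure_automorphisms: "gluable_group (measure_automorphisms cantor_measure)"
proof (rule gluable_group.intro)
  show "subgroup (measure_automorphisms cantor_measure) (BijGroup UNIV)"
    using subgroup_measure_automorphisms[of cantor_measure] by simp
  have I: "f \<in> measure_automorphisms cantor_measure"
    if "bij f" "measure_preserving_map cantor_measure f" "inv_into UNIV f \<in> cantor_measure \<rightarrow>\<^sub>M cantor_measure" for f
    using that by (simp add: measure_automorphisms_def Bij_def)
  show "(\<lambda>x. x \<circ> \<tau>) \<in> measure_automorphisms cantor_measure" if "bij \<tau>" for \<tau>
  proof (rule I)
    have homeo: "homeomorphic_map cantor_space cantor_space (\<lambda>x. x \<circ> \<tau>)"
      using that by (rule reindex_homeomorphic_map)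
    show "bij (\<lambda>x :: nat \<Rightarrow> bool. x \<circ> \<tau>)"
      using homeo by (rule homeo_bij)
    show "measure_preserving_map cantor_measure (\<lambda>x. x \<circ> \<tau>)"
      using that by (intro reindex_measure_preserving bij_is_inj)
    show "inv_into UNIV (\<lambda>x. x \<circ> \<tau>) \<in> cantor_measure \<rightarrow>\<^sub>M cantor_measure"
      by (rule homeo_measurable[OF homeo_inv[OF homeo]])
  qed
  fix b \<eta> and f :: "nat \<Rightarrow> (nat \<Rightarrow> bool) \<Rightarrow> nat \<Rightarrow> bool"
  assume "coordinate_blocks b \<eta>" and f: "\<And>j. f j \<in> measure_automorphisms cantor_measure"
  then interpret coordinate_blocks b \<eta> by simp
  have bij: "bij (f j)" for j
    using measure_automorphismsD(2)[OF f] by simp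
  show "glue f \<in> measure_automorphisms cantor_measure"
  proof (rule I)
    show "bij (glue f)"
      using bij by (rule glue_bij)
    show "measure_preserving_map cantor_measure (glue f)"
      using measure_automorphismsD(3)[OF f] by (rule measure_preserving_glue)
    show "inv_into UNIV (glue f) \<in> cantor_measure \<rightarrow>\<^sub>M cantor_measure"
      unfolding glue_bij(2)[OF bij] using measure_automorphismsD(6)[OF f] by (intro measurable_glue) simp
  qed
qed

text \<open>Given \<open>f\<close> and a measurable set \<open>A\<close>, choose a clopen set \<open>L\<close> close to \<open>A\<close> and a clopen set \<open>E\<close> close to the
preimage of \<open>L\<close> under \<open>f\<close>. A conjugate \<open>q\<close> under which the preimage of \<open>L\<close> is close to \<open>E\<close> satisfies
\<open>q\<^sup>-\<^sup>1(A) \<approx> q\<^sup>-\<^sup>1(L) \<approx> E \<approx> f\<^sup>-\<^sup>1(L) \<approx> f\<^sup>-\<^sup>1(A)\<close>, where each of the four errors is less than a quarter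
of \<open>\<epsilon>\<close>.\<close>

lemma cantor_dense_conjugates:
  obtains g h where "dense_conjugates cantor_measure g h"
proof -
  let ?H = "measure_automorphisms cantor_measure" and ?\<mu> = "measure cantor_measure"
  interpret gluable_group ?H
    by (rule gluable_group_measure_automorphisms)
  have G: "MPT cantor_measure = G"
    by (simp add: MPT_def)
  interpret group G
    by (rule group_BijGroup_restrict[OF subgroup_H])
  have sets: "f -` A \<in> sets cantor_measure" if "f \<in> ?H" "A \<in> sets cantor_measure" for f A
    using measurable_sets[OF measure_automorphismsD(4)[OF that(1)] that(2)] by simp
  have pres: "?\<mu> (f -` A) = ?\<mu> A" if "measure_preserving_map cantor_measure f" "A \<in> sets cantor_measure" for f A
    using measure_preserving_map_measure[OF that] by simp
  obtain g h where gh: "g \<in> ?H" "h \<in> ?H" and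
    dense: "\<And>f N P. f \<in> ?H \<Longrightarrow> (\<And>L E. (L, E) \<in> set P \<Longrightarrow>
        ?\<mu> (sym_diff (f -` cylinder_union L) (cylinder_union E)) < 1 / Suc N) \<Longrightarrow>
      \<exists>c. \<forall>(L, E)\<in>set P. ?\<mu> (sym_diff
        (power_conjugate G g h c -` cylinder_union L) (cylinder_union E)) < 1 / Suc N"
  proof (rule obtain_dense_conjugates[of "\<lambda>N A E. ?\<mu> (sym_diff A E) < 1 / Suc N"])
    fix N f L E \<rho> assume f: "f \<in> ?H" and \<rho>: "inj (\<rho> :: nat \<Rightarrow> nat)"
      and less: "?\<mu> (sym_diff (f -` cylinder_union L) (cylinder_union E)) < 1 / real (Suc N)"
    let ?r = "\<lambda>x :: nat \<Rightarrow> bool. x \<circ> \<rho>"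
    have "?\<mu> (?r -` sym_diff (f -` cylinder_union L) (cylinder_union E)) =
        ?\<mu> (sym_diff (f -` cylinder_union L) (cylinder_union E))"
      using sets[OF f] by (intro pres reindex_measure_preserving \<rho> sets.Un sets.Diff) (auto simp: cylinder_union_measurable)
    then show "?\<mu> (sym_diff (?r -` (f -` cylinder_union L)) (?r -` cylinder_union E)) < 1 / real (Suc N)"
      using less unfolding vimage_Un vimage_Diff by simp
  qed blast
  have "dense_conjugates cantor_measure g h"
    unfolding dense_conjugates_def
  proof (intro conjI gh allI impI)
    fix f \<A> and \<epsilon> :: real
    assume f: "f \<in> ?H" and \<A>: "finite \<A>" "\<A> \<subseteq> sets cantor_measure" and \<epsilon>: "\<epsilon> > 0"
    obtain N where "1 / (\<epsilon> / 4) < real N"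
      using reals_Archimedean2 by blast
    then have N: "1 / real (Suc N) < \<epsilon> / 4"
      using \<epsilon> by (simp add: field_simps)
    have "\<exists>L E. ?\<mu> (sym_diff A (cylinder_union L)) < \<epsilon> / 4 \<and>
        ?\<mu> (sym_diff (f -` cylinder_union L) (cylinder_union E)) < 1 / Suc N" if "A \<in> \<A>" for A
    proof -
      have "A \<in> sets cantor_measure" "0 < \<epsilon> / 4" "0 < 1 / real (Suc N)"
        using that \<A> \<epsilon> by auto
      then obtain L where "?\<mu> (sym_diff A (cylinder_union L)) < \<epsilon> / 4"
        using approximate_by_cylinders by blast
      moreover obtain E where "?\<mu> (sym_diff (f -` cylinder_union L) (cylinder_union E)) < 1 / Suc N"
        using approximate_by_cylinders[OF sets[OF f cylinder_union_measurable] \<open>0 < 1 / real (Suc N)\<close>] by blast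
      ultimately show ?thesis
        by blast
    qed
    then obtain L E where L: "\<And>A. A \<in> \<A> \<Longrightarrow> ?\<mu> (sym_diff A (cylinder_union (L A))) < \<epsilon> / 4"
      and E: "\<And>A. A \<in> \<A> \<Longrightarrow> ?\<mu> (sym_diff (f -` cylinder_union (L A)) (cylinder_union (E A))) < 1 / Suc N"
      by metis
    obtain As where As: "set As = \<A>"
      using \<A>(1) finite_list by blast
    have "\<And>L' E'. (L', E') \<in> set (map (\<lambda>A. (L A, E A)) As) \<Longrightarrow>
        ?\<mu> (sym_diff (f -` cylinder_union L') (cylinder_union E')) < 1 / Suc N"
      using E As by auto
    from dense[OF f this] obtain c where
      "\<forall>(L', E')\<in>set (map (\<lambda>A. (L A, E A)) As). ?\<mu> (sym_diff
        (power_conjugate G g h c -` cylinder_union L') (cylinder_union E')) < 1 / Suc N"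
      by blast
    then have c: "\<And>A. A \<in> \<A> \<Longrightarrow> ?\<mu> (sym_diff
        (power_conjugate G g h c -` cylinder_union (L A)) (cylinder_union (E A))) < 1 / Suc N"
      unfolding As[symmetric] by simp
    let ?q = "power_conjugate G g h c"
    have "?q \<in> carrier G"
      using gh by (intro m_closed inv_closed nat_pow_closed) auto
    then have q: "?q \<in> ?H"
      by simp
    have "?\<mu> (sym_diff (?q -` A) (f -` A)) < \<epsilon>" if A: "A \<in> \<A>" for A
    proof -
      let ?L = "cylinder_union (L A)" and ?E = "cylinder_union (E A)"
      have As: "A \<in> sets cantor_measure"
        using A \<A> by blast
      have meas: "?q -` A \<in> sets cantor_measure" "f -` A \<in> sets cantor_measure"
        "?q -` ?L \<in> sets cantor_measure" "f -` ?L \<in> sets cantor_measure" "?E \<in> sets cantor_measure"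
        using sets[OF q] sets[OF f] As cylinder_union_measurable by auto
      have *: "?\<mu> (sym_diff (u -` A) (u -` ?L)) < \<epsilon> / 4" if "u \<in> ?H" for u
      proof -
        have "?\<mu> (u -` sym_diff A ?L) = ?\<mu> (sym_diff A ?L)"
          using As by (intro pres measure_automorphismsD(3)[OF that] sets.Un sets.Diff) (auto simp: cylinder_union_measurable)
        then show ?thesis
          using L[OF A] by (simp add: vimage_Un vimage_Diff)
      qed
      have "?\<mu> (sym_diff (?q -` A) (f -` A)) \<le> ?\<mu> (sym_diff (?q -` A) (?q -` ?L)) + ?\<mu> (sym_diff (?q -` ?L) (f -` A))"
        using meas by (intro cantor.measure_sym_diff_triangle)
      moreover have "?\<mu> (sym_diff (?q -` ?L) (f -` A)) \<le> ?\<mu> (sym_diff (?q -` ?L) ?E) + ?\<mu> (sym_diff ?E (f -` A))"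
        using meas by (intro cantor.measure_sym_diff_triangle)
      moreover have "?\<mu> (sym_diff ?E (f -` A)) \<le> ?\<mu> (sym_diff ?E (f -` ?L)) + ?\<mu> (sym_diff (f -` ?L) (f -` A))"
        using meas by (intro cantor.measure_sym_diff_triangle)
      moreover have "?\<mu> (sym_diff ?E (f -` ?L)) < \<epsilon> / 4"
        using E[OF A] N by (simp add: Un_commute)
      moreover have "?\<mu> (sym_diff (f -` ?L) (f -` A)) < \<epsilon> / 4"
        using *[OF f] by (simp add: Un_commute)
      ultimately show ?thesis
        using *[OF q] c[OF A] N by linarith
    qed
    then show "\<exists>c. \<forall>A\<in>\<A>. ?\<mu> (sym_diff
        (power_conjugate (MPT cantor_measure) g h c -` A \<inter> space cantor_measure)
        (f -` A \<inter> space cantor_measure)) < \<epsilon>"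
      unfolding G by (intro exI[of _ c]) simp
  qed
  then show ?thesis
    by (rule that)
qed

section \<open>Isomorphisms modulo null sets\<close>

locale iso_mod0 =
  fixes M :: "'a measure" and N :: "'b measure" and \<phi> :: "'a \<Rightarrow> 'b" and \<psi> :: "'b \<Rightarrow> 'a"
  assumes measurable_\<phi>: "\<phi> \<in> M \<rightarrow>\<^sub>M N" and measurable_\<psi>: "\<psi> \<in> N \<rightarrow>\<^sub>M M"
    and distr_\<phi>: "distr M N \<phi> = N" and distr_\<psi>: "distr N M \<psi> = M"
    and AE_\<psi>_\<phi>: "AE x in M. \<psi> (\<phi> x) = x" and AE_\<phi>_\<psi>: "AE y in N. \<phi> (\<psi> y) = y"

lemma iso_mod0_sym: "iso_mod0 M N \<phi> \<psi> \<Longrightarrow> iso_mod0 N M \<psi> \<phi>"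
  by (auto simp: iso_mod0_def)

lemma AE_distr_eqD:
  assumes "f \<in> M \<rightarrow>\<^sub>M N" "distr M N f = N" "AE y in N. P y"
  shows "AE x in M. P (f x)"
  by (rule AE_distrD[OF assms(1), unfolded assms(2), OF assms(3)])

lemma iso_mod0_trans:
  assumes "iso_mod0 M N \<phi> \<psi>" "iso_mod0 N K \<phi>' \<psi>'"
  shows "iso_mod0 M K (\<phi>' \<circ> \<phi>) (\<psi> \<circ> \<psi>')"
proof -
  interpret A: iso_mod0 M N \<phi> \<psi> by fact
  interpret B: iso_mod0 N K \<phi>' \<psi>' by fact
  note m = A.measurable_\<phi> A.measurable_\<psi> B.measurable_\<phi> B.measurable_\<psi>
  have d: "distr M K (\<phi>' \<circ> \<phi>) = K" "distr K M (\<psi> \<circ> \<psi>') = M"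
    using distr_distr[OF m(3,1)] distr_distr[OF m(2,4)] A.distr_\<phi> A.distr_\<psi> B.distr_\<phi> B.distr_\<psi> by simp_all
  have "AE x in M. \<psi>' (\<phi>' (\<phi> x)) = \<phi> x"
    using AE_distr_eqD[OF m(1) A.distr_\<phi> B.AE_\<psi>_\<phi>] .
  then have 1: "AE x in M. (\<psi> \<circ> \<psi>') ((\<phi>' \<circ> \<phi>) x) = x"
    using A.AE_\<psi>_\<phi> by eventually_elim simp
  have "AE y in K. \<phi> (\<psi> (\<psi>' y)) = \<psi>' y"
    using AE_distr_eqD[OF m(4) B.distr_\<psi> A.AE_\<phi>_\<psi>] .
  then have 2: "AE y in K. (\<phi>' \<circ> \<phi>) ((\<psi> \<circ> \<psi>') y) = y"
    using B.AE_\<phi>_\<psi> by eventually_elim simp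
  show ?thesis
    using m d 1 2 by (intro iso_mod0.intro measurable_comp) 
qed

text \<open>An almost everywhere left inverse of a measure preserving map is automatically measure preserving and
an inverse on both sides, because the set where it is a right inverse contains almost every value of
the map.\<close>

lemma iso_mod0I:
  assumes \<phi>: "\<phi> \<in> M \<rightarrow>\<^sub>M N" "distr M N \<phi> = N" and \<psi>: "\<psi> \<in> N \<rightarrow>\<^sub>M M"
    and left: "AE x in M. \<psi> (\<phi> x) = x" and meas: "{y \<in> space N. \<phi> (\<psi> y) = y} \<in> sets N"
  shows "iso_mod0 M N \<phi> \<psi>"
proof
  have "distr N M \<psi> = distr M M (\<psi> \<circ> \<phi>)"
    using distr_distr[OF \<psi> \<phi>(1)] \<phi>(2) by simp
  also have "\<dots> = distr M M (\<lambda>x. x)"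
    using left \<phi> \<psi> by (intro distr_cong_AE) (auto intro: measurable_comp)
  finally show "distr N M \<psi> = M"
    by simp
  have "AE x in M. \<phi> (\<psi> (\<phi> x)) = \<phi> x"
    using left by eventually_elim simp
  then have "AE y in distr M N \<phi>. \<phi> (\<psi> y) = y"
    by (subst AE_distr_iff[OF \<phi>(1)]) (use meas in auto)
  then show "AE y in N. \<phi> (\<psi> y) = y"
    by (simp only: \<phi>(2))
qed fact+

lemma AE_conull_set:
  assumes "AE x in M. P x"
  obtains A where "A \<in> sets M" "AE x in M. x \<in> A" "\<And>x. x \<in> A \<Longrightarrow> P x"
proof -
  obtain Z where Z: "{x \<in> space M. \<not> P x} \<subseteq> Z" "emeasure M Z = 0" "Z \<in> sets M"
    using AE_E[OF assms] by blast
  have "AE x in M. x \<in> space M - Z"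
    using Z by (intro AE_I[where N = Z]) auto
  then show ?thesis
    using Z by (intro that[of "space M - Z"]) auto
qed

lemma MPT_inv_apply:
  assumes f: "f \<in> measure_automorphisms M" and x: "x \<in> space M"
  shows "f ((inv\<^bsub>MPT M\<^esub> f) x) = x" "(inv\<^bsub>MPT M\<^esub> f) (f x) = x"
    "f x \<in> space M" "(inv\<^bsub>MPT M\<^esub> f) x \<in> space M"
  using measure_automorphismsD(2)[OF f] x
  by (auto simp: inv_MPT[OF f] bij_betw_def inv_into_into f_inv_into_f)

lemma MPT_inv_closed: "f \<in> measure_automorphisms M \<Longrightarrow> inv\<^bsub>MPT M\<^esub> f \<in> measure_automorphisms M"
  using group.inv_closed[OF group_MPT, of f M] by simp

text \<open>Intersecting the translates of \<open>A\<close> under all iterates of \<open>f\<close> and of its inverse gives an invariant set,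
still of full measure since there are countably many iterates.\<close>

lemma invariant_conull_subset:
  assumes f: "f \<in> measure_automorphisms M" and A: "A \<in> sets M" "AE x in M. x \<in> A"
  obtains Y where "Y \<in> sets M" "Y \<subseteq> A" "AE x in M. x \<in> Y"
    "\<And>x. x \<in> space M \<Longrightarrow> f x \<in> Y \<longleftrightarrow> x \<in> Y"
proof -
  let ?F = "inv\<^bsub>MPT M\<^esub> f"
  note F = MPT_inv_closed[OF f]
  have pow: "(u ^^ k) \<in> M \<rightarrow>\<^sub>M M" "AE x in M. (u ^^ k) x \<in> A"
    if u: "u \<in> measure_automorphisms M" for u k
  proof -
    show "(u ^^ k) \<in> M \<rightarrow>\<^sub>M M"
    proof (induction k)
      case (Suc k)
      then show ?case
        using measurable_comp[OF Suc measure_automorphismsD(4)[OF u]] by (simp only: funpow.simps)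
    qed (simp add: id_def)
    show "AE x in M. (u ^^ k) x \<in> A"
    proof (induction k)
      case (Suc k)
      then have "AE x in M. (u ^^ k) (u x) \<in> A"
        by (rule AE_measure_preserving[OF measure_automorphismsD(3)[OF u]])
      then show ?case
        by (simp add: funpow_swap1)
    qed (use A in simp)
  qed
  define Y where "Y = {x \<in> space M. (\<forall>k. (f ^^ k) x \<in> A) \<and> (\<forall>k. (?F ^^ k) x \<in> A)}"
  have Y_Int: "Y = (\<Inter>k. ((f ^^ k) -` A \<inter> space M) \<inter> ((?F ^^ k) -` A \<inter> space M))"
    by (auto simp: Y_def)
  have "Y \<in> sets M"
    unfolding Y_Int using measurable_sets[OF pow(1)[OF f] A(1)] measurable_sets[OF pow(1)[OF F] A(1)]
    by (intro sets.countable_INT) auto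
  moreover have "Y \<subseteq> A"
  proof
    fix x assume "x \<in> Y"
    then have "(f ^^ 0) x \<in> A"
      unfolding Y_def by blast
    then show "x \<in> A"
      by simp
  qed
  moreover have "AE x in M. x \<in> Y"
  proof -
    have "AE x in M. \<forall>k. (f ^^ k) x \<in> A" "AE x in M. \<forall>k. (?F ^^ k) x \<in> A"
      using pow(2)[OF f] pow(2)[OF F] by (simp_all add: AE_all_countable)
    then show ?thesis
      using AE_space by eventually_elim (simp add: Y_def)
  qed
  moreover have "f x \<in> Y \<longleftrightarrow> x \<in> Y" if x: "x \<in> space M" for x
  proof -
    have up: "(f ^^ k) (f x) = (f ^^ Suc k) x" for k
      by (simp add: funpow_swap1)
    have down: "(?F ^^ Suc k) (f x) = (?F ^^ k) x" for k
      using MPT_inv_apply(2)[OF f x] by (simp add: funpow_Suc_right del: funpow.simps)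
    show ?thesis
    proof
      assume fx: "f x \<in> Y"
      then have Y: "(f ^^ k) (f x) \<in> A" "(?F ^^ k) (f x) \<in> A" for k
        by (auto simp: Y_def)
      have "(f ^^ k) x \<in> A" for k
      proof (cases k)
        case 0
        then show ?thesis
          using Y(2)[of "Suc 0"] down[of 0] by simp
      next
        case (Suc n)
        then show ?thesis
          using Y(1)[of n] by (simp only: up)
      qed
      moreover have "(?F ^^ k) x \<in> A" for k
        using Y(2)[of "Suc k"] by (simp only: down)
      ultimately show "x \<in> Y"
        using x by (simp add: Y_def)
    next
      assume "x \<in> Y"
      then have Y: "(f ^^ k) x \<in> A" "(?F ^^ k) x \<in> A" for k
        by (auto simp: Y_def)
      have "(f ^^ k) (f x) \<in> A" for k
        using Y(1)[of "Suc k"] by (simp only: up)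
      moreover have "(?F ^^ k) (f x) \<in> A" for k
      proof (cases k)
        case 0
        then show ?thesis
          using Y(1)[of 1] by simp
      next
        case (Suc n)
        then show ?thesis
          using Y(2)[of n] by (simp only: down)
      qed
      ultimately show "f x \<in> Y"
        using MPT_inv_apply(3)[OF f x] by (simp add: Y_def)
    qed
  qed
  ultimately show ?thesis
    by (rule that)
qed

lemma restrict_measure_automorphism:
  assumes f: "f \<in> M \<rightarrow>\<^sub>M M" "distr M M f = M" and f': "f' \<in> M \<rightarrow>\<^sub>M M"
    and inv: "\<And>x. x \<in> space M \<Longrightarrow> f' (f x) = x" "\<And>x. x \<in> space M \<Longrightarrow> f (f' x) = x"
  shows "(\<lambda>x\<in>space M. f x) \<in> measure_automorphisms M"
proof -
  let ?f = "\<lambda>x\<in>space M. f x"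
  have bij: "bij_betw ?f (space M) (space M)"
    using measurable_space[OF f(1)] measurable_space[OF f'] inv
    by (intro bij_betw_byWitness[where f' = f']) auto
  have "inv_into (space M) ?f x = f' x" if "x \<in> space M" for x
    using bij that measurable_space[OF f' that] inv by (intro inv_into_f_eq) (auto simp: bij_betw_def)
  then have "inv_into (space M) ?f \<in> M \<rightarrow>\<^sub>M M"
    using f' by (subst measurable_cong[where g = f']) auto
  moreover have "?f \<in> M \<rightarrow>\<^sub>M M"
    using f(1) by (subst measurable_cong[where g = f]) auto
  moreover have "distr M M ?f = distr M M f"
    by (rule distr_cong) auto
  ultimately show ?thesis
    using bij f(2) by (simp add: measure_automorphisms_def Bij_def measure_preserving_map_distr)
qed

context iso_mod0 begin

text \<open>The map \<open>\<psi> \<circ> f' \<circ> \<phi>\<close> need not be a bijection. It becomes one after restriction to a set \<open>X\<close> of full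
measure that corresponds under \<open>\<phi>\<close> and \<open>\<psi>\<close> to an \<open>f'\<close>-invariant set \<open>Y\<close> on which \<open>\<phi>\<close> and \<open>\<psi>\<close> are
inverse to each other; outside \<open>X\<close> the identity is used.\<close>

lemma lift_automorphism:
  assumes f': "f' \<in> measure_automorphisms N"
  obtains f where "f \<in> measure_automorphisms M" "AE x in M. f x = \<psi> (f' (\<phi> x))"
proof -
  obtain A where A: "A \<in> sets N" "AE y in N. y \<in> A" "\<And>y. y \<in> A \<Longrightarrow> \<phi> (\<psi> y) = y"
    using AE_conull_set[OF AE_\<phi>_\<psi>] by blast
  obtain B where B: "B \<in> sets M" "AE x in M. x \<in> B" "\<And>x. x \<in> B \<Longrightarrow> \<psi> (\<phi> x) = x"
    using AE_conull_set[OF AE_\<psi>_\<phi>] by blast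
  have "A \<inter> (\<psi> -` B \<inter> space N) \<in> sets N"
    using A(1) measurable_sets[OF measurable_\<psi> B(1)] by simp
  moreover have "AE y in N. y \<in> A \<inter> (\<psi> -` B \<inter> space N)"
    using A(2) AE_distr_eqD[OF measurable_\<psi> distr_\<psi> B(2)] AE_space by eventually_elim simp
  ultimately obtain Y where Y: "Y \<in> sets N" "Y \<subseteq> A \<inter> (\<psi> -` B \<inter> space N)" "AE y in N. y \<in> Y"
    and inv: "\<And>y. y \<in> space N \<Longrightarrow> f' y \<in> Y \<longleftrightarrow> y \<in> Y"
    using invariant_conull_subset[OF f'] by metis
  let ?F = "inv\<^bsub>MPT N\<^esub> f'"
  have inv_F: "?F y \<in> Y \<longleftrightarrow> y \<in> Y" if "y \<in> space N" for y
    using inv[of "?F y"] MPT_inv_apply[OF f' that] by simp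
  define X where "X = B \<inter> (\<phi> -` Y \<inter> space M)"
  have X: "X \<in> sets M"
    unfolding X_def using B(1) measurable_sets[OF measurable_\<phi> Y(1)] by simp
  have AE_X: "AE x in M. x \<in> X"
    using B(2) AE_distr_eqD[OF measurable_\<phi> distr_\<phi> Y(3)] AE_space by eventually_elim (simp add: X_def)
  define t where "t u x = (if x \<in> X then \<psi> (u (\<phi> x)) else x)" for u x
  have t_meas: "t u \<in> M \<rightarrow>\<^sub>M M" if "u \<in> N \<rightarrow>\<^sub>M N" for u
    unfolding t_def using X measurable_\<phi> measurable_\<psi> that
    by (intro measurable_If_set) (auto intro: measurable_compose)
  have tX: "t u x \<in> X" "\<phi> (t u x) = u (\<phi> x)"
    if u: "\<And>y. y \<in> space N \<Longrightarrow> u y \<in> Y \<longleftrightarrow> y \<in> Y" and x: "x \<in> X" for u x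
  proof -
    have "\<phi> x \<in> Y" "\<phi> x \<in> space N"
      using x measurable_space[OF measurable_\<phi>] by (auto simp: X_def)
    then have "u (\<phi> x) \<in> Y"
      using u by blast
    then show "\<phi> (t u x) = u (\<phi> x)" "t u x \<in> X"
      using x Y(2) A(3) measurable_space[OF measurable_\<psi>] by (auto simp: t_def X_def subset_iff)
  qed
  have "t ?F (t f' x) = x" "t f' (t ?F x) = x" if "x \<in> space M" for x
  proof -
    have "\<phi> x \<in> space N"
      using measurable_space[OF measurable_\<phi> that] .
    note F = MPT_inv_apply[OF f' this]
    show "t ?F (t f' x) = x" "t f' (t ?F x) = x"
    proof -
      have *: "t u (t v x) = x"
        if "x \<in> X" and v: "\<And>y. y \<in> space N \<Longrightarrow> v y \<in> Y \<longleftrightarrow> y \<in> Y" and uv: "u (v (\<phi> x)) = \<phi> x" for u v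
      proof -
        have "t u (t v x) = \<psi> (u (\<phi> (t v x)))"
          using tX(1)[OF v \<open>x \<in> X\<close>] by (simp add: t_def[of u])
        also have "\<dots> = \<psi> (\<phi> x)"
          by (simp only: tX(2)[OF v \<open>x \<in> X\<close>] uv)
        also have "\<dots> = x"
          using \<open>x \<in> X\<close> by (intro B(3)) (simp add: X_def)
        finally show ?thesis .
      qed
      show "t ?F (t f' x) = x" "t f' (t ?F x) = x"
        using *[where u = ?F and v = f', OF _ inv F(2)] *[where u = f' and v = ?F, OF _ inv_F F(1)]
        by (cases "x \<in> X"; simp add: t_def)+
    qed
  qed
  moreover have t_f': "t f' \<in> M \<rightarrow>\<^sub>M M" "t ?F \<in> M \<rightarrow>\<^sub>M M"
    using measure_automorphismsD(4)[OF f'] measure_automorphismsD(4)[OF MPT_inv_closed[OF f']]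
    by (auto intro: t_meas)
  moreover have AE_t: "AE x in M. t f' x = \<psi> (f' (\<phi> x))"
    using AE_X by eventually_elim (simp add: t_def)
  moreover have "distr M M (t f') = M"
  proof -
    note m = measure_automorphismsD(4)[OF f']
    have "distr M M (t f') = distr M M (\<psi> \<circ> (f' \<circ> \<phi>))"
      using AE_t t_f' measurable_comp[OF measurable_comp[OF measurable_\<phi> m] measurable_\<psi>]
      by (intro distr_cong_AE) (auto simp: o_assoc)
    also have "\<dots> = distr (distr (distr M N \<phi>) N f') M \<psi>"
      using distr_distr[OF measurable_\<psi> measurable_comp[OF measurable_\<phi> m]]
        distr_distr[OF m measurable_\<phi>] by simp
    also have "\<dots> = M"
      by (simp add: distr_\<phi> distr_\<psi> measure_automorphismsD(5)[OF f'])
    finally show ?thesis .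
  qed
  ultimately have "(\<lambda>x\<in>space M. t f' x) \<in> measure_automorphisms M"
    by (intro restrict_measure_automorphism[where f' = "t ?F"])
  moreover have "AE x in M. (\<lambda>x\<in>space M. t f' x) x = \<psi> (f' (\<phi> x))"
    using AE_t AE_space by eventually_elim simp
  ultimately show ?thesis
    by (rule that)
qed

text \<open>Being related is compatible with products and inverses, so that a conjugate by a power in one group
is related to the corresponding conjugate in the other group.\<close>

definition related :: "('a \<Rightarrow> 'a) \<Rightarrow> ('b \<Rightarrow> 'b) \<Rightarrow> bool" where
  "related f f' \<longleftrightarrow> f \<in> measure_automorphisms M \<and> f' \<in> measure_automorphisms N \<and>
     (AE x in M. \<phi> (f x) = f' (\<phi> x))"

lemma ex_related_right:
  assumes f': "f' \<in> measure_automorphisms N"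
  shows "\<exists>f. related f f'"
proof -
  obtain f where f: "f \<in> measure_automorphisms M" "AE x in M. f x = \<psi> (f' (\<phi> x))"
    using lift_automorphism[OF f'] by blast
  have "AE x in M. \<phi> (\<psi> (f' (\<phi> x))) = f' (\<phi> x)"
    using AE_distr_eqD[OF measurable_\<phi> distr_\<phi> AE_measure_preserving[OF measure_automorphismsD(3)[OF f'] AE_\<phi>_\<psi>]] .
  then have "AE x in M. \<phi> (f x) = f' (\<phi> x)"
    using f(2) by eventually_elim simp
  then show ?thesis
    using f f' by (auto simp: related_def)
qed

lemma ex_related_left:
  assumes f: "f \<in> measure_automorphisms M"
  shows "\<exists>f'. related f f'"
proof -
  interpret inverse: iso_mod0 N M \<psi> \<phi>
    by (rule iso_mod0_sym) (rule iso_mod0_axioms)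
  obtain f' where f': "f' \<in> measure_automorphisms N" "AE y in N. f' y = \<phi> (f (\<psi> y))"
    using inverse.lift_automorphism[OF f] by blast
  have "AE x in M. f' (\<phi> x) = \<phi> (f (\<psi> (\<phi> x)))"
    using AE_distr_eqD[OF measurable_\<phi> distr_\<phi> f'(2)] .
  then have "AE x in M. \<phi> (f x) = f' (\<phi> x)"
    using AE_\<psi>_\<phi> by eventually_elim simp
  then show ?thesis
    using f f' by (auto simp: related_def)
qed

lemma related_mult:
  assumes f: "related f f'" and g: "related g g'"
  shows "related (f \<otimes>\<^bsub>MPT M\<^esub> g) (f' \<otimes>\<^bsub>MPT N\<^esub> g')"
proof -
  have m: "f \<in> measure_automorphisms M" "f' \<in> measure_automorphisms N"
    "g \<in> measure_automorphisms M" "g' \<in> measure_automorphisms N"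
    using f g by (auto simp: related_def)
  have "AE x in M. \<phi> (f (g x)) = f' (\<phi> (g x))"
    using f by (intro AE_measure_preserving[OF measure_automorphismsD(3)[OF m(3)]]) (simp add: related_def)
  moreover have "AE x in M. \<phi> (g x) = g' (\<phi> x)"
    using g by (simp add: related_def)
  ultimately have "AE x in M. \<phi> ((f \<otimes>\<^bsub>MPT M\<^esub> g) x) = (f' \<otimes>\<^bsub>MPT N\<^esub> g') (\<phi> x)"
    using AE_space
    by eventually_elim (simp add: mult_MPT m compose_def measurable_space[OF measurable_\<phi>])
  moreover have "f \<otimes>\<^bsub>MPT M\<^esub> g \<in> measure_automorphisms M" "f' \<otimes>\<^bsub>MPT N\<^esub> g' \<in> measure_automorphisms N"
    using m monoid.m_closed[OF group.is_monoid[OF group_MPT]] by (metis carrier_MPT)+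
  ultimately show ?thesis
    by (simp add: related_def)
qed

lemma related_inv:
  assumes f: "related f f'"
  shows "related (inv\<^bsub>MPT M\<^esub> f) (inv\<^bsub>MPT N\<^esub> f')"
proof -
  have m: "f \<in> measure_automorphisms M" "f' \<in> measure_automorphisms N"
    using f by (auto simp: related_def)
  have "AE x in M. \<phi> (f ((inv\<^bsub>MPT M\<^esub> f) x)) = f' (\<phi> ((inv\<^bsub>MPT M\<^esub> f) x))"
    using f by (intro AE_measure_preserving[OF measure_automorphismsD(3)[OF MPT_inv_closed[OF m(1)]]]) (simp add: related_def)
  then have "AE x in M. \<phi> ((inv\<^bsub>MPT M\<^esub> f) x) = (inv\<^bsub>MPT N\<^esub> f') (\<phi> x)"
    using AE_space
  proof eventually_elim
    case (elim x)
    have "\<phi> ((inv\<^bsub>MPT M\<^esub> f) x) \<in> space N"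
      using MPT_inv_apply(4)[OF m(1) elim(2)] measurable_space[OF measurable_\<phi>] by blast
    then show ?case
      using elim MPT_inv_apply(1)[OF m(1) elim(2)] MPT_inv_apply(2)[OF m(2)] by metis
  qed
  then show ?thesis
    using m by (auto simp: related_def intro: MPT_inv_closed)
qed

lemma related_pow:
  assumes f: "related f f'"
  shows "related (f [^]\<^bsub>MPT M\<^esub> (c::nat)) (f' [^]\<^bsub>MPT N\<^esub> c)"
proof (induction c)
  case 0
  have "AE x in M. \<phi> (\<one>\<^bsub>MPT M\<^esub> x) = \<one>\<^bsub>MPT N\<^esub> (\<phi> x)"
    using AE_space by eventually_elim (simp add: measurable_space[OF measurable_\<phi>])
  moreover have "\<one>\<^bsub>MPT M\<^esub> \<in> measure_automorphisms M" "\<one>\<^bsub>MPT N\<^esub> \<in> measure_automorphisms N"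
    using monoid.one_closed[OF group.is_monoid[OF group_MPT]] by (metis carrier_MPT)+
  ultimately show ?case
    by (simp add: related_def del: one_MPT)
next
  case (Suc c)
  then show ?case
    using related_mult[OF Suc f] by simp
qed

text \<open>If \<open>u\<close> is related to \<open>u'\<close>, then for almost every \<open>x\<close> membership of \<open>u x\<close> in \<open>A\<close> is equivalent to
membership of \<open>u' (\<phi> x)\<close> in the preimage of \<open>A\<close> under \<open>\<psi>\<close>. Hence the measures in the definition of
dense conjugates have the same value on both sides.\<close>

lemma transfer_dense_conjugates:
  assumes dense: "dense_conjugates N g' h'"
  shows "\<exists>g h. dense_conjugates M g h"
proof -
  obtain g h where gh: "related g g'" "related h h'"
    using dense ex_related_right unfolding dense_conjugates_def by metis
  have "dense_conjugates M g h"
    unfolding dense_conjugates_def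
  proof (intro conjI allI impI)
    show "g \<in> measure_automorphisms M" "h \<in> measure_automorphisms M"
      using gh by (auto simp: related_def)
    fix f \<A> and \<epsilon> :: real
    assume f: "f \<in> measure_automorphisms M" and \<A>: "finite \<A>" "\<A> \<subseteq> sets M" and \<epsilon>: "\<epsilon> > 0"
    obtain f' where ff': "related f f'"
      using ex_related_left[OF f] by blast
    let ?A' = "\<lambda>A. \<psi> -` A \<inter> space N"
    have "finite (?A' ` \<A>)" "?A' ` \<A> \<subseteq> sets N" "f' \<in> measure_automorphisms N"
      using \<A> ff' measurable_sets[OF measurable_\<psi>] by (auto simp: related_def)
    then have "\<exists>c. \<forall>A'\<in>?A' ` \<A>. measure N (sym_diff
        (power_conjugate (MPT N) g' h' c -` A' \<inter> space N)
        (f' -` A' \<inter> space N)) < \<epsilon>"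
      using dense \<epsilon> unfolding dense_conjugates_def by blast
    then obtain c where c: "\<And>A. A \<in> \<A> \<Longrightarrow> measure N (sym_diff
        (power_conjugate (MPT N) g' h' c -` ?A' A \<inter> space N)
        (f' -` ?A' A \<inter> space N)) < \<epsilon>"
      by blast
    let ?q = "power_conjugate (MPT M) g h c"
    let ?q' = "power_conjugate (MPT N) g' h' c"
    have qq': "related ?q ?q'"
      by (intro related_mult related_inv related_pow gh)
    have AE_vimage: "AE x in M. \<phi> x \<in> u' -` ?A' A \<inter> space N \<longleftrightarrow> x \<in> u -` A \<inter> space M"
      if u: "related u u'" for u u' A
    proof -
      have m: "u \<in> measure_automorphisms M" "u' \<in> measure_automorphisms N"
        and ae: "AE x in M. \<phi> (u x) = u' (\<phi> x)"
        using u by (auto simp: related_def)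
      have "AE x in M. \<psi> (\<phi> (u x)) = u x"
        by (rule AE_measure_preserving[OF measure_automorphismsD(3)[OF m(1)] AE_\<psi>_\<phi>])
      then show ?thesis
        using ae AE_space
      proof eventually_elim
        case (elim x)
        have "\<phi> x \<in> space N" "u' (\<phi> x) \<in> space N"
          using elim(3) measurable_space[OF measurable_\<phi>] MPT_inv_apply(3)[OF m(2)] by auto
        then show ?case
          using elim by auto
      qed
    qed
    have sets_vimage: "u -` A \<inter> space K \<in> sets K" if "u \<in> measure_automorphisms K" "A \<in> sets K"
      for K :: "'c measure" and u A
      using measurable_sets[OF measure_automorphismsD(4)[OF that(1)] that(2)] .
    have "measure M (sym_diff (?q -` A \<inter> space M) (f -` A \<inter> space M)) < \<epsilon>" if A: "A \<in> \<A>" for A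
    proof -
      let ?E' = "sym_diff (?q' -` ?A' A \<inter> space N) (f' -` ?A' A \<inter> space N)"
      have AM: "A \<in> sets M" and AN: "?A' A \<in> sets N"
        using \<A> A measurable_sets[OF measurable_\<psi>] by auto
      have E': "?E' \<in> sets N"
        using measurable_sets[OF measure_automorphismsD(4) AN] qq' ff' unfolding related_def
        by (intro sets.Un sets.Diff) auto
      have "AE x in M. x \<in> sym_diff (?q -` A \<inter> space M) (f -` A \<inter> space M) \<longleftrightarrow> x \<in> \<phi> -` ?E' \<inter> space M"
        using AE_vimage[OF qq', of A] AE_vimage[OF ff', of A] AE_space by eventually_elim auto
      then have "measure M (sym_diff (?q -` A \<inter> space M) (f -` A \<inter> space M)) = measure M (\<phi> -` ?E' \<inter> space M)"
        using measurable_sets[OF measure_automorphismsD(4) AM] qq' ff' measurable_sets[OF measurable_\<phi> E'] unfolding related_def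
        by (intro measure_eq_AE sets.Un sets.Diff) auto
      also have "\<dots> = measure N ?E'"
        using measure_distr[OF measurable_\<phi> E'] by (simp add: distr_\<phi>)
      finally show ?thesis
        using c[OF A] by simp
    qed
    then show "\<exists>c. \<forall>A\<in>\<A>. measure M (sym_diff
        (power_conjugate (MPT M) g h c -` A \<inter> space M)
        (f -` A \<inter> space M)) < \<epsilon>"
      by blast
  qed
  then show ?thesis
    by blast
qed

end

section \<open>Binary and quaternary expansions\<close>

lemma binary_floor_step:
  "\<lfloor>2 ^ Suc n * (u::real)\<rfloor> = 2 * \<lfloor>2 ^ n * u\<rfloor> + of_bool (odd \<lfloor>2 ^ Suc n * u\<rfloor>)"
proof -
  have "\<lfloor>2 ^ n * u\<rfloor> = \<lfloor>2 ^ Suc n * u\<rfloor> div 2"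
    using floor_divide_real_eq_div[of 2 "2 ^ Suc n * u"] by simp
  then show ?thesis
    by (simp add: of_bool_odd_eq_mod_2)
qed

definition binary_digits :: "real \<Rightarrow> nat \<Rightarrow> bool" where
  "binary_digits u i \<longleftrightarrow> odd \<lfloor>2 ^ Suc i * u\<rfloor>"

definition binary_value :: "(nat \<Rightarrow> bool) \<Rightarrow> real" where
  "binary_value b = (\<Sum>i. of_bool (b i) / 2 ^ Suc i)"

lemma binary_value_digits:
  assumes "0 \<le> u" "u < 1"
  shows "binary_value (binary_digits u) = u"
proof -
  have partial: "(\<Sum>i<n. of_bool (binary_digits u i) / 2 ^ Suc i) = real_of_int \<lfloor>2 ^ n * u\<rfloor> / 2 ^ n" for n
  proof (induction n)
    case 0
    have "\<lfloor>u\<rfloor> = 0"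
      using assms by (simp add: floor_eq_iff)
    then show ?case
      by simp
  next
    case (Suc n)
    have "real_of_int \<lfloor>2 ^ Suc n * u\<rfloor> = 2 * real_of_int \<lfloor>2 ^ n * u\<rfloor> + of_bool (binary_digits u n)"
      unfolding binary_digits_def by (subst binary_floor_step) simp
    then show ?case
      using Suc by (simp add: field_simps)
  qed
  have "(\<lambda>n. real_of_int \<lfloor>2 ^ n * u\<rfloor> / 2 ^ n) \<longlonglongrightarrow> u"
  proof (rule real_tendsto_sandwich)
    show "\<forall>\<^sub>F n in sequentially. u - (1/2) ^ n \<le> real_of_int \<lfloor>2 ^ n * u\<rfloor> / 2 ^ n"
    proof (rule always_eventually, rule allI)
      fix n
      have "2 ^ n * u - 1 \<le> real_of_int \<lfloor>2 ^ n * u\<rfloor>"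
        by linarith
      then have "(2 ^ n * u - 1) / 2 ^ n \<le> real_of_int \<lfloor>2 ^ n * u\<rfloor> / 2 ^ n"
        by (rule divide_right_mono) simp
      then show "u - (1/2) ^ n \<le> real_of_int \<lfloor>2 ^ n * u\<rfloor> / 2 ^ n"
        by (simp add: diff_divide_distrib power_one_over)
    qed
    show "\<forall>\<^sub>F n in sequentially. real_of_int \<lfloor>2 ^ n * u\<rfloor> / 2 ^ n \<le> u"
      by (intro always_eventually allI) (simp add: divide_le_eq mult.commute)
    have "(\<lambda>n. u - (1/2::real) ^ n) \<longlonglongrightarrow> u - 0"
      by (intro tendsto_intros LIMSEQ_power_zero) auto
    then show "(\<lambda>n. u - (1/2::real) ^ n) \<longlonglongrightarrow> u"
      by simp
  qed simp
  then have "(\<lambda>i. of_bool (binary_digits u i) / 2 ^ Suc i) sums u"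
    unfolding sums_def partial .
  then show ?thesis
    unfolding binary_value_def by (rule sums_unique[symmetric])
qed

text \<open>Sequences of bits are read as expansions to the base 4. As only the digits 0 and 1 occur, the tail of
an expansion never carries over, and in contrast to base 2 the digits can be recovered from the value.\<close>

definition quaternary_value :: "(nat \<Rightarrow> bool) \<Rightarrow> real" where
  "quaternary_value b = (\<Sum>i. of_bool (b i) / 4 ^ Suc i)"

lemma summable_quaternary: "summable (\<lambda>i. of_bool (b i) / (4::real) ^ Suc i)"
proof (rule summable_comparison_test')
  show "summable (\<lambda>i. (1/4::real) ^ Suc i)"
    by (intro summable_ignore_initial_segment[of _ 1, simplified] summable_geometric) simp
qed (auto simp: power_divide)

lemma quaternary_value_bounds: "0 \<le> quaternary_value b" "quaternary_value b \<le> 1 / 3"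
proof -
  show "0 \<le> quaternary_value b"
    unfolding quaternary_value_def by (intro suminf_nonneg summable_quaternary) auto
  have s: "(\<lambda>i. (1/4::real) * (1/4) ^ i) sums (1/4 * (1 / (1 - 1/4)))"
    by (intro sums_mult geometric_sums) simp
  have "quaternary_value b \<le> (\<Sum>i. (1/4::real) * (1/4) ^ i)"
    unfolding quaternary_value_def using s
    by (intro suminf_le summable_quaternary) (auto simp: sums_iff power_divide)
  also have "\<dots> = 1 / 3"
    using s by (simp add: sums_iff)
  finally show "quaternary_value b \<le> 1 / 3" .
qed

lemma quaternary_value_split: "4 * quaternary_value b = of_bool (b 0) + quaternary_value (\<lambda>i. b (Suc i))"
proof -
  have "quaternary_value b = of_bool (b 0) / 4 + (\<Sum>i. of_bool (b (Suc i)) / 4 ^ Suc (Suc i))"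
    unfolding quaternary_value_def using suminf_split_head[OF summable_quaternary[of b]] by simp
  also have "(\<Sum>i. of_bool (b (Suc i)) / 4 ^ Suc (Suc i)) = (\<Sum>i. of_bool (b (Suc i)) / 4 ^ Suc i / (4::real))"
    by simp
  also have "\<dots> = quaternary_value (\<lambda>i. b (Suc i)) / 4"
    unfolding quaternary_value_def by (rule suminf_divide) (rule summable_quaternary)
  finally show ?thesis
    by simp
qed

definition quaternary_digits :: "real \<Rightarrow> nat \<Rightarrow> bool" where
  "quaternary_digits u i \<longleftrightarrow> odd \<lfloor>4 ^ Suc i * u\<rfloor>"

lemma quaternary_digits_value: "quaternary_digits (quaternary_value b) = b"
proof
  fix i
  show "quaternary_digits (quaternary_value b) i = b i"
  proof (induction i arbitrary: b)
    case 0
    have "\<lfloor>4 * quaternary_value b\<rfloor> = of_bool (b 0)"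
      unfolding quaternary_value_split floor_eq_iff using quaternary_value_bounds[of "\<lambda>i. b (Suc i)"] by auto
    then show ?case
      by (simp add: quaternary_digits_def)
  next
    case (Suc i)
    have "4 ^ Suc (Suc i) * quaternary_value b = 4 ^ Suc i * (4 * quaternary_value b)"
      by simp
    also have "\<dots> = real_of_int (4 ^ Suc i * of_bool (b 0)) + 4 ^ Suc i * quaternary_value (\<lambda>i. b (Suc i))"
      unfolding quaternary_value_split by (simp add: distrib_left)
    finally have "\<lfloor>4 ^ Suc (Suc i) * quaternary_value b\<rfloor> =
        4 ^ Suc i * of_bool (b 0) + \<lfloor>4 ^ Suc i * quaternary_value (\<lambda>i. b (Suc i))\<rfloor>"
      by (simp only: int_add_floor)
    then show ?case
      using Suc[of "\<lambda>i. b (Suc i)"] by (simp add: quaternary_digits_def)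
  qed
qed

lemma measurable_digit: "Measurable.pred borel (\<lambda>u::real. odd \<lfloor>c * u\<rfloor>)"
  by measurable

lemma measurable_quaternary_value: "quaternary_value \<in> borel_measurable cantor_measure"
  unfolding quaternary_value_def by measurable

lemma measurable_binary_value: "binary_value \<in> borel_measurable cantor_measure"
  unfolding binary_value_def by measurable

lemma measurable_quaternary_digits: "quaternary_digits \<in> borel \<rightarrow>\<^sub>M cantor_measure"
  by (rule measurable_into_cantorI) (simp add: quaternary_digits_def measurable_digit)

lemma measurable_binary_digits: "binary_digits \<in> borel \<rightarrow>\<^sub>M cantor_measure"
  by (rule measurable_into_cantorI) (simp add: binary_digits_def measurable_digit)

section \<open>The Cantor measure, the unit interval and distributions on the real line\<close>

abbreviation unit_interval :: "real measure" where
  "unit_interval \<equiv> restrict_space lborel {0<..<1}"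

lemma sets_cantor_cylinder: "{x. \<forall>i<n. x i = l i} \<in> sets cantor_measure"
proof -
  have "{x \<in> space cantor_measure. \<forall>i\<in>{..<n}. x i = l i} \<in> sets cantor_measure"
    by measurable
  then show ?thesis
    by (simp add: Ball_def)
qed

lemma emeasure_cantor_cylinder: "emeasure cantor_measure {x. \<forall>i<n. x i = l i} = ennreal ((1/2) ^ n)"
proof -
  let ?coin = "uniform_count_measure (UNIV :: bool set)"
  have "{x. \<forall>i<n. x i = l i} = prod_emb UNIV (\<lambda>_::nat. ?coin) {..<n} (PiE {..<n} (\<lambda>i. {l i}))"
  proof (rule Set.set_eqI)
    fix x
    have "x \<in> prod_emb UNIV (\<lambda>_::nat. ?coin) {..<n} (PiE {..<n} (\<lambda>i. {l i})) \<longleftrightarrow>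
        restrict x {..<n} \<in> PiE {..<n} (\<lambda>i. {l i})"
      unfolding prod_emb_def space_uniform_count_measure PiE_UNIV_domain by simp
    then show "x \<in> {x. \<forall>i<n. x i = l i} \<longleftrightarrow> x \<in> prod_emb UNIV (\<lambda>_::nat. ?coin) {..<n} (PiE {..<n} (\<lambda>i. {l i}))"
      unfolding restrict_PiE_iff by auto
  qed
  moreover have "emeasure (PiM UNIV (\<lambda>_::nat. ?coin)) (prod_emb UNIV (\<lambda>_::nat. ?coin) {..<n} (PiE {..<n} (\<lambda>i. {l i}))) =
      (\<Prod>i\<in>{..<n}. emeasure ?coin {l i})"
    by (rule emeasure_PiM_emb) (simp_all add: prob_space_fair_coin sets_uniform_count_measure)
  ultimately have "emeasure cantor_measure {x. \<forall>i<n. x i = l i} = (\<Prod>i\<in>{..<n}. emeasure ?coin {l i})"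
    by (simp only: cantor_measure_def)
  also have "\<dots> = (\<Prod>i\<in>{..<n}. ennreal (1/2))"
    by (intro prod.cong refl) (simp add: emeasure_uniform_count_measure)
  also have "\<dots> = ennreal ((1/2) ^ n)"
    unfolding prod_constant card_lessThan by (rule ennreal_power) simp
  finally show ?thesis .
qed

text \<open>Two cylinders are nested or disjoint, so that the cylinders together with the empty set form a
generator that is closed under intersections.\<close>

lemma cantor_measure_eqI:
  assumes N: "sets N = sets cantor_measure"
    and eq: "\<And>n l. emeasure N {x. \<forall>i<n. x i = l i} = ennreal ((1/2) ^ n)"
  shows "N = cantor_measure"
proof -
  let ?C = "\<lambda>(n, l :: nat \<Rightarrow> bool). {x. \<forall>i<n. x i = l i}"
  let ?E = "insert {} (range ?C)"
  have sets: "sets cantor_measure = sigma_sets UNIV ?E"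
  proof
    have "cylinder_union L \<in> sigma_sets UNIV ?E" for L
    proof -
      have "{x. \<forall>i<length l. x i = l ! i} \<in> sigma_sets UNIV ?E" for l
      proof -
        have "?C (length l, (!) l) \<in> ?E"
          by blast
        then show ?thesis
          by (intro sigma_sets.Basic) simp
      qed
      then have "(\<Union>l\<in>set L. {x. \<forall>i<length l. x i = l ! i}) \<in> sigma_sets UNIV ?E"
        by (intro sigma_sets_UNION countable_finite finite_imageI) auto
      moreover have "cylinder_union L = (\<Union>l\<in>set L. {x. \<forall>i<length l. x i = l ! i})"
        by (auto simp: cylinder_union_def)
      ultimately show ?thesis
        by simp
    qed
    then have "sigma_sets UNIV (range cylinder_union) \<subseteq> sigma_sets UNIV ?E"
      by (intro sigma_sets_mono) auto
    then show "sets cantor_measure \<subseteq> sigma_sets UNIV ?E"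
      using sets_cantor_measure_subset by blast
    have "?E \<subseteq> sets cantor_measure"
      by (auto intro: sets_cantor_cylinder)
    then show "sigma_sets UNIV ?E \<subseteq> sets cantor_measure"
      using sets.sigma_sets_subset[of ?E cantor_measure] by simp
  qed
  show ?thesis
  proof (rule measure_eqI_generator_eq[where E = ?E and \<Omega> = UNIV and A = "\<lambda>_. UNIV"])
    show "Int_stable ?E"
    proof (rule Int_stableI)
      fix a b assume ab: "a \<in> ?E" "b \<in> ?E"
      have *: "?C (n, l) \<inter> ?C (m, k) \<in> ?E" if "n \<le> m" for n m l k
      proof (cases "\<forall>i<n. l i = k i")
        case True
        then have "?C (n, l) \<inter> ?C (m, k) = ?C (m, k)"
          using that by auto
        then show ?thesis
          by blast
      next
        case False
        then have "?C (n, l) \<inter> ?C (m, k) = {}"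
          using that by fastforce
        then show ?thesis
          by simp
      qed
      have **: "?C (n, l) \<inter> ?C (m, k) \<in> ?E" for n m l k
      proof (cases "n \<le> m")
        case True
        then show ?thesis
          by (rule *)
      next
        case False
        then have "?C (m, k) \<inter> ?C (n, l) \<in> ?E"
          by (intro *) simp
        then show ?thesis
          by (simp only: Int_commute)
      qed
      show "a \<inter> b \<in> ?E"
      proof (cases "a = {} \<or> b = {}")
        case False
        then have "a \<in> range ?C" "b \<in> range ?C"
          using ab by simp_all
        then obtain p q where pq: "a = ?C p" "b = ?C q"
          by (elim rangeE)
        obtain n l m k where "p = (n, l)" "q = (m, k)"
          by (cases p, cases q)
        then show ?thesis
          using ** pq by (simp only:)
      qed auto
    qed
    show "emeasure N X = emeasure cantor_measure X" if "X \<in> ?E" for X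
      using that by (auto simp: eq emeasure_cantor_cylinder)
    show "range (\<lambda>_. UNIV) \<subseteq> ?E"
      by (auto intro!: image_eqI[of _ _ "(0, \<lambda>_. True)"])
    show "emeasure N UNIV \<noteq> \<infinity>"
      using eq[of 0] by simp
  qed (use N sets in auto)
qed

text \<open>Fixing the first \<open>n\<close> binary digits of \<open>u\<close> amounts to fixing the integer part of \<open>2\<^sup>n u\<close>.\<close>

lemma binary_cylinder_interval:
  "\<exists>k::int. 0 \<le> k \<and> (\<forall>u\<in>{0<..<1::real}. (\<forall>i<n. binary_digits u i = l i) \<longleftrightarrow> \<lfloor>2 ^ n * u\<rfloor> = k)"
proof (induction n)
  case 0
  then show ?case
    by (intro exI[of _ 0]) (auto simp: floor_eq_iff)
next
  case (Suc n)
  then obtain k where k: "0 \<le> k" "\<And>u. u \<in> {0<..<1} \<Longrightarrow> (\<forall>i<n. binary_digits u i = l i) \<longleftrightarrow> \<lfloor>2 ^ n * u\<rfloor> = k"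
    by blast
  have *: "F = k \<and> odd K = b \<longleftrightarrow> K = 2 * k + of_bool b" if "K = 2 * F + of_bool (odd K)" for F K :: int and b
    using that by (cases b; cases "odd K"; simp; presburger)
  have "(\<forall>i<Suc n. binary_digits u i = l i) \<longleftrightarrow> \<lfloor>2 ^ Suc n * u\<rfloor> = 2 * k + of_bool (l n)" if u: "u \<in> {0<..<1}" for u
  proof -
    have "(\<forall>i<Suc n. binary_digits u i = l i) \<longleftrightarrow> \<lfloor>2 ^ n * u\<rfloor> = k \<and> binary_digits u n = l n"
      using k(2)[OF u] by (auto simp: less_Suc_eq)
    also have "\<dots> \<longleftrightarrow> \<lfloor>2 ^ Suc n * u\<rfloor> = 2 * k + of_bool (l n)"
      unfolding binary_digits_def by (rule *) (rule binary_floor_step)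
    finally show ?thesis .
  qed
  then show ?case
    using k(1) by (intro exI[of _ "2 * k + of_bool (l n)"]) auto
qed

lemma emeasure_floor_interval:
  assumes "0 \<le> k" and ne: "\<exists>u\<in>{0<..<1::real}. \<lfloor>2 ^ n * u\<rfloor> = k"
  shows "emeasure lborel {u \<in> {0<..<1::real}. \<lfloor>2 ^ n * u\<rfloor> = k} = ennreal ((1/2) ^ n)"
proof -
  define a b :: real where "a = real_of_int k / 2 ^ n" and "b = (real_of_int k + 1) / 2 ^ n"
  obtain v :: real where v: "0 < v" "v < 1" "\<lfloor>2 ^ n * v\<rfloor> = k"
    using ne by auto
  have "k < 2 ^ n"
  proof -
    have "2 ^ n * v < 2 ^ n * 1"
      using v by (intro mult_strict_left_mono) auto
    then have "real_of_int k < 2 ^ n"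
      using v(3) of_int_floor_le[of "2 ^ n * v"] by linarith
    then show ?thesis
      by (metis of_int_less_iff of_int_numeral of_int_power)
  qed
  then have "k + 1 \<le> 2 ^ n"
    by simp
  then have "real_of_int (k + 1) \<le> real_of_int (2 ^ n)"
    by (simp only: of_int_le_iff)
  then have b: "b \<le> 1"
    by (simp add: b_def)
  have a: "0 \<le> a"
    using assms by (simp add: a_def)
  have iff: "\<lfloor>2 ^ n * u\<rfloor> = k \<longleftrightarrow> a \<le> u \<and> u < b" for u
    by (simp add: floor_eq_iff field_simps a_def b_def)
  have "emeasure lborel {u \<in> {0<..<1::real}. \<lfloor>2 ^ n * u\<rfloor> = k} = emeasure lborel {a..<b}"
  proof (rule emeasure_eq_AE)
    \<comment> \<open>The two sets differ at most in the point 0.\<close>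
    show "AE u in lborel. u \<in> {u \<in> {0<..<1::real}. \<lfloor>2 ^ n * u\<rfloor> = k} \<longleftrightarrow> u \<in> {a..<b}"
      using AE_lborel_singleton[of "0::real"]
    proof eventually_elim
      case (elim u)
      then show ?case
        unfolding mem_Collect_eq iff using a b by auto
    qed
    have "{u \<in> {0<..<1::real}. \<lfloor>2 ^ n * u\<rfloor> = k} = {0<..<1} \<inter> {a..<b}"
      by (auto simp: iff)
    then show "{u \<in> {0<..<1::real}. \<lfloor>2 ^ n * u\<rfloor> = k} \<in> sets lborel"
      by simp
  qed simp
  also have "\<dots> = ennreal (b - a)"
    by (simp add: a_def b_def divide_right_mono)
  also have "b - a = (1/2) ^ n"
    by (simp add: a_def b_def power_one_over add_divide_distrib)
  finally show ?thesis .
qed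

text \<open>Every finite word of digits occurs inside the open unit interval: start from the middle and prepend the
digits one by one. So every cylinder corresponds to a dyadic interval that is not empty.\<close>

lemma ex_real_with_binary_digits: "\<exists>u\<in>{0<..<1::real}. \<forall>i<n. binary_digits u i = l i"
proof (induction n arbitrary: l)
  case 0
  then show ?case
    by (intro bexI[of _ "1/2"]) auto
next
  case (Suc n)
  obtain u where u: "u \<in> {0<..<1}" "\<forall>i<n. binary_digits u i = l (Suc i)"
    using Suc[of "\<lambda>i. l (Suc i)"] by blast
  let ?v = "(of_bool (l 0) + u) / 2"
  have "binary_digits ?v i = l i" if "i < Suc n" for i
  proof (cases i)
    case 0
    have "\<lfloor>of_bool (l 0) + u\<rfloor> = of_bool (l 0)"
      using u by (auto simp: floor_eq_iff)
    moreover have "2 ^ Suc 0 * ?v = of_bool (l 0) + u"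
      by simp
    ultimately show ?thesis
      unfolding 0 binary_digits_def by (simp only:) simp
  next
    case (Suc m)
    have "2 ^ Suc i * ?v = real_of_int (2 ^ Suc m * of_bool (l 0)) + 2 ^ Suc m * u"
      unfolding Suc by (simp add: distrib_left)
    then have "\<lfloor>2 ^ Suc i * ?v\<rfloor> = 2 ^ Suc m * of_bool (l 0) + \<lfloor>2 ^ Suc m * u\<rfloor>"
      by (simp only: int_add_floor)
    then show ?thesis
      using u(2) Suc that by (simp add: binary_digits_def)
  qed
  then show ?case
    using u(1) by (intro bexI[of _ ?v]) auto
qed

lemma distr_binary_digits: "distr unit_interval cantor_measure binary_digits = cantor_measure"
proof (rule cantor_measure_eqI)
  fix n l
  have digits: "binary_digits \<in> unit_interval \<rightarrow>\<^sub>M cantor_measure"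
    using measurable_binary_digits by (intro measurable_restrict_space1) simp
  obtain k where k: "0 \<le> k" "\<And>u. u \<in> {0<..<1} \<Longrightarrow> (\<forall>i<n. binary_digits u i = l i) \<longleftrightarrow> \<lfloor>2 ^ n * u\<rfloor> = k"
    using binary_cylinder_interval[of n l] by blast
  have ne: "\<exists>u\<in>{0<..<1::real}. \<lfloor>2 ^ n * u\<rfloor> = k"
    using ex_real_with_binary_digits[of n l] k(2) by blast
  have eq: "binary_digits -` {x. \<forall>i<n. x i = l i} \<inter> space unit_interval = {u \<in> {0<..<1}. \<lfloor>2 ^ n * u\<rfloor> = k}"
    using k(2) by (auto simp: space_restrict_space)
  have "emeasure (distr unit_interval cantor_measure binary_digits) {x. \<forall>i<n. x i = l i} =
      emeasure unit_interval {u \<in> {0<..<1}. \<lfloor>2 ^ n * u\<rfloor> = k}"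
    unfolding eq[symmetric] by (rule emeasure_distr[OF digits sets_cantor_cylinder])
  also have "\<dots> = emeasure lborel {u \<in> {0<..<1::real}. \<lfloor>2 ^ n * u\<rfloor> = k}"
    by (rule emeasure_restrict_space) auto
  also have "\<dots> = ennreal ((1/2) ^ n)"
    by (rule emeasure_floor_interval[OF k(1) ne])
  finally show "emeasure (distr unit_interval cantor_measure binary_digits) {x. \<forall>i<n. x i = l i} = ennreal ((1/2) ^ n)" .
qed simp

text \<open>Retracts the real line onto the open unit interval. The value for points outside is arbitrary; it
only matters that it lies inside the interval.\<close>

definition clamp :: "real \<Rightarrow> real" where
  "clamp t = (if 0 < t \<and> t < 1 then t else 1/2)"

lemma measurable_clamp:
  assumes "f \<in> borel_measurable N"
  shows "(\<lambda>x. clamp (f x)) \<in> N \<rightarrow>\<^sub>M unit_interval"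
proof (rule measurable_restrict_space2)
  show "(\<lambda>x. clamp (f x)) \<in> N \<rightarrow>\<^sub>M lborel"
    unfolding clamp_def using assms by simp
qed (auto simp: clamp_def)

lemma iso_unit_interval_cantor:
  "iso_mod0 unit_interval cantor_measure binary_digits (\<lambda>b. clamp (binary_value b))"
proof (rule iso_mod0I)
  show "binary_digits \<in> unit_interval \<rightarrow>\<^sub>M cantor_measure"
    using measurable_binary_digits by (intro measurable_restrict_space1) simp
  show "distr unit_interval cantor_measure binary_digits = cantor_measure"
    by (rule distr_binary_digits)
  show v: "(\<lambda>b. clamp (binary_value b)) \<in> cantor_measure \<rightarrow>\<^sub>M unit_interval"
    by (rule measurable_clamp) (rule measurable_binary_value)
  show "AE x in unit_interval. clamp (binary_value (binary_digits x)) = x"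
    by (rule AE_I2) (auto simp: binary_value_digits clamp_def space_restrict_space)
  have "(\<lambda>b. clamp (binary_value b)) \<in> borel_measurable cantor_measure"
    unfolding clamp_def using measurable_binary_value by simp
  from measurable_compose[OF this measurable_binary_digits]
  have [measurable]: "(\<lambda>b. binary_digits (clamp (binary_value b)) i) \<in> cantor_measure \<rightarrow>\<^sub>M count_space UNIV" for i
    by (rule measurable_compose) (rule measurable_cantor_coordinate)
  have "{y \<in> space cantor_measure. \<forall>i. binary_digits (clamp (binary_value y)) i = y i} \<in> sets cantor_measure"
    by measurable
  then show "{y \<in> space cantor_measure. binary_digits (clamp (binary_value y)) = y} \<in> sets cantor_measure"
    by (simp add: fun_eq_iff)
qed

text \<open>The quantile function pushes Lebesgue measure on the unit interval forward to \<open>\<nu>\<close>. As \<open>\<nu>\<close> has no atoms,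
its distribution function is continuous and therefore a left inverse of the quantile function.\<close>

lemma iso_unit_interval_real:
  assumes \<nu>: "real_distribution \<nu>" and no_atoms: "\<And>t. measure \<nu> {t} = 0"
  shows "\<exists>q f. iso_mod0 unit_interval \<nu> q f"
proof -
  interpret cdf_distribution \<nu>
    unfolding cdf_distribution_def by (rule \<nu>)
  have sets: "sets \<nu> = sets borel"
    by simp
  have q_meas: "I \<in> unit_interval \<rightarrow>\<^sub>M \<nu>"
    using measurable_CI by (simp add: measurable_cong_sets[OF _ sets] measurable_cong_sets[OF sets_restrict_space_cong[OF sets_lborel] refl])
  have q_borel: "I \<in> unit_interval \<rightarrow>\<^sub>M borel"
    using q_meas measurable_cong_sets[OF refl sets] by blast
  have f_meas: "(\<lambda>x. clamp (C x)) \<in> \<nu> \<rightarrow>\<^sub>M unit_interval"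
    by (rule measurable_clamp) (simp add: measurable_cong_sets[OF sets refl])
  have left: "C (I u) = u" if u: "u \<in> {0<..<1}" for u
  proof (rule antisym)
    show "u \<le> C (I u)"
      using pseudoinverse[of u "I u"] u by simp
    have "isCont C (I u)"
      using no_atoms by (simp add: isCont_cdf)
    then have "(C \<longlongrightarrow> C (I u)) (at_left (I u))"
      by (auto simp: isCont_def intro: filterlim_at_split[THEN iffD1, THEN conjunct1])
    moreover have "\<forall>\<^sub>F x in at_left (I u). C x \<le> u"
    proof (rule eventually_at_leftI[of "I u - 1"])
      fix x assume "x \<in> {I u - 1<..<I u}"
      then have "\<not> u \<le> C x"
        using pseudoinverse[of u x] u by simp
      then show "C x \<le> u"
        by simp
    qed simp
    ultimately show "C (I u) \<le> u"
      by (intro tendsto_upperbound) auto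
  qed
  have "iso_mod0 unit_interval \<nu> I (\<lambda>x. clamp (C x))"
  proof (rule iso_mod0I[OF q_meas _ f_meas])
    have "distr unit_interval \<nu> I = distr unit_interval borel I"
      by (rule distr_cong) (simp_all add: sets)
    then show "distr unit_interval \<nu> I = \<nu>"
      using distr_I_eq_M by simp
    show "AE u in unit_interval. clamp (C (I u)) = u"
      by (rule AE_I2) (auto simp: left clamp_def space_restrict_space)
    have "(\<lambda>x. I (clamp (C x))) \<in> borel_measurable \<nu>"
      using measurable_compose[OF f_meas q_borel] .
    moreover have "(\<lambda>x. x) \<in> borel_measurable \<nu>"
      by (simp add: measurable_cong_sets[OF sets refl])
    ultimately show "{y \<in> space \<nu>. I (clamp (C y)) = y} \<in> sets \<nu>"
      by (rule borel_measurable_eq)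
  qed
  then show ?thesis
    by blast
qed

section \<open>Standard Borel spaces\<close>

lemma (in Metric_space) closedin_approximable:
  assumes C: "closedin mtopology C" and x: "x \<in> M"
    and approx: "\<And>k. \<exists>c\<in>C. d c x \<le> 3 * (1/2) ^ k"
  shows "x \<in> C"
proof (rule ccontr)
  assume "x \<notin> C"
  then have "openin mtopology (M - C)" "x \<in> M - C"
    using C x by (auto simp: closedin_def)
  then obtain r where r: "r > 0" "mball x r \<subseteq> M - C"
    unfolding openin_mtopology by blast
  obtain k where "(1/2::real) ^ k < r / 3"
    using real_arch_pow_inv[of "r / 3" "1/2"] r by auto
  moreover obtain c where c: "c \<in> C" "d c x \<le> 3 * (1/2) ^ k"
    using approx by blast
  moreover have "c \<in> M"
    using c(1) C by (auto simp: closedin_def)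
  ultimately have "c \<in> mball x r"
    using x by (simp add: commute)
  then show False
    using r(2) c(1) by blast
qed

text \<open>Let \<open>a\<close> enumerate a dense sequence. The bits of \<open>e x\<close> record which \<open>a n\<close> have distance less than \<open>2\<^sup>-\<^sup>k\<close>
from \<open>x\<close>. From such bits the point is recovered as the limit of the points \<open>a (y b k)\<close>, where \<open>y b k\<close> is
the first index allowed at precision \<open>2\<^sup>-\<^sup>k\<close>. This decoding \<open>r\<close> is measurable: by completeness the limit exists precisely if the points \<open>a (y b k)\<close> satisfy
countably many inequalities, and whether it belongs to a closed set can be read off from the
distances of the points \<open>a (y b k)\<close> to the set.\<close>

lemma standard_Borel_embedding:
  assumes M: "standard_Borel M" and ne: "space M \<noteq> {}"
  obtains e r where "e \<in> M \<rightarrow>\<^sub>M cantor_measure" "r \<in> cantor_measure \<rightarrow>\<^sub>M M" "\<And>x. x \<in> space M \<Longrightarrow> r (e x) = x"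
proof -
  obtain T where T: "completely_metrizable_space T" "separable_space T" "topspace T = space M"
    and sets: "sets M = sigma_sets (space M) {U. openin T U}"
    using M unfolding standard_Borel_def Polish_topology_def by blast
  obtain X d where "Metric_space X d" and complete: "Metric_space.mcomplete X d"
    and TX: "T = Metric_space.mtopology X d"
    using T(1) unfolding completely_metrizable_space_def by blast
  interpret Metric_space X d by fact
  have X: "X = space M"
    using T(3) by (simp add: TX)
  obtain S where S: "countable S" "S \<subseteq> X" "mtopology closure_of S = X"
    using T(2) unfolding separable_space_def by (auto simp: TX)
  have "S \<noteq> {}"
    using S(3) ne by (auto simp: X)
  define a where "a = from_nat_into S"
  have range_a: "range a = S"
    unfolding a_def by (rule range_from_nat_into[OF \<open>S \<noteq> {}\<close> S(1)])
  have aX: "a n \<in> X" for n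
    using range_a S(2) by blast
  have dense: "\<exists>n. d x (a n) < r" if x: "x \<in> X" and r: "r > 0" for x r
  proof -
    have "\<exists>y\<in>S. y \<in> mball x r"
      using S(3) x r unfolding metric_closure_of by blast
    then show ?thesis
      using range_a by auto
  qed
  obtain x0 where x0: "x0 \<in> X"
    using ne X by blast
  define e where "e x m = (d x (a (fst (prod_decode m))) < (1/2) ^ snd (prod_decode m))" for x m
  define y where "y b k = (LEAST n. b (prod_encode (n, k)))" for b :: "nat \<Rightarrow> bool" and k
  define is_limit where "is_limit b x \<longleftrightarrow> x \<in> X \<and> (\<forall>k. d x (a (y b k)) \<le> (1/2) ^ k)" for b x
  define r where "r b = (if \<exists>x. is_limit b x then SOME x. is_limit b x else x0)" for b
  have limit_r: "is_limit b (r b)" if "is_limit b x" for b x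
    unfolding r_def using someI[of "is_limit b", OF that] that by auto
  have rX: "r b \<in> X" for b
    using limit_r x0 unfolding r_def is_limit_def by (metis (no_types, lifting))
  have limit_unique: "x = x'" if "is_limit b x" "is_limit b x'" for b x x'
  proof (rule ccontr)
    assume "x \<noteq> x'"
    have xX: "x \<in> X" "x' \<in> X"
      using that by (auto simp: is_limit_def)
    then have "d x x' > 0"
      using \<open>x \<noteq> x'\<close> by simp
    then obtain k where k: "(1/2::real) ^ k < d x x' / 2"
      using real_arch_pow_inv[of "d x x' / 2" "1/2"] by auto
    have "d x x' \<le> d x (a (y b k)) + d (a (y b k)) x'"
      by (intro triangle xX aX)
    also have "\<dots> \<le> (1/2) ^ k + (1/2) ^ k"
      using that by (intro add_mono) (auto simp: is_limit_def commute)
    finally show False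
      using k by simp
  qed
  have is_limit_e: "is_limit (e x) x" if x: "x \<in> X" for x
  proof -
    have "d x (a (y (e x) k)) < (1/2) ^ k" for k
    proof -
      obtain n where "d x (a n) < (1/2) ^ k"
        using dense[OF x, of "(1/2) ^ k"] by auto
      then have "e x (prod_encode (n, k))"
        by (simp add: e_def)
      then have "e x (prod_encode (y (e x) k, k))"
        unfolding y_def by (rule LeastI)
      then show ?thesis
        by (simp add: e_def)
    qed
    then show ?thesis
      using x by (auto simp: is_limit_def intro: less_imp_le)
  qed
  have r_e: "r (e x) = x" if "x \<in> space M" for x
    using limit_unique limit_r is_limit_e that X by blast
  have openM: "U \<in> sets M" if "openin T U" for U
    unfolding sets using that by (intro sigma_sets.Basic) simp
  have "e \<in> M \<rightarrow>\<^sub>M cantor_measure"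
  proof (rule measurable_into_cantorI)
    fix m
    have "{x \<in> space M. e x m} = mball (a (fst (prod_decode m))) ((1/2) ^ snd (prod_decode m))"
      using aX by (auto simp: e_def X[symmetric] commute)
    moreover have "openin T (mball (a (fst (prod_decode m))) ((1/2) ^ snd (prod_decode m)))"
      unfolding TX by (rule openin_mball)
    ultimately have "{x \<in> space M. e x m} \<in> sets M"
      using openM by simp
    then have "Measurable.pred M (\<lambda>x. e x m)"
      by (simp add: pred_def)
    then show "(\<lambda>x. e x m) \<in> M \<rightarrow>\<^sub>M count_space UNIV" .
  qed
  moreover have "r \<in> cantor_measure \<rightarrow>\<^sub>M M"
  proof (rule measurable_sigma_sets[OF sets])
    show "{U. openin T U} \<subseteq> Pow (space M)"
      using openin_subset[of T] T(3) by auto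
    show "r \<in> space cantor_measure \<rightarrow> space M"
      using rX X by simp
    have y_meas [measurable]: "(\<lambda>b. y b k) \<in> cantor_measure \<rightarrow>\<^sub>M count_space UNIV" for k
      unfolding y_def by measurable
    have good_iff: "(\<exists>x. is_limit b x) \<longleftrightarrow> (\<forall>k l. d (a (y b k)) (a (y b l)) \<le> (1/2) ^ k + (1/2) ^ l)" for b
    proof
      assume "\<exists>x. is_limit b x"
      then obtain x where x: "x \<in> X" "\<And>k. d x (a (y b k)) \<le> (1/2) ^ k"
        by (auto simp: is_limit_def)
      show "\<forall>k l. d (a (y b k)) (a (y b l)) \<le> (1/2) ^ k + (1/2) ^ l"
      proof (intro allI)
        fix k l
        have "d (a (y b k)) (a (y b l)) \<le> d (a (y b k)) x + d x (a (y b l))"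
          by (intro triangle x aX)
        also have "\<dots> \<le> (1/2) ^ k + (1/2) ^ l"
          using x(2)[of k] x(2)[of l] by (intro add_mono) (simp_all add: commute)
        finally show "d (a (y b k)) (a (y b l)) \<le> (1/2) ^ k + (1/2) ^ l" .
      qed
    next
      assume good: "\<forall>k l. d (a (y b k)) (a (y b l)) \<le> (1/2) ^ k + (1/2) ^ l"
      have small: "\<exists>N. \<forall>n\<ge>N. (1/2::real) ^ n < \<epsilon>" if pos: "\<epsilon> > 0" for \<epsilon>
      proof -
        obtain N where "(1/2::real) ^ N < \<epsilon>"
          using real_arch_pow_inv[OF pos, of "1/2"] by auto
        moreover have "(1/2::real) ^ n \<le> (1/2) ^ N" if "N \<le> n" for n
          using that by (rule power_decreasing) auto
        ultimately show ?thesis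
          by (meson le_less_trans)
      qed
      have "MCauchy (\<lambda>k. a (y b k))"
        unfolding MCauchy_def
      proof (intro conjI allI impI)
        fix \<epsilon> :: real assume "\<epsilon> > 0"
        then obtain N where N: "\<And>n. n \<ge> N \<Longrightarrow> (1/2::real) ^ n < \<epsilon> / 2"
          using small[of "\<epsilon> / 2"] by auto
        have "d (a (y b n)) (a (y b n')) < \<epsilon>" if "N \<le> n" "N \<le> n'" for n n'
          using good[rule_format, of n n'] N[OF that(1)] N[OF that(2)] by linarith
        then show "\<exists>N. \<forall>n n'. N \<le> n \<longrightarrow> N \<le> n' \<longrightarrow> d (a (y b n)) (a (y b n')) < \<epsilon>"
          by blast
      qed (use aX in auto)
      then obtain x where x: "limitin mtopology (\<lambda>k. a (y b k)) x sequentially"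
        using complete unfolding mcomplete_def by blast
      have xX: "x \<in> X"
        using x by (simp add: limitin_metric)
      have "d x (a (y b k)) \<le> (1/2) ^ k" for k
      proof (rule field_le_epsilon)
        fix \<epsilon> :: real assume \<epsilon>: "\<epsilon> > 0"
        obtain N where N: "\<And>n. n \<ge> N \<Longrightarrow> (1/2::real) ^ n < \<epsilon> / 2"
          using small[of "\<epsilon> / 2"] \<epsilon> by auto
        have "\<forall>\<^sub>F n in sequentially. d (a (y b n)) x < \<epsilon> / 2"
          using x half_gt_zero[OF \<epsilon>] unfolding limitin_metric by (blast intro: eventually_mono)
        then obtain n where n: "n \<ge> N" "d (a (y b n)) x < \<epsilon> / 2"
          unfolding eventually_sequentially using nle_le by blast
        have "d x (a (y b k)) \<le> d x (a (y b n)) + d (a (y b n)) (a (y b k))"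
          by (intro triangle xX aX)
        also have "\<dots> \<le> \<epsilon> / 2 + ((1/2) ^ n + (1/2) ^ k)"
          using less_imp_le[OF n(2)] good[rule_format, of n k] by (intro add_mono) (simp_all add: commute[of x])
        finally show "d x (a (y b k)) \<le> (1/2) ^ k + \<epsilon>"
          using N[OF n(1)] by linarith
      qed
      then show "\<exists>x. is_limit b x"
        using xX by (auto simp: is_limit_def)
    qed
    have closed: "{b. r b \<in> C} \<in> sets cantor_measure" if C: "closedin mtopology C" for C
    proof -
      have CX: "C \<subseteq> X"
        using closedin_subset[OF C] by simp
      have r_iff: "r b \<in> C \<longleftrightarrow> (\<forall>k. \<exists>c\<in>C. d c (a (y b k)) \<le> 2 * (1/2) ^ k)" if b: "\<exists>x. is_limit b x" for b
      proof
        have lim: "d (r b) (a (y b k)) \<le> (1/2) ^ k" for k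
          using b limit_r unfolding is_limit_def by blast
        show "\<forall>k. \<exists>c\<in>C. d c (a (y b k)) \<le> 2 * (1/2) ^ k" if "r b \<in> C"
        proof (intro allI bexI[OF _ that])
          fix k
          show "d (r b) (a (y b k)) \<le> 2 * (1/2) ^ k"
            using lim[of k] zero_le_power[of "1/2::real" k] by linarith
        qed
        assume *: "\<forall>k. \<exists>c\<in>C. d c (a (y b k)) \<le> 2 * (1/2) ^ k"
        show "r b \<in> C"
        proof (rule closedin_approximable[OF C rX])
          fix k
          obtain c where c: "c \<in> C" "d c (a (y b k)) \<le> 2 * (1/2) ^ k"
            using * by blast
          have "d c (r b) \<le> d c (a (y b k)) + d (a (y b k)) (r b)"
            using c(1) CX rX aX by (intro triangle) auto
          also have "\<dots> \<le> 2 * (1/2) ^ k + (1/2) ^ k"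
            using c(2) lim[of k] by (intro add_mono) (simp_all add: commute)
          finally show "\<exists>c\<in>C. d c (r b) \<le> 3 * (1/2) ^ k"
            using c(1) by (intro bexI[of _ c]) auto
        qed
      qed
      have "r b \<in> C \<longleftrightarrow> (if \<forall>k l. d (a (y b k)) (a (y b l)) \<le> (1/2) ^ k + (1/2) ^ l
          then \<forall>k. \<exists>c\<in>C. d c (a (y b k)) \<le> 2 * (1/2) ^ k else x0 \<in> C)" for b
        unfolding good_iff[symmetric] using r_iff[of b] by (simp add: r_def)
      then have eq: "{b. r b \<in> C} = {b \<in> space cantor_measure. if \<forall>k l. d (a (y b k)) (a (y b l)) \<le> (1/2) ^ k + (1/2) ^ l
          then \<forall>k. \<exists>c\<in>C. d c (a (y b k)) \<le> 2 * (1/2) ^ k else x0 \<in> C}"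
        by simp
      have [measurable]: "Measurable.pred cantor_measure (\<lambda>b. d (a (y b k)) (a (y b l)) \<le> (1/2) ^ k + (1/2) ^ l)" for k l
        by (rule measurable_compose_countable'[where I = UNIV and f = "\<lambda>n b. d (a n) (a (y b l)) \<le> (1/2) ^ k + (1/2) ^ l", OF _ y_meas])
          (auto intro: measurable_compose[OF y_meas])
      have [measurable]: "Measurable.pred cantor_measure (\<lambda>b. \<exists>c\<in>C. d c (a (y b k)) \<le> 2 * (1/2) ^ k)" for k
        by (rule measurable_compose[OF y_meas]) simp
      show ?thesis
        unfolding eq by measurable
    qed
    fix U assume "U \<in> {U. openin T U}"
    then have "closedin mtopology (X - U)"
      using closedin_diff[OF closedin_topspace, of mtopology U] by (simp add: TX)
    then have "space cantor_measure - {b. r b \<in> X - U} \<in> sets cantor_measure"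
      by (intro sets.compl_sets closed)
    moreover have "r -` U \<inter> space cantor_measure = space cantor_measure - {b. r b \<in> X - U}"
      using rX by auto
    ultimately show "r -` U \<inter> space cantor_measure \<in> sets cantor_measure"
      by simp
  qed
  ultimately show ?thesis
    using r_e by (rule that)
qed

text \<open>Composing the embedding with quaternary expansion gives an injection into the real line. A point of
positive measure on the line would pull back to a single point of \<open>M\<close> of positive measure, which
is an atom.\<close>

lemma standard_Borel_iso_cantor:
  assumes M: "standard_Borel M" "prob_space M" "non_atomic M"
  shows "\<exists>\<phi> \<psi>. iso_mod0 M cantor_measure \<phi> \<psi>"
proof -
  interpret M: prob_space M by fact
  obtain e r where e: "e \<in> M \<rightarrow>\<^sub>M cantor_measure" and r: "r \<in> cantor_measure \<rightarrow>\<^sub>M M"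
    and r_e: "\<And>x. x \<in> space M \<Longrightarrow> r (e x) = x"
    using standard_Borel_embedding[OF M(1) M.not_empty] by blast
  let ?\<phi> = "quaternary_value \<circ> e" and ?\<psi> = "r \<circ> quaternary_digits"
  define \<nu> where "\<nu> = distr M borel ?\<phi>"
  have \<phi>: "?\<phi> \<in> M \<rightarrow>\<^sub>M borel" and \<psi>: "?\<psi> \<in> borel \<rightarrow>\<^sub>M M"
    using e r measurable_quaternary_value measurable_quaternary_digits by (auto intro: measurable_comp)
  have left: "?\<psi> (?\<phi> x) = x" if "x \<in> space M" for x
    using r_e[OF that] by (simp add: quaternary_digits_value)
  have sets: "sets \<nu> = sets borel"
    by (simp add: \<nu>_def)
  have iso: "iso_mod0 M \<nu> ?\<phi> ?\<psi>"
  proof (rule iso_mod0I)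
    show "?\<phi> \<in> M \<rightarrow>\<^sub>M \<nu>" "?\<psi> \<in> \<nu> \<rightarrow>\<^sub>M M"
      using \<phi> \<psi> by (simp_all add: measurable_cong_sets[OF refl sets] measurable_cong_sets[OF sets refl])
    show "distr M \<nu> ?\<phi> = \<nu>"
      unfolding \<nu>_def by (rule distr_cong) simp_all
    show "AE x in M. ?\<psi> (?\<phi> x) = x"
      using left by (intro AE_I2)
    have "(\<lambda>y. ?\<phi> (?\<psi> y)) \<in> borel_measurable borel"
      using measurable_compose[OF \<psi> \<phi>] .
    from borel_measurable_eq[OF this measurable_ident_sets[OF refl]]
    show "{y \<in> space \<nu>. ?\<phi> (?\<psi> y) = y} \<in> sets \<nu>"
      by (simp add: sets sets_eq_imp_space_eq[OF sets])
  qed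
  have "measure \<nu> {t} = 0" for t
  proof (rule ccontr)
    assume "measure \<nu> {t} \<noteq> 0"
    define A where "A = ?\<phi> -` {t} \<inter> space M"
    have A: "A \<in> sets M"
      unfolding A_def by (rule measurable_sets[OF \<phi>]) simp
    have "measure \<nu> {t} = measure M A"
      unfolding \<nu>_def A_def by (rule measure_distr[OF \<phi>]) simp
    then have "emeasure M A > 0"
      using \<open>measure \<nu> {t} \<noteq> 0\<close> by (simp add: M.emeasure_eq_measure zero_less_measure_iff)
    moreover have "B = {} \<or> B = A" if "B \<subseteq> A" for B
    proof -
      have "x = ?\<psi> t" if "x \<in> A" for x
      proof -
        have "?\<phi> x = t" "x \<in> space M"
          using that by (simp_all add: A_def)
        then show ?thesis
          using left[of x] by simp
      qed
      then show ?thesis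
        using \<open>B \<subseteq> A\<close> by blast
    qed
    ultimately show False
      using M(3) A unfolding non_atomic_def by (metis emeasure_empty)
  qed
  moreover have "real_distribution \<nu>"
    unfolding \<nu>_def using \<phi> by (rule M.real_distribution_distr)
  ultimately obtain q f where "iso_mod0 unit_interval \<nu> q f"
    using iso_unit_interval_real by blast
  from iso_mod0_trans[OF iso_mod0_trans[OF iso iso_mod0_sym[OF this]] iso_unit_interval_cantor]
  show ?thesis
    by blast
qed

lemma cyclically_dense_Aut:
  assumes "standard_Borel M" "prob_space M" "non_atomic M"
  shows "cyclically_dense_conjugacy_classes (Aut M) (Aut_topology M)"
proof -
  obtain \<phi> \<psi> where "iso_mod0 M cantor_measure \<phi> \<psi>"
    using standard_Borel_iso_cantor[OF assms] by blast
  then obtain g h where "dense_conjugates M g h"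
    using iso_mod0.transfer_dense_conjugates cantor_dense_conjugates by metis
  then show ?thesis
    by (rule cyclically_dense_AutI[OF assms(2)])
qed

section \<open>The four groups\<close>

theorem theorem2p10:
  fixes M :: "'a measure"
  shows "(cyclically_dense_conjugacy_classes H_cantor
            (uniform_convergence_topology (carrier H_cantor)) \<and>
          topologically_2_generated H_cantor
            (uniform_convergence_topology (carrier H_cantor))) \<and>
         (cyclically_dense_conjugacy_classes H_cantor_measure
            (uniform_convergence_topology (carrier H_cantor_measure)) \<and>
          topologically_2_generated H_cantor_measure
            (uniform_convergence_topology (carrier H_cantor_measure))) \<and>
         (standard_Borel M \<and> prob_space M \<and> non_atomic M \<longrightarrow>
          cyclically_dense_conjugacy_classes (Aut M) (Aut_topology M) \<and>
          topologically_2_generated (Aut M) (Aut_topology M)) \<and>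
         (cyclically_dense_conjugacy_classes Aut_tree Aut_tree_topology \<and>
          topologically_2_generated Aut_tree Aut_tree_topology)"
  using cyclically_dense_H_cantor cyclically_dense_H_cantor_measure cyclically_dense_Aut[of M]
    cyclically_dense_Aut_tree
    group.topologically_2_generated_if_cyclically_dense[OF group_H_cantor
      topspace_uniform_convergence_topology cyclically_dense_H_cantor]
    group.topologically_2_generated_if_cyclically_dense[OF group_H_cantor_measure
      topspace_uniform_convergence_topology cyclically_dense_H_cantor_measure]
    group.topologically_2_generated_if_cyclically_dense[OF group_Aut topspace_Aut_topology, of M]
    group.topologically_2_generated_if_cyclically_dense[OF group_Aut_tree
      topspace_Aut_tree_topology cyclically_dense_Aut_tree]
  by blast

end
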